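(* Let $n\ge 1$, $\alpha>0$, and let $\mu$ be a positive Borel measure on $\mathbb{C}^n$ such that $\int_{\mathbb{C}^n}|K_{ph,\alpha}(z,w)|^2e^{-|w|^2/\alpha}\,d\mu(w)<\infty$ for every $z\in\mathbb{C}^n$. Then the Toeplitz operator $T_\mu$ is bounded on $\mathcal{PH}^2_\alpha(\mathbb{C}^n)$ if and only if $\mu$ is a $2$-Carleson measure for $\mathcal{PH}^2_\alpha(\mathbb{C}^n)$.
   Context: $dA$ is Lebesgue measure on $\mathbb{C}^n$, and $z\bar w=\sum_{j=1}^n z_j\overline{w_j}$. A function $f:\mathbb{C}^n\to\mathbb{C}$ is pluriharmonic if $\partial^2 f/\partial z_j\partial\bar z_k=0$ for all $j,k$; equivalently $f=g+\bar h$ with $g,h$ entire. For $p>0$, $L^p_\alpha$ is the space of measurable $f$ on $\mathbb{C}^n$ with $\|f\|_{p,\alpha}^p=\frac{p^n}{(2\pi\alpha)^n}\int_{\mathbb{C}^n}|f(z)e^{-|z|^2/(2\alpha)}|^p\,dA(z)<\infty$, and $\mathcal{PH}^p_\alpha(\mathbb{C}^n)$ is the subspace of pluriharmonic functions in $L^p_\alpha$. $\mathcal{PH}^2_\alpha(\mathbb{C}^n)$ is a Hilbert space with inner product $\langle f,g\rangle=\frac{1}{(\alpha\pi)^n}\int f\bar g\,e^{-|z|^2/\alpha}\,dA$ and reproducing kernel $K_{ph,\alpha}(z,w)=e^{z\bar w/\alpha}+e^{\bar z w/\alpha}-1$. The Toeplitz operator with symbol $\mu$ is $T_\mu f(z)=\int_{\mathbb{C}^n}K_{ph,\alpha}(z,w)f(w)e^{-|w|^2/\alpha}\,d\mu(w)$,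 which is defined at least for $f$ in the linear span of the kernels $K_{ph,\alpha}(\cdot,w)$, $w\in\mathbb{C}^n$ (a dense subspace of $\mathcal{PH}^2_\alpha(\mathbb{C}^n)$); it is called bounded if it extends to a bounded operator on $\mathcal{PH}^2_\alpha(\mathbb{C}^n)$. For $1\le p<\infty$, $\mu$ is a $p$-Carleson measure for $\mathcal{PH}^p_\alpha(\mathbb{C}^n)$ if there is $C>0$ with $\left(\int_{\mathbb{C}^n}|f(z)e^{-|z|^2/(2\alpha)}|^p\,d\mu(z)\right)^{1/p}\le C\|f\|_{p,\alpha}$ for all $f\in\mathcal{PH}^p_\alpha(\mathbb{C}^n)$. *)

theory Defs
  imports "HOL-Analysis.Analysis"
begin

definition C1_fun :: "(complex^'n \<Rightarrow> complex) \<Rightarrow> bool" where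
  "C1_fun f \<longleftrightarrow> (\<forall>z. f differentiable (at z)) \<and>
     (\<forall>v. continuous_on UNIV (\<lambda>z. frechet_derivative f (at z) v))"

definition C2_fun :: "(complex^'n \<Rightarrow> complex) \<Rightarrow> bool" where
  "C2_fun f \<longleftrightarrow> C1_fun f \<and> (\<forall>v. C1_fun (\<lambda>z. frechet_derivative f (at z) v))"

text \<open>Wirtinger derivatives. The vectors \<open>axis j 1\<close> and \<open>axis j \<i>\<close> are the real directions
  \<open>x\<^sub>j\<close> and \<open>y\<^sub>j\<close> of the coordinate \<open>z\<^sub>j = x\<^sub>j + \<i> y\<^sub>j\<close>; \<^const>\<open>frechet_derivative\<close> is the
  real derivative.\<close>

definition wirtinger_dz :: "'n \<Rightarrow> (complex^'n \<Rightarrow> complex) \<Rightarrow> complex^'n \<Rightarrow> complex" where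
  "wirtinger_dz j f z =
     (frechet_derivative f (at z) (axis j 1) - \<i> * frechet_derivative f (at z) (axis j \<i>)) / 2"

definition wirtinger_dzbar :: "'n \<Rightarrow> (complex^'n \<Rightarrow> complex) \<Rightarrow> complex^'n \<Rightarrow> complex" where
  "wirtinger_dzbar j f z =
     (frechet_derivative f (at z) (axis j 1) + \<i> * frechet_derivative f (at z) (axis j \<i>)) / 2"

definition pluriharmonic :: "(complex^'n \<Rightarrow> complex) \<Rightarrow> bool" where
  "pluriharmonic f \<longleftrightarrow> C2_fun f \<and> (\<forall>j k z. wirtinger_dz j (wirtinger_dzbar k f) z = 0)"

definition Lp_space :: "real \<Rightarrow> real \<Rightarrow> (complex^'n \<Rightarrow> complex) set" where
  "Lp_space p \<alpha> = {f. f \<in> borel_measurable lborel \<and>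
     integrable lborel (\<lambda>z. norm (f z * exp (- (norm z)\<^sup>2 / (2 * \<alpha>))) powr p)}"

definition Lp_norm :: "real \<Rightarrow> real \<Rightarrow> (complex^'n \<Rightarrow> complex) \<Rightarrow> real" where
  "Lp_norm p \<alpha> f =
     (p ^ CARD('n) / (2 * pi * \<alpha>) ^ CARD('n) *
       (\<integral>z. norm (f z * exp (- (norm z)\<^sup>2 / (2 * \<alpha>))) powr p \<partial>lborel)) powr (1 / p)"

text \<open>Pluriharmonic functions are continuous, so the elements of this space are genuine functions
  and no almost-everywhere classes are needed.\<close>

definition PH_space :: "real \<Rightarrow> real \<Rightarrow> (complex^'n \<Rightarrow> complex) set" where
  "PH_space p \<alpha> = {f \<in> Lp_space p \<alpha>. pluriharmonic f}"

definition herm :: "complex^'n \<Rightarrow> complex^'n \<Rightarrow> complex" where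
  "herm z w = (\<Sum>j\<in>UNIV. z $ j * cnj (w $ j))"

text \<open>\<open>herm w z\<close> is the conjugate of \<open>herm z w\<close>, so the two exponentials below are conjugate.\<close>

definition K_ph :: "real \<Rightarrow> complex^'n \<Rightarrow> complex^'n \<Rightarrow> complex" where
  "K_ph \<alpha> z w = exp (herm z w / \<alpha>) + exp (herm w z / \<alpha>) - 1"

definition kernel_span :: "real \<Rightarrow> (complex^'n \<Rightarrow> complex) set" where
  "kernel_span \<alpha> = {f. \<exists>W c. finite W \<and> f = (\<lambda>z. \<Sum>w\<in>W. c w * K_ph \<alpha> z w)}"

definition toeplitz ::
  "real \<Rightarrow> (complex^'n) measure \<Rightarrow> (complex^'n \<Rightarrow> complex) \<Rightarrow> complex^'n \<Rightarrow> complex" where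
  "toeplitz \<alpha> \<mu> f z = (\<integral>w. K_ph \<alpha> z w * f w * exp (- (norm w)\<^sup>2 / \<alpha>) \<partial>\<mu>)"

definition bounded_operator_PH2 ::
  "real \<Rightarrow> ((complex^'n \<Rightarrow> complex) \<Rightarrow> complex^'n \<Rightarrow> complex) \<Rightarrow> bool" where
  "bounded_operator_PH2 \<alpha> S \<longleftrightarrow>
     (\<forall>f\<in>PH_space 2 \<alpha>. S f \<in> PH_space 2 \<alpha>) \<and>
     (\<forall>f\<in>PH_space 2 \<alpha>. \<forall>g\<in>PH_space 2 \<alpha>. S (\<lambda>z. f z + g z) = (\<lambda>z. S f z + S g z)) \<and>
     (\<forall>f\<in>PH_space 2 \<alpha>. \<forall>c. S (\<lambda>z. c * f z) = (\<lambda>z. c * S f z)) \<and>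
     (\<exists>C. \<forall>f\<in>PH_space 2 \<alpha>. Lp_norm 2 \<alpha> (S f) \<le> C * Lp_norm 2 \<alpha> f)"

definition toeplitz_bounded :: "real \<Rightarrow> (complex^'n) measure \<Rightarrow> bool" where
  "toeplitz_bounded \<alpha> \<mu> \<longleftrightarrow>
     (\<exists>S. bounded_operator_PH2 \<alpha> S \<and> (\<forall>f\<in>kernel_span \<alpha>. S f = toeplitz \<alpha> \<mu> f))"

text \<open>The integrability conjunct expresses that the integral on the left is finite; without it the
  Bochner integral would silently be \<open>0\<close>.\<close>

definition carleson :: "real \<Rightarrow> real \<Rightarrow> (complex^'n) measure \<Rightarrow> bool" where
  "carleson p \<alpha> \<mu> \<longleftrightarrow> (\<exists>C>0. \<forall>f\<in>PH_space p \<alpha>.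
     integrable \<mu> (\<lambda>z. norm (f z * exp (- (norm z)\<^sup>2 / (2 * \<alpha>))) powr p) \<and>
     (\<integral>z. norm (f z * exp (- (norm z)\<^sup>2 / (2 * \<alpha>))) powr p \<partial>\<mu>) powr (1 / p) \<le> C * Lp_norm p \<alpha> f)"

end

theory Submission
  imports Defs "HOL-Complex_Analysis.Cauchy_Integral_Formula"
begin

text \<open>A pluriharmonic function in \<open>L\<^sup>2\<close> is \<open>g + cnj h\<close> with \<open>g\<close> and \<open>h\<close> holomorphic and \<open>h 0 = 0\<close>; the two
  parts are orthogonal with respect to every radial weight, hence both are in \<open>L\<^sup>2\<close>, and the mean value
  property yields the reproducing property of the kernel. If \<open>T\<close> is bounded, then for \<open>f\<close> in the span of the
  kernels \<open>\<parallel>f\<parallel>\<^sup>2\<close> in \<open>L\<^sup>2(\<mu>)\<close>, with the Gaussian weight, is \<open>\<langle>T f, f\<rangle> \<le> C \<parallel>f\<parallel>\<^sup>2\<close>. A general \<open>f\<close> is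
  the limit of the projections of its truncations to balls, these are limits of Riemann sums in the
  span, and Fatou's lemma carries the inequality over. Conversely, if \<open>\<mu>\<close> is a Carleson measure, then
  \<open>\<langle>T f, \<phi>\<rangle>\<close> equals the pairing in \<open>L\<^sup>2(\<mu>)\<close> of \<open>f\<close> with the projection of \<open>\<phi>\<close>, and taking for \<open>\<phi>\<close> the
  truncations of \<open>T f\<close> bounds \<open>\<parallel>T f\<parallel>\<close>.\<close>

section \<open>Rotation invariance of Lebesgue measure\<close>

text \<open>The obstacle throughout is integrability that is not known in advance. That g h is
  integrable is clear only once g and h are known to lie in L2, and that T f lies in L2 is a
  conclusion; so the orthogonality of g and cnj h and the duality bound for T f are first run on
  balls, with bounds independent of the radius, and Fatou's lemma then yields integrability and
  estimate together. The same lemma crosses from the span to the whole space: pointwise convergence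
  and convergent bounds on the Lebesgue side suffice, and no convergence in L2(\<mu>) has to be
  known. From Carleson to Toeplitz another gap must be closed: T f has to be differentiable and
  Fubini's theorem has to apply. Testing the Carleson inequality on single exponentials provides all
  exponential moments of the Gaussian-weighted \<mu>, which settles both. The constant in the
  reproducing formula is the total Gaussian mass; it is carried along as \<open>gauss_mass\<close>,
  and only its positivity matters. No abstract Hilbert space theory is invoked: the orthogonal
  projection is the explicit integral against the kernel, divided by that mass.\<close>

text \<open>Such a map only relabels coordinates, so the preimage of a box is a box with permuted
  side lengths, and Lebesgue measure is determined by its values on boxes. This carries results
  between two Euclidean spaces of equal dimension.\<close>

lemma lborel_distr_basis_isomorphism:
  fixes f :: "'a::euclidean_space \<Rightarrow> 'b::euclidean_space"
  assumes lin: "linear f" and bij: "bij_betw f Basis Basis"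
    and iso: "\<And>x y. f x \<bullet> f y = x \<bullet> y"
  shows "distr lborel borel f = lborel"
proof (rule lborel_eqI[symmetric])
  have [measurable]: "f \<in> borel_measurable borel"
    using lin by (simp add: borel_measurable_continuous_onI linear_continuous_on linear_linear)
  fix l u :: 'b assume lu: "\<And>b. b \<in> Basis \<Longrightarrow> l \<bullet> b \<le> u \<bullet> b"
  define l' where "l' = (\<Sum>b\<in>Basis. (l \<bullet> f b) *\<^sub>R b)"
  define u' where "u' = (\<Sum>b\<in>Basis. (u \<bullet> f b) *\<^sub>R b)"
  have B: "f b \<in> Basis" if "b \<in> Basis" for b using bij that by (auto simp: bij_betw_def)
  have l': "l' \<bullet> b = l \<bullet> f b" and u': "u' \<bullet> b = u \<bullet> f b" if "b \<in> Basis" for b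
    using that by (simp_all add: l'_def u'_def)
  have "f -` box l u = box l' u'"
  proof (intro set_eqI)
    fix x
    have "f x \<in> box l u \<longleftrightarrow> (\<forall>b\<in>f ` Basis. l \<bullet> b < f x \<bullet> b \<and> f x \<bullet> b < u \<bullet> b)"
      using bij by (simp add: mem_box bij_betw_def)
    also have "\<dots> \<longleftrightarrow> x \<in> box l' u'" by (auto simp: mem_box iso l' u')
    finally show "x \<in> f -` box l u \<longleftrightarrow> x \<in> box l' u'" by simp
  qed
  then have "emeasure (distr lborel borel f) (box l u) = emeasure lborel (box l' u')"
    by (simp add: emeasure_distr)
  also have "\<dots> = (\<Prod>b\<in>Basis. (u' - l') \<bullet> b)"
    by (rule emeasure_lborel_box) (simp add: l' u' lu B)
  also have "(\<Prod>b\<in>Basis. (u' - l') \<bullet> b) = (\<Prod>b\<in>Basis. (u - l) \<bullet> f b)"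
    by (intro prod.cong) (auto simp: inner_diff_left l' u')
  also have "\<dots> = (\<Prod>b\<in>Basis. (u - l) \<bullet> b)"
    using prod.reindex_bij_betw[OF bij, of "\<lambda>b. (u - l) \<bullet> b"] by simp
  finally show "emeasure (distr lborel borel f) (box l u) = (\<Prod>b\<in>Basis. (u - l) \<bullet> b)" .
qed simp

text \<open>Invariance of Lebesgue measure under orthogonal images is applied to the inverse map,
  whose image of a box is the preimage wanted here. Borel measurability of that set allows
  \<open>lebesgue\<close> and \<open>lborel\<close> to be interchanged on it.\<close>

lemma lborel_distr_orthogonal_cart:
  fixes f :: "real^'m::{finite,wellorder} \<Rightarrow> real^'m::_"
  assumes f: "orthogonal_transformation f"
  shows "distr lborel borel f = lborel"
proof (rule lborel_eqI[symmetric])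
  have [measurable]: "f \<in> borel_measurable borel"
    using orthogonal_transformation_linear[OF f]
    by (simp add: borel_measurable_continuous_onI linear_continuous_on linear_linear)
  fix l u :: "real^'m::_" assume lu: "\<And>b. b \<in> Basis \<Longrightarrow> l \<bullet> b \<le> u \<bullet> b"
  have g: "orthogonal_transformation (inv f)" by (rule orthogonal_transformation_inv[OF f])
  have "f -` box l u = inv f ` box l u"
    using orthogonal_transformation_bij[OF f] by (simp add: bij_vimage_eq_inv_image)
  moreover have m: "inv f ` box l u \<in> lmeasurable" 
    by (rule measurable_orthogonal_image[OF g]) simp
  moreover have "inv f ` box l u \<in> sets borel"
    unfolding calculation(1)[symmetric] by (rule measurable_sets_borel[of f borel]) simp_all
  ultimately have "emeasure (distr lborel borel f) (box l u) = emeasure lebesgue (inv f ` box l u)"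
    by (simp add: emeasure_distr)
  also have "\<dots> = ennreal (measure lebesgue (inv f ` box l u))"
    using m by (simp add: emeasure_eq_measure2)
  also have "\<dots> = ennreal (measure lebesgue (box l u))"
    by (subst measure_orthogonal_image[OF g]) simp_all
  also have "\<dots> = (\<Prod>b\<in>Basis. (u - l) \<bullet> b)"
    by (simp add: measure_lborel_box lu)
  finally show "emeasure (distr lborel borel f) (box l u) = (\<Prod>b\<in>Basis. (u - l) \<bullet> b)" .
qed simp

text \<open>The library proves this for \<open>real ^ 'm\<close> with \<open>'m\<close> a finite wellorder only; it is transported
  along coordinates with respect to an enumeration of the basis by \<open>'m\<close>.\<close>

lemma lborel_distr_orthogonal:
  fixes r :: "'a::euclidean_space \<Rightarrow> 'a"
  assumes r: "orthogonal_transformation r" and dim: "DIM('a) = CARD('m::{finite,wellorder})"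
  shows "distr lborel borel r = lborel"
proof -
  obtain \<beta> :: "'m \<Rightarrow> 'a" where \<beta>: "bij_betw \<beta> UNIV Basis"
    using finite_same_card_bij[of "UNIV :: 'm set" "Basis :: 'a set"] dim by auto
  have \<beta>B: "\<beta> i \<in> Basis" for i using \<beta> by (auto simp: bij_betw_def)
  define f where "f = (\<lambda>x. \<chi> i. x \<bullet> \<beta> i)"
  have lf: "linear f" by (rule linearI) (auto simp: f_def vec_eq_iff inner_add_left)
  have inn: "f x \<bullet> f y = x \<bullet> y" for x y
  proof -
    have "f x \<bullet> f y = (\<Sum>i\<in>UNIV. (x \<bullet> \<beta> i) * (y \<bullet> \<beta> i))" by (simp add: inner_vec_def f_def)
    also have "\<dots> = (\<Sum>b\<in>Basis. (x \<bullet> b) * (y \<bullet> b))"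
      using sum.reindex_bij_betw[OF \<beta>, of "\<lambda>b. (x \<bullet> b) * (y \<bullet> b)"] by simp
    finally show ?thesis by (simp add: euclidean_inner[of x y])
  qed
  have nf: "norm (f x) = norm x" for x by (simp add: norm_eq_sqrt_inner inn)
  have injf: "inj f"
    unfolding linear_injective_0[OF lf] by (metis norm_eq_zero nf)
  have f\<beta>: "f (\<beta> i) = axis i 1" for i
  proof -
    have "\<beta> i \<bullet> \<beta> j = (if j = i then 1 else 0)" for j
      using \<beta>B \<beta> by (auto simp: inner_Basis bij_betw_def inj_def)
    then show ?thesis by (simp add: f_def vec_eq_iff axis_def)
  qed
  have "f ` Basis = f ` range \<beta>" using \<beta> by (simp add: bij_betw_def)
  also have "\<dots> = range (\<lambda>i. axis i 1)" by (simp add: image_image f\<beta>)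
  also have "\<dots> = Basis" by (auto simp: Basis_vec_def)
  finally have fB: "bij_betw f Basis Basis"
    using injf by (auto simp: bij_betw_def intro: inj_on_subset)
  have "f (\<Sum>i\<in>UNIV. y $ i *\<^sub>R \<beta> i) = y" for y
    by (simp add: linear_sum[OF lf] linear_scale[OF lf] f\<beta> vec_eq_iff axis_def if_distrib cong: if_cong)
  then have "surj f" by (rule surjI)
  then have bf: "bij f" using injf by (simp add: bij_def)
  \<comment> \<open>In the coordinates \<open>f\<close> the isometry becomes a linear
    norm-preserving map of \<open>real ^ 'm\<close>; undoing the change of coordinates gives
    \<open>r = inv f \<circ> g \<circ> f\<close>.\<close>
  define g where "g = f \<circ> r \<circ> inv f"
  have lr: "linear r" using r by (rule orthogonal_transformation_linear)
  have fi: "f (inv f x) = x" for x using \<open>surj f\<close> by (rule surj_f_inv_f)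
  have li: "linear (inv f)"
    by (rule linearI; rule injD[OF injf]) (simp_all add: linear_add[OF lf] linear_scale[OF lf] fi)
  have ni: "norm (inv f x) = norm x" for x
    by (metis fi nf)
  have "orthogonal_transformation g"
    using r unfolding orthogonal_transformation g_def
    using lf lr li by (auto intro!: linear_compose simp: nf ni)
  then have dg: "distr lborel borel g = lborel" by (rule lborel_distr_orthogonal_cart)
  have [measurable]: "f \<in> borel_measurable borel" "r \<in> borel_measurable borel"
    "g \<in> borel_measurable borel" "inv f \<in> borel_measurable borel"
    using lf lr li \<open>orthogonal_transformation g\<close>
    by (auto simp: borel_measurable_continuous_onI linear_continuous_on linear_linear orthogonal_transformation_linear)
  have df: "distr lborel borel f = lborel"
    by (intro lborel_distr_basis_isomorphism lf fB inn)
  have "distr lborel borel (inv f) = distr (distr lborel borel f) borel (inv f)" by (simp add: df)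
  also have "\<dots> = lborel" using bf by (simp add: distr_distr o_def bij_is_inj distr_id2)
  finally have di: "distr lborel borel (inv f) = lborel" .
  have "distr lborel borel r = distr (distr lborel borel f) borel (inv f \<circ> g)"
    using bf by (simp add: distr_distr g_def o_def bij_is_inj)
  also have "\<dots> = distr lborel borel (inv f \<circ> g)" by (simp only: df)
  also have "\<dots> = distr (distr lborel borel g) borel (inv f)"
    by (simp add: distr_distr)
  also have "\<dots> = lborel" by (simp add: dg di)
  finally show ?thesis .
qed

lemma linear_vector_scalar_mult: "linear (\<lambda>z::complex^'n. c *s z)"
  by (rule linearI) (auto simp: vec_eq_iff algebra_simps)

lemma norm_vector_scalar_mult: "norm (c *s z) = norm c * norm (z :: complex^'n)"
  by (simp add: norm_vec_def L2_set_def norm_mult power_mult_distrib sum_distrib_left[symmetric] real_sqrt_mult)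

lemma lborel_distr_rotation:
  assumes c: "norm c = 1"
  shows "distr lborel borel (\<lambda>z::complex^'n. c *s z) = lborel"
proof (rule lborel_distr_orthogonal)
  show "orthogonal_transformation (\<lambda>z::complex^'n. c *s z)"
    unfolding orthogonal_transformation by (simp add: linear_vector_scalar_mult norm_vector_scalar_mult c)
  \<comment> \<open>The real dimension is twice \<open>CARD('n)\<close>, and the numeral type
    \<open>'n bit0\<close> is a finite wellorder with that many elements.\<close>
  show "DIM(complex^'n) = CARD('n bit0)" by simp
qed

section \<open>Decomposition of pluriharmonic functions\<close>

lemma has_derivative_line:
  assumes "(f has_derivative D) (at (p + s *\<^sub>R v))"
  shows "((\<lambda>s. f (p + s *\<^sub>R v)) has_vector_derivative D v) (at s)"
proof -
  have "((\<lambda>s. p + s *\<^sub>R v) has_derivative (\<lambda>h. h *\<^sub>R v)) (at s)"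
    by (auto intro!: derivative_eq_intros)
  from diff_chain_at[OF this assms]
  have "((\<lambda>s. f (p + s *\<^sub>R v)) has_derivative (\<lambda>h. D (h *\<^sub>R v))) (at s)" by (simp add: o_def)
  then show ?thesis
    using assms by (simp add: has_vector_derivative_def linear_scale has_derivative_linear)
qed

section \<open>Symmetry of second derivatives and Wirtinger calculus\<close>

text \<open>The mean value theorem is applied along \<open>a\<close> to the increment in direction
  \<open>b\<close>, and then along \<open>b\<close>. The left side is symmetric in \<open>a\<close>
  and \<open>b\<close>, whereas the right side records the order of differentiation.\<close>

lemma second_difference_mean_value:
  fixes f :: "'a::real_normed_vector \<Rightarrow> real"
  assumes f: "\<And>z. (f has_derivative f' z) (at z)"
    and fa: "\<And>z. ((\<lambda>z. f' z a) has_derivative fa z) (at z)"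
    and h: "h > 0"
  obtains \<xi> \<eta> where "0 < \<xi>" "\<xi> < h" "0 < \<eta>" "\<eta> < h"
    "f (z + h *\<^sub>R a + h *\<^sub>R b) - f (z + h *\<^sub>R a) - f (z + h *\<^sub>R b) + f z
      = h * h * fa (z + \<xi> *\<^sub>R a + \<eta> *\<^sub>R b) b"
proof -
  let ?\<phi> = "\<lambda>s. f (z + h *\<^sub>R b + s *\<^sub>R a) - f (z + s *\<^sub>R a)"
  have "DERIV ?\<phi> s :> f' (z + h *\<^sub>R b + s *\<^sub>R a) a - f' (z + s *\<^sub>R a) a" for s
    using has_derivative_line[OF f, where p = "z + h *\<^sub>R b" and s = s and v = a]
      has_derivative_line[OF f, where p = z and s = s and v = a]
    unfolding has_real_derivative_iff_has_vector_derivative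
    by (intro has_vector_derivative_diff)
  from MVT2[OF h this] obtain \<xi> where \<xi>: "0 < \<xi>" "\<xi> < h"
    "?\<phi> h - ?\<phi> 0 = h * (f' (z + h *\<^sub>R b + \<xi> *\<^sub>R a) a - f' (z + \<xi> *\<^sub>R a) a)" by auto
  let ?\<psi> = "\<lambda>t. f' (z + \<xi> *\<^sub>R a + t *\<^sub>R b) a"
  have "DERIV ?\<psi> t :> fa (z + \<xi> *\<^sub>R a + t *\<^sub>R b) b" for t
    using has_derivative_line[OF fa, where p = "z + \<xi> *\<^sub>R a" and s = t and v = b]
    unfolding has_real_derivative_iff_has_vector_derivative .
  from MVT2[OF h this] obtain \<eta> where \<eta>: "0 < \<eta>" "\<eta> < h"
    "?\<psi> h - ?\<psi> 0 = h * fa (z + \<xi> *\<^sub>R a + \<eta> *\<^sub>R b) b" by auto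
  show thesis
    by (rule that[OF \<xi>(1,2) \<eta>(1,2)]) (use \<xi>(3) \<eta>(3) in \<open>simp add: algebra_simps\<close>)
qed

text \<open>Schwarz's theorem: the second difference over the parallelogram with sides
  \<open>h *\<^sub>R a\<close> and \<open>h *\<^sub>R b\<close> is \<open>h * h\<close> times either
  mixed derivative, each taken at a point that tends to \<open>z\<close> as \<open>h\<close>
  shrinks; continuity gives equality at \<open>z\<close>.\<close>

lemma symmetric_second_derivative_real:
  fixes f :: "'a::real_normed_vector \<Rightarrow> real"
  assumes f: "\<And>z. (f has_derivative f' z) (at z)"
    and fa: "\<And>z. ((\<lambda>z. f' z a) has_derivative fa z) (at z)"
    and fb: "\<And>z. ((\<lambda>z. f' z b) has_derivative fb z) (at z)"
    and ca: "continuous_on UNIV (\<lambda>z. fa z b)"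
    and cb: "continuous_on UNIV (\<lambda>z. fb z a)"
  shows "fa z b = fb z a"
proof -
  have "\<exists>p q. norm (p - z) \<le> h * (norm a + norm b) \<and> norm (q - z) \<le> h * (norm a + norm b)
     \<and> fa p b = fb q a" if h: "h > 0" for h
  proof -
    obtain \<xi> \<eta> where 1: "0 < \<xi>" "\<xi> < h" "0 < \<eta>" "\<eta> < h"
      "f (z + h *\<^sub>R a + h *\<^sub>R b) - f (z + h *\<^sub>R a) - f (z + h *\<^sub>R b) + f z
        = h * h * fa (z + \<xi> *\<^sub>R a + \<eta> *\<^sub>R b) b"
      by (rule second_difference_mean_value[OF f fa h])
    obtain \<xi>' \<eta>' where 2: "0 < \<xi>'" "\<xi>' < h" "0 < \<eta>'" "\<eta>' < h"
      "f (z + h *\<^sub>R b + h *\<^sub>R a) - f (z + h *\<^sub>R b) - f (z + h *\<^sub>R a) + f z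
        = h * h * fb (z + \<xi>' *\<^sub>R b + \<eta>' *\<^sub>R a) a"
      by (rule second_difference_mean_value[OF f fb h])
    have "h * h * fa (z + \<xi> *\<^sub>R a + \<eta> *\<^sub>R b) b = h * h * fb (z + \<xi>' *\<^sub>R b + \<eta>' *\<^sub>R a) a"
      using 1(5) 2(5) by (simp add: algebra_simps)
    then have "fa (z + \<xi> *\<^sub>R a + \<eta> *\<^sub>R b) b = fb (z + \<xi>' *\<^sub>R b + \<eta>' *\<^sub>R a) a" using h by simp
    moreover have "norm ((z + s *\<^sub>R c + t *\<^sub>R d) - z) \<le> h * (norm c + norm d)"
      if "0 < s" "s < h" "0 < t" "t < h" for s t c d
    proof -
      have "norm (s *\<^sub>R c + t *\<^sub>R d) \<le> s * norm c + t * norm d"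
        using that by (intro order_trans[OF norm_triangle_ineq]) simp
      also have "\<dots> \<le> h * norm c + h * norm d"
        using that by (intro add_mono mult_right_mono) auto
      finally show ?thesis by (simp add: algebra_simps)
    qed
    from this[OF 1(1-4), of a b] this[OF 2(1-4), of b a]
    have "norm (z + \<xi> *\<^sub>R a + \<eta> *\<^sub>R b - z) \<le> h * (norm a + norm b)"
      "norm (z + \<xi>' *\<^sub>R b + \<eta>' *\<^sub>R a - z) \<le> h * (norm a + norm b)" by (simp_all add: add.commute)
    ultimately show ?thesis by blast
  qed
  then have "\<forall>n. \<exists>p q. norm (p - z) \<le> inverse (real (Suc n)) * (norm a + norm b) \<and>
      norm (q - z) \<le> inverse (real (Suc n)) * (norm a + norm b) \<and> fa p b = fb q a"
    by simp
  then obtain p q where pq: "\<And>n. norm (p n - z) \<le> inverse (real (Suc n)) * (norm a + norm b)"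
      "\<And>n. norm (q n - z) \<le> inverse (real (Suc n)) * (norm a + norm b)" "\<And>n. fa (p n) b = fb (q n) a"
    by metis
  have lim0: "(\<lambda>n. inverse (real (Suc n)) * (norm a + norm b)) \<longlonglongrightarrow> 0"
    using tendsto_mult_left_zero[OF LIMSEQ_inverse_real_of_nat] by simp
  have "p \<longlonglongrightarrow> z" "q \<longlonglongrightarrow> z"
    using Lim_null_comparison[OF always_eventually[OF allI[OF pq(1)]] lim0]
      Lim_null_comparison[OF always_eventually[OF allI[OF pq(2)]] lim0]
    by (simp_all add: LIM_zero_iff)
  then have "(\<lambda>n. fa (p n) b) \<longlonglongrightarrow> fa z b" "(\<lambda>n. fb (q n) a) \<longlonglongrightarrow> fb z a"
    using ca cb by (auto intro: continuous_on_tendsto_compose)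
  then show ?thesis unfolding pq(3) by (rule LIMSEQ_unique)
qed

lemma frechet_derivative_works_C1:
  "C1_fun f \<Longrightarrow> (f has_derivative frechet_derivative f (at z)) (at z)"
  by (simp add: C1_fun_def frechet_derivative_works)

lemma C2_fun_frechet_commute:
  fixes f :: "complex^'n \<Rightarrow> complex"
  assumes "C2_fun f"
  shows "frechet_derivative (\<lambda>z. frechet_derivative f (at z) a) (at z) b
       = frechet_derivative (\<lambda>z. frechet_derivative f (at z) b) (at z) a"
proof -
  let ?D = "\<lambda>a z. frechet_derivative f (at z) a"
  have 1: "C1_fun f" "C1_fun (?D a)" for a using assms by (simp_all add: C2_fun_def)
  note der = frechet_derivative_works_C1[OF 1(1)] frechet_derivative_works_C1[OF 1(2)]
  have cont: "continuous_on UNIV (\<lambda>z. frechet_derivative (?D a) (at z) b)" for a b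
    using 1(2) by (simp add: C1_fun_def)
  have bl: "bounded_linear Re" "bounded_linear Im"
    by (simp_all add: bounded_linear_Re bounded_linear_Im)
  \<comment> \<open>The mean value argument needs real values, so it is run with \<open>P\<close>
    equal to \<open>Re\<close> and to \<open>Im\<close>.\<close>
  have "P (frechet_derivative (?D a) (at z) b) = P (frechet_derivative (?D b) (at z) a)"
    if P: "bounded_linear P" for P :: "complex \<Rightarrow> real"
    by (rule symmetric_second_derivative_real[where f = "\<lambda>z. P (f z)" and f' = "\<lambda>z v. P (?D v z)"])
      (intro bounded_linear.has_derivative[OF P] der bounded_linear.continuous_on[OF P] cont)+
  from this[OF bl(1)] this[OF bl(2)] show ?thesis by (simp add: complex_eq_iff)
qed

text \<open>\<open>pluriharmonic\<close> prescribes one order of the mixed derivatives; the other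
  order is the one that shows each \<open>wirtinger_dz j u\<close> to satisfy the Cauchy-Riemann
  equations.\<close>

lemma wirtinger_commute:
  assumes f: "C2_fun f"
  shows "wirtinger_dzbar k (wirtinger_dz j f) z = wirtinger_dz j (wirtinger_dzbar k f) z"
proof -
  let ?D = "\<lambda>a z. frechet_derivative f (at z) a"
  let ?DD = "\<lambda>a b. frechet_derivative (?D a) (at z) b"
  have der: "(?D a has_derivative ?DD a) (at z)" for a
    using f by (intro frechet_derivative_works_C1) (simp add: C2_fun_def)
  have dz: "frechet_derivative (wirtinger_dz j f) (at z) = (\<lambda>v. (?DD (axis j 1) v - \<i> * ?DD (axis j \<i>) v) / 2)"
    unfolding wirtinger_dz_def
    by (rule frechet_derivative_at[symmetric]) (auto intro!: derivative_eq_intros der)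
  have dzbar: "frechet_derivative (wirtinger_dzbar k f) (at z) = (\<lambda>v. (?DD (axis k 1) v + \<i> * ?DD (axis k \<i>) v) / 2)"
    unfolding wirtinger_dzbar_def
    by (rule frechet_derivative_at[symmetric]) (auto intro!: derivative_eq_intros der)
  show ?thesis
    unfolding wirtinger_dz_def[of j "wirtinger_dzbar k f"] wirtinger_dzbar_def[of k "wirtinger_dz j f"] dz dzbar
    by (simp add: C2_fun_frechet_commute[OF f, of "axis k 1"] C2_fun_frechet_commute[OF f, of "axis k \<i>"]
        field_simps)
qed

text \<open>When all \<open>wirtinger_dzbar\<close> vanish, the real derivative becomes complex
  linear; this is how holomorphy is recognised below.\<close>

lemma frechet_derivative_wirtinger:
  assumes "f differentiable (at z)"
  shows "frechet_derivative f (at z) v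
    = (\<Sum>k\<in>UNIV. v $ k * wirtinger_dz k f z + cnj (v $ k) * wirtinger_dzbar k f z)"
proof -
  let ?D = "frechet_derivative f (at z)"
  have lin: "linear ?D" using assms by (rule linear_frechet_derivative)
  have "v = (\<Sum>k\<in>UNIV. Re (v $ k) *\<^sub>R axis k 1 + Im (v $ k) *\<^sub>R axis k \<i>)"
    by (auto simp: vec_eq_iff axis_def if_distrib complex_eq_iff cong: if_cong)
  then have "?D v = ?D (\<Sum>k\<in>UNIV. Re (v $ k) *\<^sub>R axis k 1 + Im (v $ k) *\<^sub>R axis k \<i>)"
    by (rule arg_cong)
  also have "\<dots> = (\<Sum>k\<in>UNIV. Re (v $ k) *\<^sub>R ?D (axis k 1) + Im (v $ k) *\<^sub>R ?D (axis k \<i>))"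
    by (simp only: linear_sum[OF lin] linear_add[OF lin] linear_scale[OF lin])
  also have "\<dots> = (\<Sum>k\<in>UNIV. v $ k * wirtinger_dz k f z + cnj (v $ k) * wirtinger_dzbar k f z)"
    by (rule sum.cong) (auto simp: wirtinger_dz_def wirtinger_dzbar_def complex_eq_iff field_simps)
  finally show ?thesis .
qed


section \<open>Holomorphy along complex lines and primitives along rays\<close>

text \<open>A one-variable substitute for entire functions on C^n: the only analytic fact used about
  them is the mean value property on complex lines through the origin, and the class is closed under
  products, exponentials and translations.\<close>

definition entire_on_lines :: "(complex^'n \<Rightarrow> complex) \<Rightarrow> bool" where
  "entire_on_lines g \<longleftrightarrow>
     continuous_on UNIV g \<and> (\<forall>a v. (\<lambda>\<zeta>. g (a + \<zeta> *s v)) holomorphic_on UNIV)"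

lemma entire_on_lines_const: "entire_on_lines (\<lambda>z. c)"
  by (simp add: entire_on_lines_def)

lemma entire_on_lines_nth: "entire_on_lines (\<lambda>z. z $ j)"
  by (auto simp: entire_on_lines_def intro!: continuous_intros holomorphic_intros)

lemma entire_on_lines_add:
  "entire_on_lines f \<Longrightarrow> entire_on_lines g \<Longrightarrow> entire_on_lines (\<lambda>z. f z + g z)"
  by (auto simp: entire_on_lines_def intro!: continuous_intros holomorphic_intros)

lemma entire_on_lines_mult:
  "entire_on_lines f \<Longrightarrow> entire_on_lines g \<Longrightarrow> entire_on_lines (\<lambda>z. f z * g z)"
  by (auto simp: entire_on_lines_def intro!: continuous_intros holomorphic_intros)

lemma entire_on_lines_sum:
  "(\<And>j. j \<in> J \<Longrightarrow> entire_on_lines (f j)) \<Longrightarrow> entire_on_lines (\<lambda>z. \<Sum>j\<in>J. f j z)"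
  by (auto simp: entire_on_lines_def intro!: continuous_intros holomorphic_intros)

lemma entire_on_lines_exp:
  "entire_on_lines f \<Longrightarrow> entire_on_lines (\<lambda>z. exp (f z))"
  by (auto simp: entire_on_lines_def intro!: continuous_intros holomorphic_intros)

lemma entire_on_lines_translate:
  assumes "entire_on_lines f"
  shows "entire_on_lines (\<lambda>z. f (a + z))"
proof -
  have f: "continuous_on UNIV f" "(\<lambda>\<zeta>. f ((a + b) + \<zeta> *s v)) holomorphic_on UNIV" for b v
    using assms by (auto simp: entire_on_lines_def)
  have "continuous_on UNIV (\<lambda>z. f (a + z))"
    by (rule continuous_on_compose2[OF f(1)]) (auto intro!: continuous_intros)
  then show ?thesis using f(2) by (simp only: entire_on_lines_def add.assoc simp_thms all_simps)
qed

lemma C1_fun_imp_continuous_on: "C1_fun f \<Longrightarrow> continuous_on A f"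
  unfolding C1_fun_def
  by (meson continuous_at_imp_continuous_on differentiable_imp_continuous_within)

lemma C1_fun_imp_continuous_wirtinger_dz: "C1_fun f \<Longrightarrow> continuous_on UNIV (wirtinger_dz k f)"
  unfolding wirtinger_dz_def by (intro continuous_intros) (auto simp: C1_fun_def)

text \<open>Differentiation under an integral over a compact interval. The vanishing of
  \<open>wirtinger_dzbar\<close> makes the derivative of \<open>A\<close> complex linear, so the
  derivative in \<zeta> is multiplication by a complex number.\<close>

lemma entire_on_lines_integral_rays:
  fixes A :: "complex^'n \<Rightarrow> complex"
  assumes A: "C1_fun A" and dzbar: "\<And>k z. wirtinger_dzbar k A z = 0"
  shows "entire_on_lines (\<lambda>z. integral (cbox 0 1) (\<lambda>t::real. A (t *\<^sub>R z)))"
  unfolding entire_on_lines_def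
proof (intro conjI allI)
  have contA: "continuous_on UNIV A" by (rule C1_fun_imp_continuous_on[OF A])
  show "continuous_on UNIV (\<lambda>z. integral (cbox 0 1) (\<lambda>t::real. A (t *\<^sub>R z)))"
    by (rule integral_continuous_on_param)
      (auto simp: case_prod_beta intro!: continuous_on_compose2[OF contA] continuous_intros)
  fix a v :: "complex^'n"
  define q where "q = (\<lambda>(\<zeta>::complex) (t::real). t *\<^sub>R (a + \<zeta> *s v))"
  have cq: "continuous_on S (\<lambda>x. q (fst x) (snd x))" for S
    unfolding q_def
    by (intro continuous_intros continuous_on_cong[THEN iffD2, OF refl, of _ "\<lambda>x. \<chi> i. fst x * v $ i"])
       (auto simp: vector_scalar_mult_def intro!: continuous_intros)
  have D: "frechet_derivative A (at z) v = (\<Sum>k\<in>UNIV. v $ k * wirtinger_dz k A z)" for z v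
    using A by (subst frechet_derivative_wirtinger) (auto simp: C1_fun_def dzbar)
  show "(\<lambda>\<zeta>. integral (cbox 0 1) (\<lambda>t::real. A (t *\<^sub>R (a + \<zeta> *s v)))) holomorphic_on UNIV"
  proof (rule leibniz_rule_holomorphic)
    fix \<zeta> :: complex and t :: real
    have "((\<lambda>\<zeta>. q \<zeta> t) has_derivative (\<lambda>h. h *s (t *\<^sub>R v))) (at \<zeta>)"
    proof -
      have "bounded_linear (\<lambda>h::complex. h *s (t *\<^sub>R v))"
        unfolding linear_conv_bounded_linear[symmetric]
        by (rule linearI) (auto simp: vec_eq_iff algebra_simps)
      moreover have "q \<zeta> t = t *\<^sub>R a + \<zeta> *s (t *\<^sub>R v)" for \<zeta>
        by (auto simp: q_def vec_eq_iff algebra_simps)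
      ultimately show ?thesis
        by (auto intro!: derivative_eq_intros bounded_linear_imp_has_derivative)
    qed
    from diff_chain_at[OF this frechet_derivative_works_C1[OF A]]
    have "((\<lambda>\<zeta>. A (q \<zeta> t)) has_derivative
        (\<lambda>h. frechet_derivative A (at (q \<zeta> t)) (h *s (t *\<^sub>R v)))) (at \<zeta>)" by (simp add: o_def)
    also have "(\<lambda>h. frechet_derivative A (at (q \<zeta> t)) (h *s (t *\<^sub>R v)))
        = (*) (\<Sum>k\<in>UNIV. (t *\<^sub>R v $ k) * wirtinger_dz k A (q \<zeta> t))"
      by (auto simp: D sum_distrib_left mult_ac)
    finally show "((\<lambda>\<zeta>. A (t *\<^sub>R (a + \<zeta> *s v))) has_field_derivative
        (\<Sum>k\<in>UNIV. (t *\<^sub>R v $ k) * wirtinger_dz k A (q \<zeta> t))) (at \<zeta> within UNIV)"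
      by (simp add: has_field_derivative_def q_def)
  next
    fix \<zeta>
    have "continuous_on (cbox 0 1) (\<lambda>t::real. A (t *\<^sub>R (a + \<zeta> *s v)))"
      by (intro continuous_on_compose2[OF contA] continuous_intros) auto
    then show "(\<lambda>t::real. A (t *\<^sub>R (a + \<zeta> *s v))) integrable_on cbox 0 1"
      by (rule integrable_continuous)
  next
    show "continuous_on (UNIV \<times> cbox 0 1)
       (\<lambda>(\<zeta>, t). \<Sum>k\<in>UNIV. (t *\<^sub>R v $ k) * wirtinger_dz k A (q \<zeta> t))"
      unfolding case_prod_beta
      by (intro continuous_intros continuous_on_compose2[OF C1_fun_imp_continuous_wirtinger_dz[OF A]] cq) auto
  qed simp
qed

text \<open>Both \<open>wirtinger_dz j u\<close> and the conjugate of
  \<open>wirtinger_dzbar j u\<close> satisfy the Cauchy-Riemann equations, the first after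
  exchanging derivatives, the second directly by pluriharmonicity. The fundamental theorem of
  calculus on the segment from 0 to \<open>z\<close> rebuilds \<open>u z - u 0\<close> from their
  integrals over rays; the constant \<open>u 0\<close> is put into \<open>g\<close>, which leaves
  \<open>h 0 = 0\<close>.\<close>

lemma pluriharmonic_decomposition:
  fixes u :: "complex^'n \<Rightarrow> complex"
  assumes u: "pluriharmonic u"
  obtains g h where "entire_on_lines g" "entire_on_lines h" "h 0 = 0" "\<And>z. u z = g z + cnj (h z)"
proof -
  have C2: "C2_fun u" and C1: "C1_fun u" using u by (auto simp: pluriharmonic_def C2_fun_def)
  define A where "A = (\<lambda>j. wirtinger_dz j u)"
  define B where "B = (\<lambda>j z. cnj (wirtinger_dzbar j u z))"
  have C1D: "C1_fun (\<lambda>z. frechet_derivative u (at z) v)" for v using C2 by (simp add: C2_fun_def)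
  have derD: "((\<lambda>z. frechet_derivative u (at z) v) has_derivative
      frechet_derivative (\<lambda>z. frechet_derivative u (at z) v) (at z)) (at z)" for v z
    by (rule frechet_derivative_works_C1[OF C1D])
  have contDD: "continuous_on UNIV (\<lambda>z. frechet_derivative (\<lambda>z. frechet_derivative u (at z) v) (at z) w)" for v w
    using C1D by (simp add: C1_fun_def)
  have fA: "(A j has_derivative
      (\<lambda>w. (frechet_derivative (\<lambda>z. frechet_derivative u (at z) (axis j 1)) (at z) w
        - \<i> * frechet_derivative (\<lambda>z. frechet_derivative u (at z) (axis j \<i>)) (at z) w) / 2)) (at z)" for j z
    unfolding A_def wirtinger_dz_def by (auto intro!: derivative_eq_intros derD)
  have fdbar: "(wirtinger_dzbar j u has_derivative
      (\<lambda>w. (frechet_derivative (\<lambda>z. frechet_derivative u (at z) (axis j 1)) (at z) w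
        + \<i> * frechet_derivative (\<lambda>z. frechet_derivative u (at z) (axis j \<i>)) (at z) w) / 2)) (at z)" for j z
    unfolding wirtinger_dzbar_def by (auto intro!: derivative_eq_intros derD)
  note fB = bounded_linear.has_derivative[OF bounded_linear_cnj fdbar]
  have A: "C1_fun (A j)" for j
    unfolding C1_fun_def frechet_derivative_at[OF fA, symmetric]
    using fA by (auto simp: differentiable_def intro!: continuous_intros contDD)
  have B: "C1_fun (B j)" for j
    unfolding C1_fun_def B_def frechet_derivative_at[OF fB, symmetric]
    using fB by (auto simp: differentiable_def intro!: continuous_intros contDD)
  have "wirtinger_dzbar k (A j) z = 0" for j k z
    using u wirtinger_commute[OF C2, of k j z] by (simp add: A_def pluriharmonic_def)
  note entA = entire_on_lines_integral_rays[OF A this]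
  have "wirtinger_dzbar k (B j) z = cnj (wirtinger_dz k (wirtinger_dzbar j u) z)" for j k z
    unfolding wirtinger_dz_def[of k "wirtinger_dzbar j u"] B_def
      wirtinger_dzbar_def[of k "\<lambda>z. cnj (wirtinger_dzbar j u z)"]
      frechet_derivative_at[OF fB, symmetric] frechet_derivative_at[OF fdbar, symmetric]
    by (simp add: field_simps)
  then have "wirtinger_dzbar k (B j) z = 0" for j k z
    using u by (simp add: pluriharmonic_def)
  note entB = entire_on_lines_integral_rays[OF B this]
  define g where "g = (\<lambda>z. u 0 + (\<Sum>j\<in>UNIV. z $ j * integral (cbox 0 1) (\<lambda>t::real. A j (t *\<^sub>R z))))"
  define h where "h = (\<lambda>z. \<Sum>j\<in>UNIV. z $ j * integral (cbox 0 1) (\<lambda>t::real. B j (t *\<^sub>R z)))"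
  have "u z = g z + cnj (h z)" for z
  proof -
    have contray: "continuous_on (cbox 0 1) (\<lambda>t::real. f (t *\<^sub>R z))" if "C1_fun f" for f :: "complex^'n \<Rightarrow> complex"
      by (rule continuous_on_compose2[OF C1_fun_imp_continuous_on[OF that, of UNIV]]) (auto intro!: continuous_intros)
    have hi: "((\<lambda>t. f (t *\<^sub>R z)) has_integral integral (cbox 0 1) (\<lambda>t::real. f (t *\<^sub>R z))) (cbox 0 1)"
      if "C1_fun f" for f :: "complex^'n \<Rightarrow> complex"
      by (intro integrable_integral integrable_continuous contray that)
    let ?F = "\<lambda>t::real. \<Sum>j\<in>UNIV. z $ j * A j (t *\<^sub>R z) + cnj (z $ j * B j (t *\<^sub>R z))"
    have "((\<lambda>t. u (0 + t *\<^sub>R z)) has_vector_derivative ?F t) (at t)" for t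
      using has_derivative_line[OF frechet_derivative_works_C1[OF C1], where p = 0 and s = t and v = z] C1
      by (simp add: frechet_derivative_wirtinger C1_fun_def A_def B_def)
    then have "(?F has_integral u (1 *\<^sub>R z) - u (0 *\<^sub>R z)) {0..1}"
      by (intro fundamental_theorem_of_calculus) (auto intro: has_vector_derivative_at_within)
    moreover have "(?F has_integral (\<Sum>j\<in>UNIV. z $ j * integral (cbox 0 1) (\<lambda>t::real. A j (t *\<^sub>R z))
        + cnj (z $ j * integral (cbox 0 1) (\<lambda>t::real. B j (t *\<^sub>R z))))) {0..1}"
      unfolding interval_cbox
      by (intro has_integral_sum has_integral_add has_integral_mult_right has_integral_cnj[THEN iffD2, unfolded o_def] hi A B) auto
    ultimately have "u z - u 0 = (\<Sum>j\<in>UNIV. z $ j * integral (cbox 0 1) (\<lambda>t::real. A j (t *\<^sub>R z))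
        + cnj (z $ j * integral (cbox 0 1) (\<lambda>t::real. B j (t *\<^sub>R z))))"
      by (simp add: has_integral_unique)
    then show ?thesis by (simp add: g_def h_def sum.distrib algebra_simps)
  qed
  moreover have "entire_on_lines g" "entire_on_lines h"
    unfolding g_def h_def
    by (intro entire_on_lines_add entire_on_lines_const entire_on_lines_sum entire_on_lines_mult
        entire_on_lines_nth entA entB)+
  moreover have "h 0 = 0" by (simp add: h_def)
  ultimately show thesis by (intro that)
qed

section \<open>Mean values over circles and weighted integrals\<close>

text \<open>Fatou's lemma, with integrability of the limit as part of the conclusion. The bounds
  \<open>A k\<close> may vary with \<open>k\<close>, because in the approximation of projections by
  Riemann sums they are norms that only converge.\<close>

lemma integrable_limit_of_bounded_integrals:
  fixes f :: "'a \<Rightarrow> real"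
  assumes int: "\<And>k. integrable M (F k)" and nonneg: "\<And>k x. 0 \<le> F k x"
    and lim: "\<And>x. (\<lambda>k. F k x) \<longlonglongrightarrow> f x"
    and bound: "\<And>k. integral\<^sup>L M (F k) \<le> A k" and A: "A \<longlonglongrightarrow> a"
  shows "integrable M f" "integral\<^sup>L M f \<le> a"
proof -
  have [measurable]: "F k \<in> borel_measurable M" for k using int by auto
  have [measurable]: "f \<in> borel_measurable M"
    by (rule borel_measurable_LIMSEQ_real[OF lim]) auto
  have f0: "0 \<le> f x" for x by (rule LIMSEQ_le_const[OF lim]) (auto intro: nonneg)
  have "0 \<le> A k" for k
    by (rule order_trans[OF _ bound]) (auto intro!: integral_nonneg_AE nonneg)
  then have a0: "0 \<le> a" by (intro LIMSEQ_le_const[OF A]) auto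
  have "(\<integral>\<^sup>+x. ennreal (f x) \<partial>M) = (\<integral>\<^sup>+x. liminf (\<lambda>k. ennreal (F k x)) \<partial>M)"
    by (intro nn_integral_cong lim_imp_Liminf[symmetric] tendsto_ennrealI lim) simp
  also have "\<dots> \<le> liminf (\<lambda>k. \<integral>\<^sup>+x. ennreal (F k x) \<partial>M)"
    by (rule nn_integral_liminf) simp
  also have "\<dots> \<le> liminf (\<lambda>k. ennreal (A k))"
  proof (rule Liminf_mono, rule always_eventually, rule allI)
    fix k
    have "(\<integral>\<^sup>+x. ennreal (F k x) \<partial>M) = ennreal (integral\<^sup>L M (F k))"
      by (rule nn_integral_eq_integral[OF int]) (simp add: nonneg)
    also have "\<dots> \<le> ennreal (A k)" by (intro ennreal_leI bound)
    finally show "(\<integral>\<^sup>+x. ennreal (F k x) \<partial>M) \<le> ennreal (A k)" .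
  qed
  also have "\<dots> = ennreal a"
    by (intro lim_imp_Liminf tendsto_ennrealI A) simp
  finally have le: "(\<integral>\<^sup>+x. ennreal (f x) \<partial>M) \<le> ennreal a" .
  show "integrable M f"
    by (rule integrableI_bounded) (use le f0 in \<open>auto simp: less_top[symmetric] top_unique\<close>)
  show "integral\<^sup>L M f \<le> a"
    by (rule integral_real_bounded[OF a0 le])
qed

section \<open>Square integrability with a weight and the Cauchy-Schwarz inequality\<close>

lemma integrable_norm_mult_weighted:
  fixes f g :: "'a \<Rightarrow> complex" and w :: "'a \<Rightarrow> real"
  assumes [measurable]: "f \<in> borel_measurable M" "g \<in> borel_measurable M" "w \<in> borel_measurable M"
    and w: "\<And>x. 0 \<le> w x"
    and f: "integrable M (\<lambda>x. (norm (f x))\<^sup>2 * w x)" and g: "integrable M (\<lambda>x. (norm (g x))\<^sup>2 * w x)"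
  shows "integrable M (\<lambda>x. norm (f x) * norm (g x) * w x)"
proof (rule Bochner_Integration.integrable_bound[OF Bochner_Integration.integrable_add[OF f g]])
  show "AE x in M. norm (norm (f x) * norm (g x) * w x) \<le> norm ((norm (f x))\<^sup>2 * w x + (norm (g x))\<^sup>2 * w x)"
  proof (rule AE_I2)
    fix x
    have "norm (f x) * norm (g x) \<le> (norm (f x))\<^sup>2 + (norm (g x))\<^sup>2"
      using sum_squares_bound[of "norm (f x)" "norm (g x)"] mult_nonneg_nonneg[OF norm_ge_zero norm_ge_zero, of "f x" "g x"]
      by linarith
    then show "norm (norm (f x) * norm (g x) * w x) \<le> norm ((norm (f x))\<^sup>2 * w x + (norm (g x))\<^sup>2 * w x)"
      using mult_right_mono[of _ _ "w x"] w[of x] by (simp add: abs_mult distrib_right[symmetric])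
  qed
qed simp

lemma integrable_mult_weighted:
  fixes f g :: "'a \<Rightarrow> complex" and w :: "'a \<Rightarrow> real"
  assumes "f \<in> borel_measurable M" "g \<in> borel_measurable M" "w \<in> borel_measurable M"
    and w: "\<And>x. 0 \<le> w x"
    and "integrable M (\<lambda>x. (norm (f x))\<^sup>2 * w x)" and "integrable M (\<lambda>x. (norm (g x))\<^sup>2 * w x)"
  shows "integrable M (\<lambda>x. f x * g x * w x)"
  by (rule Bochner_Integration.integrable_bound[OF integrable_norm_mult_weighted[OF assms]])
    (use assms in \<open>auto simp: norm_mult w\<close>)

lemma integrable_add_square_weighted:
  fixes f g :: "'a \<Rightarrow> complex" and w :: "'a \<Rightarrow> real"
  assumes [measurable]: "f \<in> borel_measurable M" "g \<in> borel_measurable M" "w \<in> borel_measurable M"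
    and w: "\<And>x. 0 \<le> w x"
    and f: "integrable M (\<lambda>x. (norm (f x))\<^sup>2 * w x)" and g: "integrable M (\<lambda>x. (norm (g x))\<^sup>2 * w x)"
  shows "integrable M (\<lambda>x. (norm (f x + g x))\<^sup>2 * w x)"
proof (rule Bochner_Integration.integrable_bound)
  show "integrable M (\<lambda>x. 2 * ((norm (f x))\<^sup>2 * w x) + 2 * ((norm (g x))\<^sup>2 * w x))"
    using f g by simp
  show "AE x in M. norm ((norm (f x + g x))\<^sup>2 * w x) \<le> norm (2 * ((norm (f x))\<^sup>2 * w x) + 2 * ((norm (g x))\<^sup>2 * w x))"
  proof (rule AE_I2)
    fix x
    have "(norm (f x + g x))\<^sup>2 \<le> (norm (f x) + norm (g x))\<^sup>2"
      by (intro power_mono norm_triangle_ineq) simp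
    also have "\<dots> \<le> 2 * (norm (f x))\<^sup>2 + 2 * (norm (g x))\<^sup>2"
      using sum_squares_bound[of "norm (f x)" "norm (g x)"] by (simp add: power2_sum)
    finally have "(norm (f x + g x))\<^sup>2 * w x \<le> (2 * (norm (f x))\<^sup>2 + 2 * (norm (g x))\<^sup>2) * w x"
      by (rule mult_right_mono[OF _ w])
    then show "norm ((norm (f x + g x))\<^sup>2 * w x) \<le> norm (2 * ((norm (f x))\<^sup>2 * w x) + 2 * ((norm (g x))\<^sup>2 * w x))"
      using w[of x] by (simp add: abs_mult distrib_right)
  qed
qed simp

text \<open>Cauchy-Schwarz for nonnegative integrals, after distributing \<open>sqrt (w x)\<close>
  to both factors. The pairing is bilinear; where an inner product is meant, the conjugate is part
  of \<open>f\<close> or \<open>g\<close>.\<close>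

lemma norm_integral_mult_weighted_le:
  fixes f g :: "'a \<Rightarrow> complex" and w :: "'a \<Rightarrow> real"
  assumes [measurable]: "f \<in> borel_measurable M" "g \<in> borel_measurable M" "w \<in> borel_measurable M"
    and w: "\<And>x. 0 \<le> w x"
    and f: "integrable M (\<lambda>x. (norm (f x))\<^sup>2 * w x)" and g: "integrable M (\<lambda>x. (norm (g x))\<^sup>2 * w x)"
  shows "norm (\<integral>x. f x * g x * w x \<partial>M)
    \<le> sqrt (\<integral>x. (norm (f x))\<^sup>2 * w x \<partial>M) * sqrt (\<integral>x. (norm (g x))\<^sup>2 * w x \<partial>M)"
proof -
  let ?I = "\<integral>x. norm (f x) * norm (g x) * w x \<partial>M"
  let ?F = "\<integral>x. (norm (f x))\<^sup>2 * w x \<partial>M" and ?G = "\<integral>x. (norm (g x))\<^sup>2 * w x \<partial>M"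
  have int: "integrable M (\<lambda>x. norm (f x) * norm (g x) * w x)"
    using assms by (rule integrable_norm_mult_weighted)
  have nn: "0 \<le> ?I" "0 \<le> ?F" "0 \<le> ?G" by (auto intro!: integral_nonneg_AE simp: w)
  have "ennreal (?I\<^sup>2) = (\<integral>\<^sup>+x. ennreal (norm (f x) * norm (g x) * w x) \<partial>M)\<^sup>2"
    using nn(1) by (subst nn_integral_eq_integral[OF int]) (auto simp: w ennreal_power)
  also have "\<dots> = (\<integral>\<^sup>+x. ennreal (norm (f x) * sqrt (w x)) * ennreal (norm (g x) * sqrt (w x)) \<partial>M)\<^sup>2"
    by (simp add: ennreal_mult[symmetric] w mult_ac flip: power2_eq_square)
      (simp add: mult.left_commute[of "sqrt _"] w flip: mult.assoc)
  also have "\<dots> \<le> (\<integral>\<^sup>+x. (ennreal (norm (f x) * sqrt (w x)))\<^sup>2 \<partial>M) * (\<integral>\<^sup>+x. (ennreal (norm (g x) * sqrt (w x)))\<^sup>2 \<partial>M)"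
    by (rule Cauchy_Schwarz_nn_integral) auto
  also have "\<dots> = (\<integral>\<^sup>+x. ennreal ((norm (f x))\<^sup>2 * w x) \<partial>M) * (\<integral>\<^sup>+x. ennreal ((norm (g x))\<^sup>2 * w x) \<partial>M)"
    by (simp add: ennreal_power power_mult_distrib w)
  also have "\<dots> = ennreal (?F * ?G)"
    using nn by (subst nn_integral_eq_integral[OF f], simp add: w,
        subst nn_integral_eq_integral[OF g], simp add: w, simp add: ennreal_mult)
  finally have "?I\<^sup>2 \<le> ?F * ?G" using nn by simp
  then have "?I \<le> sqrt (?F * ?G)" by (rule real_le_rsqrt)
  moreover have "norm (\<integral>x. f x * g x * w x \<partial>M) \<le> ?I"
    by (rule order_trans[OF integral_norm_bound]) (simp add: norm_mult w)
  ultimately show ?thesis by (simp add: real_sqrt_mult)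
qed

section \<open>Circle means and averages over rotations\<close>

text \<open>Cauchy's formula at the centre of the unit circle: the factor 1/u cancels against the
  velocity 2 pi i u of the parametrisation.\<close>

lemma circle_mean_value:
  assumes "f holomorphic_on UNIV"
  shows "((\<lambda>t::real. f (exp (2 * of_real pi * \<i> * t))) has_integral f 0) {0..1}"
proof -
  have path: "circlepath 0 1 x = exp (2 * of_real pi * \<i> * x)" for x
    by (simp add: circlepath)
  have "((\<lambda>u. f u / (u - 0)) has_contour_integral 2 * of_real pi * \<i> * f 0) (circlepath 0 1)"
    by (rule Cauchy_integral_circlepath_simple) (auto intro: holomorphic_on_subset[OF assms])
  then have "((\<lambda>t::real. (f (exp (2 * of_real pi * \<i> * t)) / exp (2 * of_real pi * \<i> * t)) *
      (2 * of_real pi * \<i> * exp (2 * of_real pi * \<i> * t))) has_integral 2 * of_real pi * \<i> * f 0) {0..1}"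
    unfolding has_contour_integral_def
    by (rule has_integral_eq[rotated]) (simp add: vector_derivative_circlepath01 path)
  then have "((\<lambda>t::real. (2 * of_real pi * \<i>) * f (exp (2 * of_real pi * \<i> * t))) has_integral
     (2 * of_real pi * \<i>) * f 0) {0..1}" by (simp add: field_simps)
  from has_integral_divide[OF this, of "2 * of_real pi * \<i>"]
  show ?thesis by simp
qed

text \<open>Of a general measure only the equality of its sigma-algebra with the Borel sets is
  known, so the product sigma-algebra must first be identified with the Borel sets of the product
  space.\<close>

lemma continuous_imp_borel_measurable_pair:
  fixes f :: "'a::second_countable_topology \<times> 'b::second_countable_topology \<Rightarrow> 'c::topological_space"
  assumes "continuous_on UNIV f" "sets M = sets borel" "sets N = sets borel"
  shows "f \<in> borel_measurable (M \<Otimes>\<^sub>M N)"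
proof -
  have "sets (M \<Otimes>\<^sub>M N) = sets (borel :: ('a \<times> 'b) measure)"
    unfolding borel_prod[symmetric] by (intro sets_pair_measure_cong assms)
  then show ?thesis
    using borel_measurable_continuous_onI[OF assms(1)] measurable_cong_sets by blast
qed

lemma continuous_on_vector_scalar_mult:
  fixes c :: "'a::topological_space \<Rightarrow> complex" and f :: "'a \<Rightarrow> complex^'n"
  assumes "continuous_on S c" "continuous_on S f"
  shows "continuous_on S (\<lambda>x. c x *s f x)"
  unfolding vector_scalar_mult_def by (intro continuous_intros assms)

lemma
  fixes F :: "complex^'n \<Rightarrow> 'b::{banach, second_countable_topology}"
  assumes F: "integrable lborel F" and c: "norm c = 1"
  shows integrable_rotation: "integrable lborel (\<lambda>z. F (c *s z))"
    and integral_rotation: "(\<integral>z. F (c *s z) \<partial>lborel) = (\<integral>z. F z \<partial>lborel)"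
proof -
  have [measurable]: "(\<lambda>z::complex^'n. c *s z) \<in> borel_measurable borel"
    by (intro borel_measurable_continuous_onI continuous_on_vector_scalar_mult continuous_intros)
  have [measurable]: "F \<in> borel_measurable borel" using F by auto
  show "integrable lborel (\<lambda>z. F (c *s z))"
    using integrable_distr_eq[of "\<lambda>z. c *s z" lborel borel F] F by (simp add: lborel_distr_rotation[OF c])
  show "(\<integral>z. F (c *s z) \<partial>lborel) = (\<integral>z. F z \<partial>lborel)"
    using integral_distr[of "\<lambda>z. c *s z" lborel borel F] by (simp add: lborel_distr_rotation[OF c])
qed

text \<open>Averaging over the rotations \<open>z \<mapsto> c z\<close> with \<open>norm c = 1\<close>, which preserve Lebesgue measure,
  replaces \<open>F\<close> by its mean values over circles about the origin.\<close>

lemma integral_entire_on_lines_radial: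
  fixes F :: "complex^'n \<Rightarrow> complex" and w :: "real \<Rightarrow> real"
  assumes F: "entire_on_lines F" and [measurable]: "w \<in> borel_measurable borel"
    and int: "integrable lborel (\<lambda>z. F z * w (norm z))"
  shows "(\<integral>z. F z * w (norm z) \<partial>lborel) = F 0 * of_real (\<integral>z. w (norm (z :: complex^'n)) \<partial>lborel)"
proof -
  define c where "c = (\<lambda>t::real. exp (2 * of_real pi * \<i> * t) :: complex)"
  have nc: "norm (c t) = 1" for t
    by (simp add: c_def norm_exp_eq_Re)
  have cc: "continuous_on S c" for S unfolding c_def by (intro continuous_intros)
  have contF: "continuous_on UNIV F" using F by (simp add: entire_on_lines_def)
  \<comment> \<open>The indicator turns the average over one period into an integral over the whole
    line, so that Fubini's theorem applies to two copies of \<open>lborel\<close>.\<close>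
  define H where "H = (\<lambda>t (z::complex^'n). indicator {0..1::real} t *\<^sub>R (F (c t *s z) * w (norm z)))"
  have contFc: "continuous_on UNIV (\<lambda>x. F (c (fst x) *s snd x))"
    by (rule continuous_on_compose2[OF contF])
      (auto intro!: continuous_on_vector_scalar_mult continuous_on_compose2[OF cc] continuous_intros)
  have [measurable]: "(\<lambda>x. F (c (fst x) *s snd x)) \<in> borel_measurable (lborel \<Otimes>\<^sub>M lborel)"
    by (rule continuous_imp_borel_measurable_pair[OF contFc]) auto
  have rot: "integrable lborel (\<lambda>z. F (c t *s z) * w (norm z))"
    "(\<integral>z. F (c t *s z) * w (norm z) \<partial>lborel) = (\<integral>z. F z * w (norm z) \<partial>lborel)"
    "(\<integral>z. norm (F (c t *s z) * w (norm z)) \<partial>lborel) = (\<integral>z. norm (F z * w (norm z)) \<partial>lborel)" for t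
    using integrable_rotation[OF int nc[of t]] integral_rotation[OF int nc[of t]]
      integral_rotation[OF integrable_norm[OF int] nc[of t]]
    by (simp_all add: norm_vector_scalar_mult nc)
  have H: "integrable (lborel \<Otimes>\<^sub>M lborel) (case_prod H)"
  proof (rule lborel_pair.Fubini_integrable)
    show "case_prod H \<in> borel_measurable (lborel \<Otimes>\<^sub>M lborel)"
      unfolding H_def case_prod_beta by measurable
    \<comment> \<open>By rotation invariance the inner integral does not depend on \<open>t\<close>
      within the unit interval.\<close>
    have "(\<lambda>t. \<integral>z. norm (case_prod H (t, z)) \<partial>lborel) =
      (\<lambda>t. indicator {0..1} t * (\<integral>z. norm (F z * w (norm z)) \<partial>lborel))"
      by (auto simp: H_def rot(3) split: split_indicator)
    then show "integrable lborel (\<lambda>t. \<integral>z. norm (case_prod H (t, z)) \<partial>lborel)"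
      by simp
    show "AE t in lborel. integrable lborel (\<lambda>z. case_prod H (t, z))"
      by (auto simp: H_def intro!: rot(1))
  qed
  have "(\<integral>z. F z * w (norm z) \<partial>lborel) = (\<integral>t. (\<integral>z. H t z \<partial>lborel) \<partial>lborel)"
    by (simp add: H_def rot(2))
  also have "\<dots> = (\<integral>z. (\<integral>t. H t z \<partial>lborel) \<partial>lborel)"
    using lborel_pair.Fubini_integral[OF H] by simp
  also have "\<dots> = (\<integral>z. F 0 * w (norm (z :: complex^'n)) \<partial>lborel)"
  proof (rule Bochner_Integration.integral_cong[OF refl])
    fix z :: "complex^'n"
    have cont: "continuous_on {0..1} (\<lambda>t. F (c t *s z))"
      by (rule continuous_on_compose2[OF contF]) (auto intro!: continuous_on_vector_scalar_mult cc)
    \<comment> \<open>The points \<open>c t *s z\<close> run through a circle in the complex line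
      spanned by \<open>z\<close>; its centre is the origin.\<close>
    have "((\<lambda>t. F (0 + c t *s z)) has_integral F (0 + 0 *s z)) {0..1}"
      unfolding c_def
      by (rule circle_mean_value[of "\<lambda>\<zeta>. F (0 + \<zeta> *s z)"]) (use F in \<open>simp only: entire_on_lines_def\<close>)
    moreover have "(LINT t:{0..1}|lborel. F (c t *s z)) = integral {0..1} (\<lambda>t. F (c t *s z))"
      by (rule set_borel_integral_eq_integral[OF borel_integrable_atLeastAtMost'[OF cont]])
    ultimately have "(LINT t:{0..1}|lborel. F (c t *s z)) = F 0"
      by (simp add: integral_unique)
    then show "(\<integral>t. H t z \<partial>lborel) = F 0 * w (norm z)"
      by (simp add: H_def set_lebesgue_integral_def flip: mult_scaleR_left)
  qed
  finally show ?thesis by simp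
qed

section \<open>The reproducing property\<close>

definition gauss :: "real \<Rightarrow> complex^'n \<Rightarrow> real" where
  "gauss \<alpha> z = exp (- (norm z)\<^sup>2 / \<alpha>)"

text \<open>Its value is (pi \<alpha>)^n, the factor that normalises the inner product; it is left
  unevaluated. The type argument only records the dimension.\<close>

definition gauss_mass :: "real \<Rightarrow> 'n::finite itself \<Rightarrow> real" where
  "gauss_mass \<alpha> _ = (\<integral>z. gauss \<alpha> (z :: complex^'n) \<partial>lborel)"

lemma gauss_pos [simp]: "0 < gauss \<alpha> z" "0 \<le> gauss \<alpha> z"
  by (simp_all add: gauss_def)

lemma continuous_on_gauss [continuous_intros]: "continuous_on S (gauss \<alpha>)"
  unfolding gauss_def divide_inverse by (intro continuous_intros)

lemma borel_measurable_gauss [measurable]: "gauss \<alpha> \<in> borel_measurable borel"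
  by (intro borel_measurable_continuous_onI continuous_intros)

section \<open>Exponential growth against the Gaussian weight\<close>

lemma integrable_exp_neg_abs: "integrable lborel (\<lambda>x::real. exp (- \<bar>x\<bar>))"
proof -
  have "(\<integral>\<^sup>+x. ennreal (exp (- x)) * indicator {0::real..} x \<partial>lborel) = ennreal (0 - (- exp (- 0)))"
  proof (rule nn_integral_FTC_atLeast)
    show "((\<lambda>x::real. - exp (- x)) \<longlongrightarrow> 0) at_top"
      using tendsto_minus[OF filterlim_compose[OF exp_at_bot filterlim_uminus_at_bot_at_top]] by simp
  qed (auto intro!: derivative_eq_intros)
  then have 1: "integrable lborel (\<lambda>x::real. indicator {0..} x * exp (- x))"
    by (intro integrableI_bounded) (auto simp: mult.commute ennreal_mult'' ennreal_indicator)
  have "integrable lborel (\<lambda>x::real. indicator {0..} (- x) * exp (- (- x)))"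
    using lborel_integrable_real_affine[OF 1, of "-1" 0] by simp
  from Bochner_Integration.integrable_add[OF 1 this]
  show ?thesis
    by (rule Bochner_Integration.integrable_bound) (auto split: split_indicator)
qed

lemma integrable_exp_neg_sum_abs:
  "integrable lborel (\<lambda>z::'a::euclidean_space. exp (- (\<Sum>b\<in>Basis. \<bar>z \<bullet> b\<bar>)))"
proof (rule integrableI_bounded)
  have "(\<integral>\<^sup>+(z::'a). ennreal (norm (exp (- (\<Sum>b\<in>Basis. \<bar>z \<bullet> b\<bar>)))) \<partial>lborel)
    = (\<integral>\<^sup>+(z::'a). (\<Prod>b\<in>Basis. ennreal (exp (- \<bar>z \<bullet> b\<bar>))) \<partial>lborel)"
    by (simp add: prod_ennreal exp_sum sum_negf[symmetric] prod_nonneg)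
  also have "\<dots> = (\<Prod>b\<in>(Basis::'a set). \<integral>\<^sup>+x. ennreal (exp (- \<bar>x\<bar>)) \<partial>lborel)"
    by (rule nn_integral_lborel_prod[where f = "\<lambda>b x. ennreal (exp (- \<bar>x\<bar>))"]) auto
  also have "\<dots> < \<infinity>"
    using integrable_exp_neg_abs by (simp add: nn_integral_eq_integral power_less_top_ennreal)
  finally show "(\<integral>\<^sup>+(z::'a). ennreal (norm (exp (- (\<Sum>b\<in>Basis. \<bar>z \<bullet> b\<bar>)))) \<partial>lborel) < \<infinity>" .
qed simp

text \<open>The comparison function is a product over the real coordinates, hence integrable by
  one-dimensional integrals; the Gaussian absorbs the cost of passing to it.\<close>

lemma integrable_exp_norm_gauss:
  assumes \<alpha>: "\<alpha> > 0"
  shows "integrable lborel (\<lambda>z::complex^'n. exp (c * norm z) * gauss \<alpha> z)"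
proof -
  define D where "D = real DIM(complex^'n)"
  have le: "exp (c * norm z) * gauss \<alpha> z \<le> exp ((c + D)\<^sup>2 * \<alpha> / 4) * exp (- (\<Sum>b\<in>Basis. \<bar>z \<bullet> b\<bar>))"
    for z :: "complex^'n"
  proof -
    have "(\<Sum>b\<in>Basis. \<bar>z \<bullet> b\<bar>) \<le> (\<Sum>b\<in>(Basis::(complex^'n) set). norm z)"
      by (intro sum_mono Basis_le_norm)
    then have 1: "(\<Sum>b\<in>Basis. \<bar>z \<bullet> b\<bar>) \<le> D * norm z" by (simp add: D_def)
    \<comment> \<open>Completing the square: (c + D) r - r^2 / \<alpha> is largest at r = (c + D)
      \<alpha> / 2, with value (c + D)^2 \<alpha> / 4.\<close>
    have "0 \<le> (norm z - (c + D) * \<alpha> / 2)\<^sup>2 / \<alpha>" using \<alpha> by simp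
    then have "(c + D) * norm z - (norm z)\<^sup>2 / \<alpha> \<le> (c + D)\<^sup>2 * \<alpha> / 4"
      using \<alpha> by (simp add: power2_eq_square field_simps)
    with 1 show ?thesis
      by (simp add: gauss_def exp_add[symmetric] algebra_simps)
  qed
  show ?thesis
    by (rule Bochner_Integration.integrable_bound[OF integrable_mult_right[where c = "exp ((c + D)\<^sup>2 * \<alpha> / 4)", OF integrable_exp_neg_sum_abs]])
      (use le in \<open>auto simp: abs_mult\<close>)
qed

lemma integrable_gauss: "\<alpha> > 0 \<Longrightarrow> integrable lborel (gauss \<alpha>)"
  using integrable_exp_norm_gauss[of \<alpha> 0] by simp

lemma gauss_mass_pos:
  assumes "\<alpha> > 0"
  shows "gauss_mass \<alpha> TYPE('n::finite) > 0"
proof -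
  have int: "integrable lborel (gauss \<alpha> :: complex^'n \<Rightarrow> real)" by (rule integrable_gauss[OF assms])
  have "gauss_mass \<alpha> TYPE('n) \<noteq> 0"
  proof
    assume "gauss_mass \<alpha> TYPE('n) = 0"
    then have "AE z::complex^'n in lborel. gauss \<alpha> z = 0"
      using integral_nonneg_eq_0_iff_AE[OF int] by (simp add: gauss_mass_def)
    then have "AE z::complex^'n in lborel. False"
      using gauss_pos(1) by (auto elim!: eventually_mono simp: less_le)
    then have "emeasure (lborel :: (complex^'n) measure) UNIV = 0"
      by (simp add: AE_iff_measurable[OF _ refl])
    then show False by simp
  qed
  moreover have "gauss_mass \<alpha> TYPE('n) \<ge> 0" by (simp add: gauss_mass_def)
  ultimately show ?thesis by simp
qed

section \<open>The Hermitian form, the growth of the kernel and the reproducing formula\<close>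

lemma herm_add_left: "herm (a + b) w = herm a w + herm b w"
  by (simp add: herm_def distrib_right sum.distrib)

lemma herm_add_right: "herm w (a + b) = herm w a + herm w b"
  by (simp add: herm_def distrib_left sum.distrib)

lemma cnj_herm: "cnj (herm z w) = herm w z"
  by (simp add: herm_def mult.commute)

lemma norm_herm_le: "norm (herm z w) \<le> norm z * norm w"
proof -
  have "norm (herm z w) \<le> (\<Sum>j\<in>UNIV. \<bar>norm (z $ j)\<bar> * \<bar>norm (w $ j)\<bar>)"
    unfolding herm_def by (rule order_trans[OF norm_sum]) (simp add: norm_mult)
  also have "\<dots> \<le> L2_set (\<lambda>j. norm (z $ j)) UNIV * L2_set (\<lambda>j. norm (w $ j)) UNIV"
    by (rule L2_set_mult_ineq)
  finally show ?thesis by (simp add: norm_vec_def)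
qed

lemma herm_self: "herm z z = of_real ((norm z)\<^sup>2)"
proof -
  have "(norm z)\<^sup>2 = (\<Sum>j\<in>UNIV. (norm (z $ j))\<^sup>2)"
    by (simp add: norm_vec_def L2_set_def sum_nonneg)
  then show ?thesis by (simp add: herm_def complex_norm_square[symmetric])
qed

lemma Re_herm: "Re (herm z w) = z \<bullet> w"
  by (simp add: herm_def inner_vec_def inner_complex_def)

lemma herm_zero [simp]: "herm 0 w = 0" "herm w 0 = 0"
  by (simp_all add: herm_def)

lemma continuous_on_herm [continuous_intros]:
  "continuous_on S f \<Longrightarrow> continuous_on S g \<Longrightarrow> continuous_on S (\<lambda>x. herm (f x) (g x))"
  unfolding herm_def by (intro continuous_intros)

lemma entire_on_lines_herm: "entire_on_lines (\<lambda>z. herm z w)"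
  unfolding herm_def
  by (intro entire_on_lines_sum entire_on_lines_mult entire_on_lines_nth entire_on_lines_const)

lemma norm_exp_herm_le:
  assumes "\<alpha> > 0"
  shows "norm (exp (herm z w / of_real \<alpha>)) \<le> exp (norm z * norm w / \<alpha>)"
  using assms norm_herm_le[of z w]
  by (intro order_trans[OF norm_exp]) (auto simp: norm_divide divide_right_mono)

lemma K_ph_commute: "K_ph \<alpha> w z = K_ph \<alpha> z w"
  by (simp add: K_ph_def)

lemma cnj_K_ph: "cnj (K_ph \<alpha> z w) = K_ph \<alpha> z w"
  by (simp add: K_ph_def exp_cnj cnj_herm)

lemma norm_K_ph_le:
  assumes "\<alpha> > 0"
  shows "norm (K_ph \<alpha> z w) \<le> 3 * exp (norm z * norm w / \<alpha>)"
proof -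
  have "norm (K_ph \<alpha> z w) \<le> norm (exp (herm z w / of_real \<alpha>)) + norm (exp (herm w z / of_real \<alpha>)) + 1"
    unfolding K_ph_def by (rule order_trans[OF norm_triangle_ineq4]) (simp add: norm_triangle_ineq del: norm_exp_eq_Re)
  also have "\<dots> \<le> exp (norm z * norm w / \<alpha>) + exp (norm z * norm w / \<alpha>) + exp (norm z * norm w / \<alpha>)"
    using norm_exp_herm_le[OF assms, of z w] norm_exp_herm_le[OF assms, of w z] assms
    by (intro add_mono) (auto simp: mult.commute)
  finally show ?thesis by simp
qed

lemma continuous_on_K_ph [continuous_intros]:
  "continuous_on S f \<Longrightarrow> continuous_on S g \<Longrightarrow> continuous_on S (\<lambda>x. K_ph \<alpha> (f x) (g x))"
  unfolding K_ph_def divide_inverse by (intro continuous_intros)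

lemma borel_measurable_K_ph [measurable]: "K_ph \<alpha> z \<in> borel_measurable borel"
  by (intro borel_measurable_continuous_onI continuous_intros)

lemma integrable_exp_growth_gauss:
  fixes f :: "complex^'n \<Rightarrow> 'b::{banach, second_countable_topology}"
  assumes \<alpha>: "\<alpha> > 0" and [measurable]: "f \<in> borel_measurable borel"
    and le: "\<And>z. norm (f z) \<le> C * exp (c * norm z)"
  shows "integrable lborel (\<lambda>z. gauss \<alpha> z *\<^sub>R f z)"
proof (rule Bochner_Integration.integrable_bound[OF integrable_mult_right[where c = C, OF integrable_exp_norm_gauss[OF \<alpha>]]])
  show "AE z in lborel. norm (gauss \<alpha> z *\<^sub>R f z) \<le> norm (C * (exp (c * norm z) * gauss \<alpha> z))"
  proof (rule AE_I2)
    fix z :: "complex^'n"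
    have "norm (gauss \<alpha> z *\<^sub>R f z) \<le> gauss \<alpha> z * (C * exp (c * norm z))"
      using le[of z] by (simp add: mult_left_mono)
    also have "\<dots> \<le> norm (C * (exp (c * norm z) * gauss \<alpha> z))" by (simp add: mult_ac)
    finally show "norm (gauss \<alpha> z *\<^sub>R f z) \<le> norm (C * (exp (c * norm z) * gauss \<alpha> z))" .
  qed
qed simp

lemma integrable_square_exp_growth_gauss:
  fixes f :: "complex^'n \<Rightarrow> complex"
  assumes \<alpha>: "\<alpha> > 0" and [measurable]: "f \<in> borel_measurable borel"
    and le: "\<And>z. norm (f z) \<le> C * exp (c * norm z)"
  shows "integrable lborel (\<lambda>z. (norm (f z))\<^sup>2 * gauss \<alpha> z)"
proof -
  have "norm ((norm (f z))\<^sup>2) \<le> C\<^sup>2 * exp ((2 * c) * norm z)" for z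
  proof -
    have "(norm (f z))\<^sup>2 \<le> (C * exp (c * norm z))\<^sup>2" by (intro power_mono le) simp
    then show ?thesis by (simp add: power_mult_distrib exp_double[symmetric] mult.assoc)
  qed
  from integrable_exp_growth_gauss[OF \<alpha> _ this] show ?thesis by (simp add: mult.commute)
qed

lemma integrable_square_K_ph:
  assumes "\<alpha> > 0"
  shows "integrable lborel (\<lambda>z. (norm (K_ph \<alpha> w z))\<^sup>2 * gauss \<alpha> z)"
  by (rule integrable_square_exp_growth_gauss[OF assms, where C = 3 and c = "norm w / \<alpha>"])
    (use norm_K_ph_le[OF assms, of w] in simp_all)

lemma integral_translation:
  fixes F :: "'a::euclidean_space \<Rightarrow> 'b::{banach, second_countable_topology}"
  assumes F: "integrable lborel F"
  shows "(\<integral>z. F (a + z) \<partial>lborel) = (\<integral>z. F z \<partial>lborel)"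
proof -
  have [measurable]: "F \<in> borel_measurable borel" using F by auto
  show "(\<integral>z. F (a + z) \<partial>lborel) = (\<integral>z. F z \<partial>lborel)"
    using integral_distr[of "(+) a" lborel borel F] by (simp add: lborel_distr_plus)
qed

lemma gauss_eq_exp_herm: "of_real (gauss \<alpha> z) = exp (- herm z z / of_real \<alpha>)"
  by (simp add: gauss_def herm_self flip: exp_of_real)

text \<open>Substituting \<open>z = w + v\<close> turns the kernel \<open>exp (herm w z / \<alpha>)\<close> times the Gaussian weight into the
  Gaussian weight in \<open>v\<close> times a holomorphic factor.\<close>

lemma entire_on_lines_reproducing:
  fixes g :: "complex^'n \<Rightarrow> complex"
  assumes \<alpha>: "\<alpha> > 0" and g: "entire_on_lines g"
    and L2: "integrable lborel (\<lambda>z. (norm (g z))\<^sup>2 * gauss \<alpha> z)"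
  shows "(\<integral>z. g z * K_ph \<alpha> w z * gauss \<alpha> z \<partial>lborel) = gauss_mass \<alpha> TYPE('n) * g w"
proof -
  have gb [measurable]: "f \<in> borel_measurable borel" if "entire_on_lines f" for f :: "complex^'n \<Rightarrow> complex"
    using that by (intro borel_measurable_continuous_onI) (simp add: entire_on_lines_def)
  have [measurable]: "(\<lambda>z. exp (herm w z / of_real \<alpha>)) \<in> borel_measurable borel"
    "(\<lambda>z. exp (herm z w / of_real \<alpha>)) \<in> borel_measurable borel"
    unfolding divide_inverse by (intro borel_measurable_continuous_onI continuous_intros)+
  have int: "integrable lborel (\<lambda>z. g z * k z * gauss \<alpha> z)"
    if [measurable]: "k \<in> borel_measurable borel"
      and "\<And>z. norm (k z) \<le> 1 * exp ((norm w / \<alpha>) * norm z)" for k :: "complex^'n \<Rightarrow> complex"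
    by (rule integrable_mult_weighted[OF _ _ _ _ L2 integrable_square_exp_growth_gauss[OF \<alpha> _ that(2)]])
      (use gb[OF g] in auto)
  have int1: "integrable lborel (\<lambda>z. g z * exp (herm w z / of_real \<alpha>) * gauss \<alpha> z)"
    by (rule int) (use norm_exp_herm_le[OF \<alpha>, of w] in simp_all)
  have int2: "integrable lborel (\<lambda>z. g z * exp (herm z w / of_real \<alpha>) * gauss \<alpha> z)"
    by (rule int) (use norm_exp_herm_le[OF \<alpha>, of _ w] in \<open>simp_all add: mult.commute\<close>)
  have int3: "integrable lborel (\<lambda>z. g z * gauss \<alpha> z)"
    using int[of "\<lambda>_. 1"] \<alpha> by simp
  have radial: "(\<integral>z. F z * gauss \<alpha> z \<partial>lborel) = F 0 * gauss_mass \<alpha> TYPE('n)"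
    if "entire_on_lines F" "integrable lborel (\<lambda>z. F z * gauss \<alpha> z)" for F :: "complex^'n \<Rightarrow> complex"
    using integral_entire_on_lines_radial[OF that(1), of "\<lambda>r. exp (- r\<^sup>2 / \<alpha>)"] that(2)
    by (simp add: gauss_def gauss_mass_def)
  \<comment> \<open>In the exponent the term \<open>herm w v\<close>, antiholomorphic in
    \<open>v\<close>, cancels; apart from the Gaussian only \<open>herm v w\<close> is left.\<close>
  have shift: "g (w + v) * exp (herm w (w + v) / of_real \<alpha>) * gauss \<alpha> (w + v)
      = g (w + v) * exp (herm v w * (- 1 / of_real \<alpha>)) * gauss \<alpha> v" for v
  proof -
    have "herm w (w + v) / of_real \<alpha> + - herm (w + v) (w + v) / of_real \<alpha>
        = herm v w * (- 1 / of_real \<alpha>) + - herm v v / of_real \<alpha>"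
      using \<alpha> by (simp add: herm_add_left herm_add_right field_simps)
    then have "exp (herm w (w + v) / of_real \<alpha>) * exp (- herm (w + v) (w + v) / of_real \<alpha>)
        = exp (herm v w * (- 1 / of_real \<alpha>)) * exp (- herm v v / of_real \<alpha>)"
      by (simp only: exp_add[symmetric])
    then show ?thesis by (simp only: gauss_eq_exp_herm mult.assoc)
  qed
  have "(\<integral>z. g z * exp (herm w z / of_real \<alpha>) * gauss \<alpha> z \<partial>lborel)
      = (\<integral>v. g (w + v) * exp (herm v w * (- 1 / of_real \<alpha>)) * gauss \<alpha> v \<partial>lborel)"
    using integral_translation[OF int1, of w] by (simp only: shift)
  also have "\<dots> = g (w + 0) * exp (herm 0 w * (- 1 / of_real \<alpha>)) * gauss_mass \<alpha> TYPE('n)"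
  proof (rule radial[of "\<lambda>v. g (w + v) * exp (herm v w * (- 1 / of_real \<alpha>))"])
    show "entire_on_lines (\<lambda>v. g (w + v) * exp (herm v w * (- 1 / of_real \<alpha>)))"
      by (rule entire_on_lines_mult[OF entire_on_lines_translate[OF g] entire_on_lines_exp[OF
          entire_on_lines_mult[OF entire_on_lines_herm entire_on_lines_const]]])
    have "integrable lborel (\<lambda>v. g (w + v) * exp (herm w (w + v) / of_real \<alpha>) * gauss \<alpha> (w + v))"
      using integrable_distr_eq[of "(+) w" lborel borel "\<lambda>z. g z * exp (herm w z / of_real \<alpha>) * gauss \<alpha> z"]
        int1 gb[OF g] by (simp add: lborel_distr_plus)
    then show "integrable lborel (\<lambda>v. g (w + v) * exp (herm v w * (- 1 / of_real \<alpha>)) * gauss \<alpha> v)"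
      unfolding shift .
  qed
  finally have I1: "(\<integral>z. g z * exp (herm w z / of_real \<alpha>) * gauss \<alpha> z \<partial>lborel) = g w * gauss_mass \<alpha> TYPE('n)"
    by simp
  \<comment> \<open>The second exponential of the kernel is holomorphic in \<open>z\<close>, so its
    integral contributes only the value \<open>g 0\<close> times the mass, which the -1 in the
    kernel removes again.\<close>
  have "entire_on_lines (\<lambda>z. g z * exp (herm z w / of_real \<alpha>))"
    unfolding divide_inverse
    by (intro entire_on_lines_mult g entire_on_lines_exp entire_on_lines_herm entire_on_lines_const)
  from radial[OF this int2]
  have I2: "(\<integral>z. g z * exp (herm z w / of_real \<alpha>) * gauss \<alpha> z \<partial>lborel) = g 0 * gauss_mass \<alpha> TYPE('n)"
    by simp
  have "(\<integral>z. g z * K_ph \<alpha> w z * gauss \<alpha> z \<partial>lborel)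
     = (\<integral>z. g z * exp (herm w z / of_real \<alpha>) * gauss \<alpha> z + g z * exp (herm z w / of_real \<alpha>) * gauss \<alpha> z
         - g z * gauss \<alpha> z \<partial>lborel)"
    by (simp add: K_ph_def algebra_simps)
  also have "\<dots> = g w * gauss_mass \<alpha> TYPE('n) + g 0 * gauss_mass \<alpha> TYPE('n) - g 0 * gauss_mass \<alpha> TYPE('n)"
    using int1 int2 int3 by (simp add: I1 I2 radial[OF g int3])
  finally show ?thesis by simp
qed


lemma integrable_continuous_truncated_gauss:
  fixes f :: "complex^'n \<Rightarrow> 'b::{banach, second_countable_topology}"
  assumes "continuous_on UNIV f"
  shows "integrable lborel (\<lambda>z. (indicator {..R} (norm z) * gauss \<alpha> z) *\<^sub>R f z)"
proof -
  have "integrable lborel (\<lambda>z. indicator (cball 0 R) z *\<^sub>R (gauss \<alpha> z *\<^sub>R f z))"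
    by (intro borel_integrable_compact continuous_intros continuous_on_subset[OF assms]) auto
  then show ?thesis
    by (rule Bochner_Integration.integrable_cong[THEN iffD1, rotated 2]) (auto split: split_indicator)
qed

text \<open>On every ball around the origin \<open>g\<close> is orthogonal to \<open>cnj h\<close>, because \<open>g h\<close> is holomorphic and
  vanishes at the origin. Hence the truncated norms of \<open>g\<close> and \<open>h\<close> are bounded by the norm of \<open>u\<close>.\<close>

lemma square_integrable_holomorphic_part:
  fixes g h u :: "complex^'n \<Rightarrow> complex"
  assumes \<alpha>: "\<alpha> > 0" and g: "entire_on_lines g" and h: "entire_on_lines h" and zero: "g 0 * h 0 = 0"
    and u: "\<And>z. (norm (u z))\<^sup>2 = (norm (g z + cnj (h z)))\<^sup>2"
    and L2: "integrable lborel (\<lambda>z. (norm (u z))\<^sup>2 * gauss \<alpha> z)"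
  shows "integrable lborel (\<lambda>z. (norm (g z))\<^sup>2 * gauss \<alpha> z)"
proof -
  define w where "w = (\<lambda>k r. indicator {..real k} r * exp (- r\<^sup>2 / \<alpha>))"
  have [measurable]: "w k \<in> borel_measurable borel" for k unfolding w_def by measurable
  have w: "w k (norm z) = indicator {..real k} (norm z) * gauss \<alpha> z" for k and z :: "complex^'n"
    by (simp add: w_def gauss_def)
  have w0: "0 \<le> w k r" for k r by (simp add: w_def)
  have cont: "continuous_on UNIV g" "continuous_on UNIV h" using g h by (simp_all add: entire_on_lines_def)
  have int: "integrable lborel (\<lambda>z. w k (norm z) *\<^sub>R f z)" if "continuous_on UNIV f"
    for k and f :: "complex^'n \<Rightarrow> 'b::{banach, second_countable_topology}"
    unfolding w using integrable_continuous_truncated_gauss[OF that] by simp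
  have intg: "integrable lborel (\<lambda>z. (norm (g z))\<^sup>2 * w k (norm z))"
    and inth: "integrable lborel (\<lambda>z. (norm (h z))\<^sup>2 * w k (norm z))"
    and intgh: "integrable lborel (\<lambda>z. (g z * h z) * w k (norm z))" for k
    using int[OF continuous_on_power[OF continuous_on_norm[OF cont(1)], of 2], of k]
      int[OF continuous_on_power[OF continuous_on_norm[OF cont(2)], of 2], of k]
      int[OF continuous_on_mult[OF cont], of k]
    by (simp_all add: mult.commute scaleR_conv_of_real)
  have int0: "(\<integral>z. (g z * h z) * w k (norm z) \<partial>lborel) = 0" for k
    using integral_entire_on_lines_radial[OF entire_on_lines_mult[OF g h] _ intgh] zero by simp
  define r where "r = (\<lambda>k z. Re (g z * h z * w k (norm z)))"
  have intr: "integrable lborel (r k)" and Re0: "(\<integral>z. r k z \<partial>lborel) = 0" for k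
    unfolding r_def using integrable_Re[OF intgh] integral_Re[OF intgh] int0 by simp_all
  \<comment> \<open>The cross term of g + cnj h is twice the real part of g h, without conjugates;
    hence the holomorphic mean value applies to it.\<close>
  have expand: "(norm (u z))\<^sup>2 * w k (norm z)
      = (norm (g z))\<^sup>2 * w k (norm z) + (norm (h z))\<^sup>2 * w k (norm z) + 2 * r k z" for z k
    unfolding u r_def unfolding cmod_power2 by (simp add: power2_eq_square algebra_simps)
  show ?thesis
  proof (rule integrable_limit_of_bounded_integrals)
    show "integrable lborel (\<lambda>z. (norm (g z))\<^sup>2 * w k (norm z))" for k by (rule intg)
    show "0 \<le> (norm (g z))\<^sup>2 * w k (norm z)" for k z by (simp add: w0)
    show "(\<lambda>k. (norm (g z))\<^sup>2 * w k (norm z)) \<longlonglongrightarrow> (norm (g z))\<^sup>2 * gauss \<alpha> z" for z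
    proof (rule tendsto_eventually)
      obtain n :: nat where "norm z \<le> real n" using real_arch_simple by blast
      then show "\<forall>\<^sub>F k in sequentially. (norm (g z))\<^sup>2 * w k (norm z) = (norm (g z))\<^sup>2 * gauss \<alpha> z"
        by (intro eventually_sequentiallyI[of n]) (simp add: w)
    qed
    show "(\<integral>z. (norm (g z))\<^sup>2 * w k (norm z) \<partial>lborel) \<le> (\<integral>z. (norm (u z))\<^sup>2 * gauss \<alpha> z \<partial>lborel)" for k
    proof -
      have "(\<integral>z. (norm (g z))\<^sup>2 * w k (norm z) \<partial>lborel)
        \<le> (\<integral>z. (norm (g z))\<^sup>2 * w k (norm z) \<partial>lborel) + (\<integral>z. (norm (h z))\<^sup>2 * w k (norm z) \<partial>lborel)"
        by (simp add: w0)
      also have "\<dots> = (\<integral>z. (norm (u z))\<^sup>2 * w k (norm z) \<partial>lborel)"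
        unfolding expand using intg inth intr Re0 by simp
      also have "\<dots> \<le> (\<integral>z. (norm (u z))\<^sup>2 * gauss \<alpha> z \<partial>lborel)"
      proof (rule integral_mono[OF _ L2])
        show "integrable lborel (\<lambda>z. (norm (u z))\<^sup>2 * w k (norm z))"
          unfolding expand using intg inth intr by simp
        show "(norm (u z))\<^sup>2 * w k (norm z) \<le> (norm (u z))\<^sup>2 * gauss \<alpha> z" for z
          by (intro mult_left_mono) (auto simp: w split: split_indicator)
      qed
      finally show ?thesis .
    qed
  qed (rule tendsto_const)
qed

text \<open>The kernel is real, so the formula for \<open>cnj (h z)\<close> is the conjugate of the
  holomorphic formula for \<open>h\<close>.\<close>

lemma pluriharmonic_reproducing:
  fixes u :: "complex^'n \<Rightarrow> complex"
  assumes \<alpha>: "\<alpha> > 0" and u: "pluriharmonic u"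
    and L2: "integrable lborel (\<lambda>z. (norm (u z))\<^sup>2 * gauss \<alpha> z)"
  shows "(\<integral>z. u z * K_ph \<alpha> w z * gauss \<alpha> z \<partial>lborel) = gauss_mass \<alpha> TYPE('n) * u w"
proof -
  obtain g h where gh: "entire_on_lines g" "entire_on_lines h" "h 0 = 0" "\<And>z. u z = g z + cnj (h z)"
    using pluriharmonic_decomposition[OF u] by blast
  \<comment> \<open>Conjugating \<open>u\<close> exchanges the roles of \<open>g\<close> and
    \<open>h\<close>, so one lemma bounds both parts.\<close>
  have norm_u: "norm (u z) = norm (h z + cnj (g z))" for z
    using complex_mod_cnj[of "u z"] by (simp add: gh(4) add.commute)
  have L2g: "integrable lborel (\<lambda>z. (norm (g z))\<^sup>2 * gauss \<alpha> z)"
    by (rule square_integrable_holomorphic_part[OF \<alpha> gh(1,2) _ _ L2]) (simp_all add: gh(3,4))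
  have L2h: "integrable lborel (\<lambda>z. (norm (h z))\<^sup>2 * gauss \<alpha> z)"
    by (rule square_integrable_holomorphic_part[OF \<alpha> gh(2,1) _ _ L2]) (simp_all add: gh(3) norm_u)
  have int: "integrable lborel (\<lambda>z. f z * K_ph \<alpha> w z * gauss \<alpha> z)"
    if "entire_on_lines f" "integrable lborel (\<lambda>z. (norm (f z))\<^sup>2 * gauss \<alpha> z)" for f :: "complex^'n \<Rightarrow> complex"
    using that(1) by (intro integrable_mult_weighted that(2) integrable_square_K_ph \<alpha>)
      (auto simp: entire_on_lines_def borel_measurable_continuous_onI)
  have "u z * K_ph \<alpha> w z * gauss \<alpha> z = g z * K_ph \<alpha> w z * gauss \<alpha> z + cnj (h z * K_ph \<alpha> w z * gauss \<alpha> z)" for z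
    by (simp add: gh(4) cnj_K_ph algebra_simps)
  then have "(\<integral>z. u z * K_ph \<alpha> w z * gauss \<alpha> z \<partial>lborel) =
      (\<integral>z. g z * K_ph \<alpha> w z * gauss \<alpha> z \<partial>lborel) + cnj (\<integral>z. h z * K_ph \<alpha> w z * gauss \<alpha> z \<partial>lborel)"
    using int[OF gh(1) L2g] int[OF gh(2) L2h] by (simp del: complex_cnj_mult)
  also have "\<dots> = gauss_mass \<alpha> TYPE('n) * u w"
    unfolding entire_on_lines_reproducing[OF \<alpha> gh(1) L2g] entire_on_lines_reproducing[OF \<alpha> gh(2) L2h]
    by (simp add: gh(4) algebra_simps)
  finally show ?thesis .
qed

section \<open>Integrals of the kernel\<close>

text \<open>The derivatives of \<open>g\<close> and \<open>h\<close> are complex linear, so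
  \<open>wirtinger_dzbar\<close> sees only \<open>cnj (h z)\<close> and gives
  \<open>cnj (H k z)\<close>, which \<open>wirtinger_dz\<close> annihilates. Explicit first and
  second partial derivatives make the continuity demanded by \<open>C2_fun\<close> readable from
  formulas.\<close>

lemma pluriharmonic_holomorphic_plus_cnj:
  fixes g h :: "complex^'n \<Rightarrow> complex"
  assumes g: "\<And>z. (g has_derivative (\<lambda>v. \<Sum>j\<in>UNIV. v $ j * G j z)) (at z)"
    and G: "\<And>j z. (G j has_derivative (\<lambda>v. \<Sum>k\<in>UNIV. v $ k * GG j k z)) (at z)"
    and GG: "\<And>j k. continuous_on UNIV (GG j k)"
    and h: "\<And>z. (h has_derivative (\<lambda>v. \<Sum>j\<in>UNIV. v $ j * H j z)) (at z)"
    and H: "\<And>j z. (H j has_derivative (\<lambda>v. \<Sum>k\<in>UNIV. v $ k * HH j k z)) (at z)"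
    and HH: "\<And>j k. continuous_on UNIV (HH j k)"
  shows "pluriharmonic (\<lambda>z. g z + cnj (h z))"
proof -
  let ?f = "\<lambda>z. g z + cnj (h z)"
  have f: "(?f has_derivative (\<lambda>v. (\<Sum>j\<in>UNIV. v $ j * G j z) + cnj (\<Sum>j\<in>UNIV. v $ j * H j z))) (at z)" for z
    by (intro has_derivative_add g bounded_linear.has_derivative[OF bounded_linear_cnj] h)
  have D: "frechet_derivative ?f (at z) = (\<lambda>v. (\<Sum>j\<in>UNIV. v $ j * G j z) + cnj (\<Sum>j\<in>UNIV. v $ j * H j z))" for z
    by (rule frechet_derivative_at[OF f, symmetric])
  have cG: "continuous_on UNIV (G j)" and cH: "continuous_on UNIV (H j)" for j
    using G H by (auto intro!: continuous_at_imp_continuous_on has_derivative_continuous)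
  have DD: "((\<lambda>z. frechet_derivative ?f (at z) v) has_derivative
     (\<lambda>w. (\<Sum>j\<in>UNIV. v $ j * (\<Sum>k\<in>UNIV. w $ k * GG j k z))
        + cnj (\<Sum>j\<in>UNIV. v $ j * (\<Sum>k\<in>UNIV. w $ k * HH j k z)))) (at z)" for v z
    unfolding D
    by (intro has_derivative_add has_derivative_sum has_derivative_mult_right G H
        bounded_linear.has_derivative[OF bounded_linear_cnj])
  have "C1_fun ?f"
    unfolding C1_fun_def D using f by (auto simp: differentiable_def intro!: continuous_intros cG cH)
  moreover have "C1_fun (\<lambda>z. frechet_derivative ?f (at z) v)" for v
    unfolding C1_fun_def frechet_derivative_at[OF DD, symmetric]
    using DD[of v] by (auto simp: differentiable_def intro!: continuous_intros GG HH)
  ultimately have "C2_fun ?f" by (simp add: C2_fun_def)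
  moreover have ax: "(\<Sum>j\<in>UNIV. axis k c $ j * x j) = c * x k" for k :: 'n and c :: complex and x
  proof -
    have "(\<Sum>j\<in>UNIV. axis k c $ j * x j) = (\<Sum>j\<in>UNIV. if j = k then c * x j else 0)"
      by (intro sum.cong) (auto simp: axis_def)
    then show ?thesis by simp
  qed
  have dzbar: "wirtinger_dzbar k ?f = (\<lambda>z. cnj (H k z))" for k
    unfolding wirtinger_dzbar_def D ax by (auto simp: field_simps)
  have "frechet_derivative (\<lambda>z. cnj (H k z)) (at z) = (\<lambda>v. cnj (\<Sum>l\<in>UNIV. v $ l * HH k l z))" for k z
    by (rule frechet_derivative_at[symmetric]) (intro bounded_linear.has_derivative[OF bounded_linear_cnj] H)
  then have "wirtinger_dz j (wirtinger_dzbar k ?f) z = 0" for j k z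
    unfolding dzbar wirtinger_dz_def by (simp add: ax del: cnj_sum)
  ultimately show ?thesis by (simp add: pluriharmonic_def)
qed

lemma borel_measurable_cnj [measurable]: "cnj \<in> borel_measurable borel"
  by (intro borel_measurable_continuous_onI continuous_intros)

section \<open>Exponential moments and differentiation of kernel integrals\<close>

text \<open>The condition is stable under multiplication by functions of exponential growth, in
  particular by coordinates, so differentiation under the integral can be repeated. In the uses,
  \<psi> already contains the Gaussian factor.\<close>

definition exp_moments :: "(complex^'n) measure \<Rightarrow> (complex^'n \<Rightarrow> complex) \<Rightarrow> bool" where
  "exp_moments \<nu> \<psi> \<longleftrightarrow> \<psi> \<in> borel_measurable \<nu> \<and>
     (\<forall>c. integrable \<nu> (\<lambda>w. exp (c * norm w) * norm (\<psi> w)))"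

lemma exp_moments_cnj: "exp_moments \<nu> \<psi> \<Longrightarrow> exp_moments \<nu> (\<lambda>w. cnj (\<psi> w))"
  by (auto simp: exp_moments_def)

text \<open>A Laplace transform. Up to a constant it is the holomorphic part of
  \<open>kernel_integral\<close>; the antiholomorphic part is the conjugate of the transform of
  \<open>cnj (\<psi> w)\<close>.\<close>

definition exp_transform ::
  "(complex^'n) measure \<Rightarrow> real \<Rightarrow> (complex^'n \<Rightarrow> complex) \<Rightarrow> complex^'n \<Rightarrow> complex" where
  "exp_transform \<nu> \<alpha> \<psi> z = (\<integral>w. exp (herm z w / of_real \<alpha>) * \<psi> w \<partial>\<nu>)"

text \<open>With \<nu> = \<mu> and \<psi> = f times the Gaussian this is the Toeplitz operator; with
  \<nu> = \<open>lborel\<close> it is \<open>gauss_mass\<close> times the orthogonal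
  projection.\<close>

definition kernel_integral ::
  "(complex^'n) measure \<Rightarrow> real \<Rightarrow> (complex^'n \<Rightarrow> complex) \<Rightarrow> complex^'n \<Rightarrow> complex" where
  "kernel_integral \<nu> \<alpha> \<psi> z = (\<integral>w. K_ph \<alpha> z w * \<psi> w \<partial>\<nu>)"

context
  fixes \<nu> :: "(complex^'n) measure"
  assumes sets_nu [measurable_cong]: "sets \<nu> = sets borel"
begin

lemma integrable_exp_moments:
  assumes "exp_moments \<nu> \<psi>" "k \<in> borel_measurable borel" "\<And>w. norm (k w) \<le> C * exp (c * norm w)"
  shows "integrable \<nu> (\<lambda>w. k w * \<psi> w)"
proof (rule Bochner_Integration.integrable_bound[OF integrable_mult_right[where c = C]])
  show "integrable \<nu> (\<lambda>w. exp (c * norm w) * norm (\<psi> w))" using assms(1) by (simp add: exp_moments_def)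
  have [measurable]: "k \<in> borel_measurable \<nu>" "\<psi> \<in> borel_measurable \<nu>"
    using assms(1,2) measurable_cong_sets[OF sets_nu] by (auto simp: exp_moments_def)
  show "(\<lambda>w. k w * \<psi> w) \<in> borel_measurable \<nu>" by measurable
  show "AE w in \<nu>. norm (k w * \<psi> w) \<le> norm (C * (exp (c * norm w) * norm (\<psi> w)))"
  proof (rule AE_I2)
    fix w
    have "norm (k w * \<psi> w) \<le> (C * exp (c * norm w)) * norm (\<psi> w)"
      unfolding norm_mult by (intro mult_right_mono assms(3)) simp
    also have "\<dots> \<le> norm (C * (exp (c * norm w) * norm (\<psi> w)))" by (simp add: mult.assoc)
    finally show "norm (k w * \<psi> w) \<le> norm (C * (exp (c * norm w) * norm (\<psi> w)))" .
  qed
qed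

lemma exp_moments_mult:
  assumes \<psi>: "exp_moments \<nu> \<psi>" and k: "k \<in> borel_measurable borel" "\<And>w. norm (k w) \<le> C * exp (c * norm w)"
  shows "exp_moments \<nu> (\<lambda>w. k w * \<psi> w)"
proof -
  have m: "k \<in> borel_measurable \<nu>" "\<psi> \<in> borel_measurable \<nu>"
    using \<psi> k(1) measurable_cong_sets[OF sets_nu] by (auto simp: exp_moments_def)
  have "integrable \<nu> (\<lambda>w. exp (d * norm w) * norm (k w * \<psi> w))" for d
  proof -
    have "integrable \<nu> (\<lambda>w. (of_real (exp (d * norm w)) * k w) * \<psi> w)"
    proof (rule integrable_exp_moments[OF \<psi>])
      show "norm (of_real (exp (d * norm w)) * k w) \<le> C * exp ((d + c) * norm w)" for w
        using mult_left_mono[OF k(2)[of w], of "exp (d * norm w)"]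
        by (simp add: norm_mult exp_add algebra_simps)
    qed (use k(1) in simp)
    from integrable_norm[OF this] show ?thesis by (simp add: norm_mult mult.assoc)
  qed
  then show ?thesis using m by (simp add: exp_moments_def)
qed

lemma borel_measurable_exp_herm: "(\<lambda>w. exp (herm z w / of_real \<alpha>)) \<in> borel_measurable borel"
  unfolding divide_inverse by (intro borel_measurable_continuous_onI continuous_intros)

text \<open>The factor is what differentiating \<open>exp (herm z w / of_real \<alpha>)\<close> in
  the direction of the coordinate \<open>z $ j\<close> produces.\<close>

lemma exp_moments_coordinate:
  assumes "exp_moments \<nu> \<psi>"
  shows "exp_moments \<nu> (\<lambda>w. (cnj (w $ j) / of_real \<alpha>) * \<psi> w)"
proof (rule exp_moments_mult[OF assms])
  show "norm (cnj (w $ j) / of_real \<alpha>) \<le> (1 / \<bar>\<alpha>\<bar>) * exp (1 * norm w)" for w :: "complex^'n"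
  proof -
    have "norm (w $ j) \<le> exp (norm w)"
      using Finite_Cartesian_Product.norm_nth_le[of w j] exp_ge_add_one_self[of "norm w"] by linarith
    then show ?thesis by (simp add: norm_divide divide_right_mono)
  qed
  show "(\<lambda>w. cnj (w $ j) / of_real \<alpha>) \<in> borel_measurable borel"
    unfolding divide_inverse by (intro borel_measurable_continuous_onI continuous_intros)
qed

lemma integrable_exp_transform:
  assumes "\<alpha> > 0" "exp_moments \<nu> \<psi>"
  shows "integrable \<nu> (\<lambda>w. exp (herm z w / of_real \<alpha>) * \<psi> w)"
proof (rule integrable_exp_moments[OF assms(2) borel_measurable_exp_herm])
  show "norm (exp (herm z w / of_real \<alpha>)) \<le> 1 * exp (norm z / \<alpha> * norm w)" for w
    using norm_exp_herm_le[OF assms(1), of z w] by simp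
qed

text \<open>The remainder is estimated directly: with \<eta> =
  \<open>herm v w / of_real \<alpha>\<close>, the difference of exp \<eta> and 1 + \<eta> is at most
  exp |Re \<eta>| |\<eta>|^2, which is quadratic in \<open>v\<close> with a coefficient integrable
  in \<open>w\<close>.\<close>

lemma has_derivative_exp_transform:
  assumes \<alpha>: "\<alpha> > 0" and \<psi>: "exp_moments \<nu> \<psi>"
  shows "(exp_transform \<nu> \<alpha> \<psi> has_derivative
    (\<lambda>v. \<Sum>j\<in>UNIV. v $ j * exp_transform \<nu> \<alpha> (\<lambda>w. (cnj (w $ j) / of_real \<alpha>) * \<psi> w) z)) (at z)"
    (is "(_ has_derivative ?D) _")
  unfolding has_derivative_at
proof
  show "bounded_linear ?D"
    by (intro bounded_linear_sum bounded_linear_mult_left[THEN bounded_linear_compose] bounded_linear_vec_nth)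
  \<comment> \<open>Of the exponent, \<open>norm z\<close> bounds the exponential at
    \<open>z\<close>, one unit bounds exp |Re \<eta>| for \<open>norm v \<le> 1\<close>, and two
    units come from bounding (norm w / \<alpha>)^2 by the square of exp (norm w / \<alpha>).\<close>
  define C where "C = (\<integral>w. exp (((norm z + 3) / \<alpha>) * norm w) * norm (\<psi> w) \<partial>\<nu>)"
  let ?R = "\<lambda>v. exp_transform \<nu> \<alpha> \<psi> (z + v) - exp_transform \<nu> \<alpha> \<psi> z - ?D v"
  have bound: "norm (?R v) \<le> (norm v)\<^sup>2 * C" if v: "norm v \<le> 1" for v
  proof -
    let ?e = "\<lambda>w. exp (herm z w / of_real \<alpha>) * \<psi> w"
    let ?\<eta> = "\<lambda>w. herm v w / of_real \<alpha>"
    note int = integrable_exp_transform[OF \<alpha> \<psi>]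
      integrable_exp_transform[OF \<alpha> exp_moments_coordinate[OF \<psi>, of _ \<alpha>]]
    have "?D v = (\<Sum>j\<in>UNIV. \<integral>w. v $ j * (exp (herm z w / of_real \<alpha>) * ((cnj (w $ j) / of_real \<alpha>) * \<psi> w)) \<partial>\<nu>)"
      unfolding exp_transform_def by simp
    also have "\<dots> = (\<integral>w. (\<Sum>j\<in>UNIV. v $ j * (exp (herm z w / of_real \<alpha>) * ((cnj (w $ j) / of_real \<alpha>) * \<psi> w))) \<partial>\<nu>)"
      by (rule Bochner_Integration.integral_sum[symmetric]) (intro integrable_mult_right int)
    also have "\<dots> = (\<integral>w. ?\<eta> w * ?e w \<partial>\<nu>)"
      by (intro Bochner_Integration.integral_cong refl)
        (simp add: herm_def sum_distrib_left sum_distrib_right sum_divide_distrib mult_ac)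
    finally have D: "?D v = (\<integral>w. ?\<eta> w * ?e w \<partial>\<nu>)" .
    have "integrable \<nu> (\<lambda>w. \<Sum>j\<in>UNIV. v $ j * (exp (herm z w / of_real \<alpha>) * ((cnj (w $ j) / of_real \<alpha>) * \<psi> w)))"
      by (intro Bochner_Integration.integrable_sum integrable_mult_right int)
    then have intD: "integrable \<nu> (\<lambda>w. ?\<eta> w * ?e w)"
      by (rule Bochner_Integration.integrable_cong[OF refl, THEN iffD1, rotated])
        (simp add: herm_def sum_distrib_left sum_distrib_right sum_divide_distrib mult_ac)
    have R: "?R v = (\<integral>w. (exp (?\<eta> w) - (1 + ?\<eta> w)) * ?e w \<partial>\<nu>)"
    proof -
      have "?R v = (\<integral>w. exp (herm (z + v) w / of_real \<alpha>) * \<psi> w - ?e w - ?\<eta> w * ?e w \<partial>\<nu>)"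
        unfolding D unfolding exp_transform_def using int(1) intD by simp
      also have "\<dots> = (\<integral>w. (exp (?\<eta> w) - (1 + ?\<eta> w)) * ?e w \<partial>\<nu>)"
        by (intro Bochner_Integration.integral_cong refl)
          (simp add: herm_add_left add_divide_distrib exp_add algebra_simps)
      finally show ?thesis .
    qed
    have "norm (?R v) \<le> (\<integral>w. norm ((exp (?\<eta> w) - (1 + ?\<eta> w)) * ?e w) \<partial>\<nu>)"
      unfolding R by (rule integral_norm_bound)
    also have "\<dots> \<le> (\<integral>w. (norm v)\<^sup>2 * (exp (((norm z + 3) / \<alpha>) * norm w) * norm (\<psi> w)) \<partial>\<nu>)"
    proof (rule Bochner_Integration.integral_mono')
      show "integrable \<nu> (\<lambda>w. (norm v)\<^sup>2 * (exp (((norm z + 3) / \<alpha>) * norm w) * norm (\<psi> w)))"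
        using \<psi> unfolding exp_moments_def by (intro integrable_mult_right) blast
      fix w
      have \<eta>: "norm (?\<eta> w) \<le> norm v * (norm w / \<alpha>)"
        using \<alpha> norm_herm_le[of v w] by (simp add: norm_divide divide_right_mono)
      also have "\<dots> \<le> 1 * (norm w / \<alpha>)" using v \<alpha> by (intro mult_right_mono) auto
      finally have \<eta>': "norm (?\<eta> w) \<le> norm w / \<alpha>" by simp
      have "norm (exp (?\<eta> w) - (1 + ?\<eta> w)) \<le> exp \<bar>Re (?\<eta> w)\<bar> * (norm (?\<eta> w))\<^sup>2"
        using Taylor_exp[of "?\<eta> w" 1] by (simp add: power2_eq_square)
      also have "\<dots> \<le> exp (norm w / \<alpha>) * (norm v * (norm w / \<alpha>))\<^sup>2"
        using \<eta> \<eta>' abs_Re_le_cmod[of "?\<eta> w"] by (intro mult_mono power_mono) auto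
      also have "\<dots> \<le> exp (norm w / \<alpha>) * ((norm v)\<^sup>2 * (exp (norm w / \<alpha>))\<^sup>2)"
      proof -
        have "norm w / \<alpha> \<le> exp (norm w / \<alpha>)" using exp_ge_add_one_self[of "norm w / \<alpha>"] by linarith
        then show ?thesis using \<alpha> unfolding power_mult_distrib
          by (intro mult_left_mono power_mono) auto
      qed
      also have "\<dots> = (norm v)\<^sup>2 * exp (3 * norm w / \<alpha>)"
        by (simp add: power2_eq_square exp_add[symmetric] mult_ac)
      finally have "norm (exp (?\<eta> w) - (1 + ?\<eta> w)) * norm (?e w)
          \<le> ((norm v)\<^sup>2 * exp (3 * norm w / \<alpha>)) * (exp (norm z * norm w / \<alpha>) * norm (\<psi> w))"
        unfolding norm_mult[of "exp _" "\<psi> w"]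
        by (intro mult_mono norm_exp_herm_le[OF \<alpha>]) auto
      also have "\<dots> = (norm v)\<^sup>2 * (exp (((norm z + 3) / \<alpha>) * norm w) * norm (\<psi> w))"
      proof -
        have "((norm z + 3) / \<alpha>) * norm w = norm z * norm w / \<alpha> + 3 * norm w / \<alpha>"
          by (simp add: distrib_right add_divide_distrib)
        then show ?thesis by (simp only: exp_add mult_ac)
      qed
      finally show "norm ((exp (?\<eta> w) - (1 + ?\<eta> w)) * ?e w)
          \<le> (norm v)\<^sup>2 * (exp (((norm z + 3) / \<alpha>) * norm w) * norm (\<psi> w))"
        by (simp only: norm_mult[of "exp _ - _"])
    qed auto
    also have "\<dots> = (norm v)\<^sup>2 * C" by (simp add: C_def)
    finally show ?thesis .
  qed
  show "(\<lambda>v. norm (?R v) / norm v) \<midarrow>0\<rightarrow> 0"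
  proof (rule Lim_null_comparison)
    show "((\<lambda>v. norm v * C) \<longlongrightarrow> 0) (at (0 :: complex^'n))"
      by (intro tendsto_mult_left_zero tendsto_norm_zero tendsto_ident_at)
    show "\<forall>\<^sub>F v in at 0. norm (norm (?R v) / norm v) \<le> norm v * C"
      unfolding eventually_at
    proof (intro exI[of _ 1] conjI ballI impI)
      fix v :: "complex^'n" assume "v \<noteq> 0 \<and> dist v 0 < 1"
      then show "norm (norm (?R v) / norm v) \<le> norm v * C"
        using bound[of v] by (simp add: divide_le_eq power2_eq_square mult_ac)
    qed simp
  qed
qed

lemma pluriharmonic_kernel_integral:
  assumes \<alpha>: "\<alpha> > 0" and \<psi>: "exp_moments \<nu> \<psi>"
  shows "pluriharmonic (kernel_integral \<nu> \<alpha> \<psi>)"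
proof -
  \<comment> \<open>The transform of \<open>?c \<psi> j\<close> is the j-th partial derivative of
    the transform of \<psi>; two applications give the second derivatives.\<close>
  let ?c = "\<lambda>\<psi> j (w :: complex^'n). (cnj (w $ j) / of_real \<alpha>) * \<psi> w"
  note \<psi>' = exp_moments_cnj[OF \<psi>]
  have int1: "integrable \<nu> \<psi>" using integrable_exp_moments[OF \<psi>, of "\<lambda>_. 1" 1 0] by simp
  have split: "kernel_integral \<nu> \<alpha> \<psi> z = (exp_transform \<nu> \<alpha> \<psi> z - (\<integral>w. \<psi> w \<partial>\<nu>)) + cnj (exp_transform \<nu> \<alpha> (\<lambda>w. cnj (\<psi> w)) z)" for z
  proof -
    have "K_ph \<alpha> z w * \<psi> w = exp (herm z w / of_real \<alpha>) * \<psi> w + cnj (exp (herm z w / of_real \<alpha>) * cnj (\<psi> w)) - \<psi> w" for w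
      by (simp add: K_ph_def exp_cnj cnj_herm algebra_simps)
    then show ?thesis
      using integrable_exp_transform[OF \<alpha> \<psi>, of z] integrable_exp_transform[OF \<alpha> \<psi>', of z] int1
      unfolding kernel_integral_def exp_transform_def by (simp del: complex_cnj_mult)
  qed
  have cont: "continuous_on UNIV (exp_transform \<nu> \<alpha> \<phi>)" if "exp_moments \<nu> \<phi>" for \<phi>
    using has_derivative_exp_transform[OF \<alpha> that]
    by (auto intro!: continuous_at_imp_continuous_on has_derivative_continuous)
  have "pluriharmonic (\<lambda>z. (exp_transform \<nu> \<alpha> \<psi> z - (\<integral>w. \<psi> w \<partial>\<nu>)) + cnj (exp_transform \<nu> \<alpha> (\<lambda>w. cnj (\<psi> w)) z))"
  proof (rule pluriharmonic_holomorphic_plus_cnj)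
    show "((\<lambda>z. exp_transform \<nu> \<alpha> \<psi> z - (\<integral>w. \<psi> w \<partial>\<nu>)) has_derivative
        (\<lambda>v. \<Sum>j\<in>UNIV. v $ j * exp_transform \<nu> \<alpha> (?c \<psi> j) z)) (at z)" for z
      using has_derivative_diff[OF has_derivative_exp_transform[OF \<alpha> \<psi>] has_derivative_const] by simp
    show "(exp_transform \<nu> \<alpha> (?c \<psi> j) has_derivative
        (\<lambda>v. \<Sum>k\<in>UNIV. v $ k * exp_transform \<nu> \<alpha> (?c (?c \<psi> j) k) z)) (at z)" for j z
      by (intro has_derivative_exp_transform \<alpha> exp_moments_coordinate \<psi>)
    show "continuous_on UNIV (exp_transform \<nu> \<alpha> (?c (?c \<psi> j) k))" for j k
      by (intro cont exp_moments_coordinate \<psi>)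
    show "(exp_transform \<nu> \<alpha> (\<lambda>w. cnj (\<psi> w)) has_derivative
        (\<lambda>v. \<Sum>j\<in>UNIV. v $ j * exp_transform \<nu> \<alpha> (?c (\<lambda>w. cnj (\<psi> w)) j) z)) (at z)" for z
      by (intro has_derivative_exp_transform \<alpha> \<psi>')
    show "(exp_transform \<nu> \<alpha> (?c (\<lambda>w. cnj (\<psi> w)) j) has_derivative
        (\<lambda>v. \<Sum>k\<in>UNIV. v $ k * exp_transform \<nu> \<alpha> (?c (?c (\<lambda>w. cnj (\<psi> w)) j) k) z)) (at z)" for j z
      by (intro has_derivative_exp_transform \<alpha> exp_moments_coordinate \<psi>')
    show "continuous_on UNIV (exp_transform \<nu> \<alpha> (?c (?c (\<lambda>w. cnj (\<psi> w)) j) k))" for j k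
      by (intro cont exp_moments_coordinate \<psi>')
  qed
  then show ?thesis unfolding split[symmetric] .
qed

text \<open>Moves the kernel from one factor of a pairing to the other, without knowing that the
  kernel integral is square integrable: on the bounded support of \<phi> the kernel grows at most
  exponentially in \<open>w\<close>, and the exponential moments of \<psi> absorb this.\<close>

lemma kernel_integral_fubini:
  assumes \<alpha>: "\<alpha> > 0" and sf: "sigma_finite_measure \<nu>" and \<psi>: "exp_moments \<nu> \<psi>"
    and [measurable]: "\<phi> \<in> borel_measurable borel" and B: "\<And>z. norm (\<phi> z) \<le> B"
    and supp: "\<And>z. norm z > R \<Longrightarrow> \<phi> z = 0"
  shows "(\<integral>z. kernel_integral \<nu> \<alpha> \<psi> z * \<phi> z \<partial>lborel) = (\<integral>w. \<psi> w * (\<integral>z. K_ph \<alpha> z w * \<phi> z \<partial>lborel) \<partial>\<nu>)"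
proof -
  interpret sigma_finite_measure \<nu> by (rule sf)
  interpret pair_sigma_finite \<nu> lborel ..
  have B0: "0 \<le> B" using B[of 0] norm_ge_zero order_trans by blast
  have [measurable]: "\<psi> \<in> borel_measurable \<nu>" using \<psi> by (simp add: exp_moments_def)
  have [measurable]: "(\<lambda>x. K_ph \<alpha> (snd x) (fst x)) \<in> borel_measurable (\<nu> \<Otimes>\<^sub>M lborel)"
    by (rule continuous_imp_borel_measurable_pair) (auto intro!: continuous_intros simp: sets_nu)
  define F where "F = (\<lambda>w z. K_ph \<alpha> z w * \<psi> w * \<phi> z)"
  have [measurable]: "case_prod F \<in> borel_measurable (\<nu> \<Otimes>\<^sub>M lborel)"
    unfolding F_def case_prod_beta by measurable
  have ind: "integrable lborel (\<lambda>z::complex^'n. indicat_real (cball 0 R) z)"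
    using borel_integrable_compact[of "cball (0 :: complex^'n) R" "\<lambda>_. 1 :: real"] by simp
  let ?b = "\<lambda>w. 3 * exp ((\<bar>R\<bar> / \<alpha>) * norm w) * norm (\<psi> w) * B"
  have le: "norm (F w z) \<le> ?b w * indicator (cball 0 R) z" for w z
  proof (cases "norm z \<le> R")
    case True
    have "norm (K_ph \<alpha> z w) \<le> 3 * exp ((\<bar>R\<bar> / \<alpha>) * norm w)"
    proof -
      have "norm z * norm w / \<alpha> \<le> \<bar>R\<bar> * norm w / \<alpha>"
        using True \<alpha> by (intro divide_right_mono mult_right_mono) auto
      then have "exp (norm z * norm w / \<alpha>) \<le> exp ((\<bar>R\<bar> / \<alpha>) * norm w)" by simp
      then show ?thesis using norm_K_ph_le[OF \<alpha>, of z w] by linarith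
    qed
    then show ?thesis
      using True B[of z] B0 unfolding F_def norm_mult by (auto intro!: mult_mono)
  next
    case False
    then show ?thesis using supp[of z] by (simp add: F_def)
  qed
  have intF: "integrable lborel (F w)" for w
  proof (rule Bochner_Integration.integrable_bound[OF integrable_mult_right[where c = "?b w", OF ind]])
    show "F w \<in> borel_measurable lborel"
      unfolding F_def using borel_measurable_K_ph[of \<alpha> w] by (simp add: K_ph_commute[of \<alpha> _ w])
    show "AE z in lborel. norm (F w z) \<le> norm (?b w * indicator (cball 0 R) z)"
      by (intro AE_I2 order_trans[OF le]) (simp only: real_norm_def abs_ge_self)
  qed
  have "integrable (\<nu> \<Otimes>\<^sub>M lborel) (case_prod F)"
  proof (rule Fubini_integrable)
    show "AE w in \<nu>. integrable lborel (\<lambda>z. case_prod F (w, z))" using intF by simp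
    have "integrable \<nu> (\<lambda>w. (3 * B * measure lborel (cball (0::complex^'n) R)) *
        (exp ((\<bar>R\<bar> / \<alpha>) * norm w) * norm (\<psi> w)))"
      using \<psi> unfolding exp_moments_def by (intro integrable_mult_right) blast
    then show "integrable \<nu> (\<lambda>w. \<integral>z. norm (case_prod F (w, z)) \<partial>lborel)"
    proof (rule Bochner_Integration.integrable_bound)
      show "(\<lambda>w. \<integral>z. norm (case_prod F (w, z)) \<partial>lborel) \<in> borel_measurable \<nu>" by measurable
      have "norm (\<integral>z. norm (case_prod F (w, z)) \<partial>lborel)
        \<le> norm ((3 * B * measure lborel (cball (0::complex^'n) R)) * (exp ((\<bar>R\<bar> / \<alpha>) * norm w) * norm (\<psi> w)))" for w
      proof -
        have "(\<integral>z. norm (F w z) \<partial>lborel) \<le> (\<integral>z. ?b w * indicator (cball (0::complex^'n) R) z \<partial>lborel)"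
          by (intro integral_mono integrable_norm integrable_mult_right intF ind le)
        then show ?thesis using B0 by (simp add: abs_mult mult_ac)
      qed
      then show "AE w in \<nu>. norm (\<integral>z. norm (case_prod F (w, z)) \<partial>lborel)
        \<le> norm ((3 * B * measure lborel (cball (0::complex^'n) R)) * (exp ((\<bar>R\<bar> / \<alpha>) * norm w) * norm (\<psi> w)))"
        by simp
    qed
  qed simp
  from Fubini_integral[OF this]
  have "(\<integral>z. (\<integral>w. F w z \<partial>\<nu>) \<partial>lborel) = (\<integral>w. (\<integral>z. F w z \<partial>lborel) \<partial>\<nu>)" .
  moreover have "(\<integral>w. F w z \<partial>\<nu>) = kernel_integral \<nu> \<alpha> \<psi> z * \<phi> z" for z
    by (simp add: F_def kernel_integral_def)
  moreover have "(\<integral>z. F w z \<partial>lborel) = \<psi> w * (\<integral>z. K_ph \<alpha> z w * \<phi> z \<partial>lborel)" for w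
    unfolding F_def by (subst integral_mult_right_zero[symmetric]) (simp add: mult_ac)
  ultimately show ?thesis by simp
qed

end

section \<open>Carleson measures and Toeplitz operators\<close>

abbreviation sqnorm_gauss :: "real \<Rightarrow> (complex^'n \<Rightarrow> complex) \<Rightarrow> real" where
  "sqnorm_gauss \<alpha> f \<equiv> (\<integral>z. (norm (f z))\<^sup>2 * gauss \<alpha> z \<partial>lborel)"

lemma pluriharmonic_continuous: "pluriharmonic f \<Longrightarrow> continuous_on S f"
  by (simp add: pluriharmonic_def C2_fun_def C1_fun_imp_continuous_on)

lemma pluriharmonic_borel_measurable: "pluriharmonic f \<Longrightarrow> f \<in> borel_measurable borel"
  by (intro borel_measurable_continuous_onI pluriharmonic_continuous)

lemma powr_2_weighted:
  fixes f :: "complex^'n \<Rightarrow> complex"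
  shows "norm (f z * exp (- (norm z)\<^sup>2 / (2 * \<alpha>))) powr 2 = (norm (f z))\<^sup>2 * gauss \<alpha> z"
proof -
  have "norm (f z * exp (- (norm z)\<^sup>2 / (2 * \<alpha>))) = norm (f z) * exp (- (norm z)\<^sup>2 / (2 * \<alpha>))"
    by (simp add: norm_mult)
  also have "\<dots> powr 2 = (norm (f z))\<^sup>2 * (exp (- (norm z)\<^sup>2 / (2 * \<alpha>)))\<^sup>2"
    by (simp add: power_mult_distrib)
  also have "(exp (- (norm z)\<^sup>2 / (2 * \<alpha>)))\<^sup>2 = gauss \<alpha> z"
    unfolding gauss_def exp_double[symmetric] by simp
  finally show ?thesis .
qed

lemma PH_space_2_iff:
  "f \<in> PH_space 2 \<alpha> \<longleftrightarrow> pluriharmonic f \<and> integrable lborel (\<lambda>z. (norm (f z))\<^sup>2 * gauss \<alpha> z)"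
  unfolding PH_space_def Lp_space_def powr_2_weighted by (auto intro: pluriharmonic_borel_measurable)

lemma sqnorm_gauss_nonneg: "0 \<le> (\<integral>z. (norm (f z))\<^sup>2 * gauss \<alpha> z \<partial>M)"
  by (intro integral_nonneg_AE) simp

text \<open>The normalising factor occurs on both sides of every norm comparison, so it is hidden
  and only its positivity is exported.\<close>

lemma Lp_norm_2:
  assumes "\<alpha> > 0"
  obtains s where "s > 0" "\<And>f :: complex^'n \<Rightarrow> complex. Lp_norm 2 \<alpha> f = s * sqrt (sqnorm_gauss \<alpha> f)"
proof
  let ?s = "sqrt (2 ^ CARD('n) / (2 * pi * \<alpha>) ^ CARD('n))"
  show "?s > 0" using assms by simp
  show "Lp_norm 2 \<alpha> f = ?s * sqrt (sqnorm_gauss \<alpha> f)" for f :: "complex^'n \<Rightarrow> complex"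
    unfolding Lp_norm_def powr_2_weighted real_sqrt_mult[symmetric]
    using assms sqnorm_gauss_nonneg[where f = f and M = lborel and \<alpha> = \<alpha>] by (simp add: powr_half_sqrt)
qed

lemma Lp_norm_2_le_iff:
  fixes f g :: "complex^'n \<Rightarrow> complex"
  assumes "\<alpha> > 0"
  shows "Lp_norm 2 \<alpha> f \<le> C * Lp_norm 2 \<alpha> g \<longleftrightarrow> sqrt (sqnorm_gauss \<alpha> f) \<le> C * sqrt (sqnorm_gauss \<alpha> g)"
proof -
  obtain s where s: "s > 0" "\<And>f :: complex^'n \<Rightarrow> complex. Lp_norm 2 \<alpha> f = s * sqrt (sqnorm_gauss \<alpha> f)"
    using Lp_norm_2[OF assms, where 'n = 'n] by blast
  show ?thesis
    unfolding s(2) mult.left_commute[of C] using s(1) by (simp only: mult_le_cancel_left_pos)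
qed

lemma carleson_2_iff:
  fixes \<mu> :: "(complex^'n) measure"
  assumes \<alpha>: "\<alpha> > 0"
  shows "carleson 2 \<alpha> \<mu> \<longleftrightarrow> (\<exists>C>0. \<forall>f\<in>PH_space 2 \<alpha>. integrable \<mu> (\<lambda>z. (norm (f z))\<^sup>2 * gauss \<alpha> z) \<and>
     sqrt (\<integral>z. (norm (f z))\<^sup>2 * gauss \<alpha> z \<partial>\<mu>) \<le> C * sqrt (sqnorm_gauss \<alpha> f))"
proof -
  obtain s where s: "s > 0" "\<And>f :: complex^'n \<Rightarrow> complex. Lp_norm 2 \<alpha> f = s * sqrt (sqnorm_gauss \<alpha> f)"
    using Lp_norm_2[OF \<alpha>, where 'n = 'n] by blast
  have half: "(\<integral>z. (norm (f z))\<^sup>2 * gauss \<alpha> z \<partial>\<mu>) powr (1 / 2) = sqrt (\<integral>z. (norm (f z))\<^sup>2 * gauss \<alpha> z \<partial>\<mu>)"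
    for f :: "complex^'n \<Rightarrow> complex"
    using sqnorm_gauss_nonneg[where f = f and M = \<mu> and \<alpha> = \<alpha>] by (simp add: powr_half_sqrt)
  have "(\<exists>C>0. \<forall>f\<in>A. P f \<and> q f \<le> C * (s * N f)) \<longleftrightarrow> (\<exists>C>0. \<forall>f\<in>A. P f \<and> q f \<le> C * N f)"
    for A and P and q N :: "(complex^'n \<Rightarrow> complex) \<Rightarrow> real"
  proof (intro iffI; elim exE conjE)
    fix C assume "C > 0" "\<forall>f\<in>A. P f \<and> q f \<le> C * (s * N f)"
    then show "\<exists>C>0. \<forall>f\<in>A. P f \<and> q f \<le> C * N f"
      using s(1) by (intro exI[of _ "C * s"]) (simp add: mult.assoc)
  next
    fix C assume "C > 0" "\<forall>f\<in>A. P f \<and> q f \<le> C * N f"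
    then show "\<exists>C>0. \<forall>f\<in>A. P f \<and> q f \<le> C * (s * N f)"
      using s(1) by (intro exI[of _ "C / s"]) simp
  qed
  then show ?thesis unfolding carleson_def powr_2_weighted half s(2) .
qed

lemma toeplitz_eq_kernel_integral:
  "toeplitz \<alpha> \<mu> f = kernel_integral \<mu> \<alpha> (\<lambda>w. f w * gauss \<alpha> w)"
  unfolding fun_eq_iff toeplitz_def kernel_integral_def gauss_def by (simp add: mult.assoc exp_of_real[symmetric])

lemma exp_moments_gauss:
  fixes f :: "complex^'n \<Rightarrow> complex"
  assumes \<alpha>: "\<alpha> > 0" and [measurable]: "f \<in> borel_measurable borel"
    and le: "\<And>z. norm (f z) \<le> C * exp (c * norm z)"
  shows "exp_moments lborel (\<lambda>z. f z * gauss \<alpha> z)"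
  unfolding exp_moments_def
proof (intro conjI allI)
  fix d
  have "norm (exp (d * norm z) * norm (f z)) \<le> C * exp ((d + c) * norm z)" for z
    using mult_left_mono[OF le[of z], of "exp (d * norm z)"] by (simp add: abs_mult exp_add algebra_simps)
  from integrable_exp_growth_gauss[OF \<alpha> _ this]
  show "integrable lborel (\<lambda>z. exp (d * norm z) * norm (f z * gauss \<alpha> z))"
    by (simp add: norm_mult mult_ac)
qed simp

section \<open>Projections of bounded functions with bounded support\<close>

text \<open>The map \<open>s\<close> is the identity for the projection itself and a simple function
  close to the identity for its Riemann sums; the bound depends on \<open>s\<close> only through
  \<open>R\<close>.\<close>

lemma norm_kernel_integral_truncated_le:
  fixes \<phi> :: "complex^'n \<Rightarrow> complex" and s :: "complex^'n \<Rightarrow> complex^'n"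
  assumes \<alpha>: "\<alpha> > 0" and \<phi> [measurable]: "\<phi> \<in> borel_measurable borel" and B: "\<And>z. norm (\<phi> z) \<le> B"
    and s: "\<And>w. \<phi> w \<noteq> 0 \<Longrightarrow> norm (s w) \<le> R"
  shows "norm (K_ph \<alpha> z (s w) * (\<phi> w * gauss \<alpha> w)) \<le> (3 * B * exp ((R / \<alpha>) * norm z)) * gauss \<alpha> w"
    and "norm (\<integral>w. K_ph \<alpha> z (s w) * (\<phi> w * gauss \<alpha> w) \<partial>lborel)
      \<le> (3 * B * gauss_mass \<alpha> TYPE('n)) * exp ((R / \<alpha>) * norm z)"
proof -
  have B0: "0 \<le> B" using B[of 0] norm_ge_zero order_trans by blast
  have le: "norm (K_ph \<alpha> z (s w) * (\<phi> w * gauss \<alpha> w)) \<le> (3 * B * exp ((R / \<alpha>) * norm z)) * gauss \<alpha> w" for w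
  proof (cases "\<phi> w = 0")
    case False
    have "norm z * norm (s w) / \<alpha> \<le> (R / \<alpha>) * norm z"
      using divide_right_mono[OF mult_left_mono[OF s[OF False], of "norm z"], of \<alpha>] \<alpha>
      by (simp add: mult.commute)
    then have "exp (norm z * norm (s w) / \<alpha>) \<le> exp ((R / \<alpha>) * norm z)" by simp
    then have "norm (K_ph \<alpha> z (s w)) \<le> 3 * exp ((R / \<alpha>) * norm z)"
      using norm_K_ph_le[OF \<alpha>, of z "s w"] by linarith
    then have "norm (K_ph \<alpha> z (s w)) * norm (\<phi> w) \<le> (3 * exp ((R / \<alpha>) * norm z)) * B"
      using B[of w] by (intro mult_mono) auto
    then have "(norm (K_ph \<alpha> z (s w)) * norm (\<phi> w)) * gauss \<alpha> w \<le> ((3 * exp ((R / \<alpha>) * norm z)) * B) * gauss \<alpha> w"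
      by (intro mult_right_mono) auto
    then show ?thesis by (simp add: norm_mult mult_ac)
  qed (use B0 in simp)
  then show "norm (K_ph \<alpha> z (s w) * (\<phi> w * gauss \<alpha> w)) \<le> (3 * B * exp ((R / \<alpha>) * norm z)) * gauss \<alpha> w" .
  have "norm (\<integral>w. K_ph \<alpha> z (s w) * (\<phi> w * gauss \<alpha> w) \<partial>lborel)
      \<le> (\<integral>w. norm (K_ph \<alpha> z (s w) * (\<phi> w * gauss \<alpha> w)) \<partial>lborel)"
    by (rule integral_norm_bound)
  also have "\<dots> \<le> (\<integral>w. (3 * B * exp ((R / \<alpha>) * norm z)) * gauss \<alpha> (w :: complex^'n) \<partial>lborel)"
    by (rule Bochner_Integration.integral_mono'[OF integrable_mult_right[OF integrable_gauss[OF \<alpha>]] le])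
      (simp add: B0)
  finally show "norm (\<integral>w. K_ph \<alpha> z (s w) * (\<phi> w * gauss \<alpha> w) \<partial>lborel)
      \<le> (3 * B * gauss_mass \<alpha> TYPE('n)) * exp ((R / \<alpha>) * norm z)"
    by (simp add: gauss_mass_def mult_ac)
qed

text \<open>Write M for \<open>gauss_mass\<close>. Up to the factor M, \<open>Q\<close> is the
  projection of \<phi>, and the estimate says that the projection is a contraction. Fubini's theorem
  and the reproducing formula for \<open>Q\<close> give M <Q, \<phi>> = <Q, Q>; Cauchy-Schwarz on
  the left and division by the norm of \<open>Q\<close> finish. Membership in the space follows from
  the exponential growth bound.\<close>

lemma
  fixes \<phi> :: "complex^'n \<Rightarrow> complex"
  assumes \<alpha>: "\<alpha> > 0" and \<phi> [measurable]: "\<phi> \<in> borel_measurable borel" and B: "\<And>z. norm (\<phi> z) \<le> B"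
    and supp: "\<And>z. norm z > R \<Longrightarrow> \<phi> z = 0"
  defines "Q \<equiv> kernel_integral lborel \<alpha> (\<lambda>z. \<phi> z * gauss \<alpha> z)"
  shows kernel_integral_in_PH_space: "Q \<in> PH_space 2 \<alpha>"
    and sqnorm_kernel_integral_le: "sqrt (sqnorm_gauss \<alpha> Q) \<le> gauss_mass \<alpha> TYPE('n) * sqrt (sqnorm_gauss \<alpha> \<phi>)"
proof -
  let ?M = "gauss_mass \<alpha> TYPE('n)"
  have M: "?M > 0" by (rule gauss_mass_pos[OF \<alpha>])
  have mom: "exp_moments lborel (\<lambda>z. \<phi> z * gauss \<alpha> z)"
    by (rule exp_moments_gauss[OF \<alpha> \<phi>, where C = B and c = 0]) (use B in simp)
  have Q: "pluriharmonic Q"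
    unfolding Q_def by (rule pluriharmonic_kernel_integral[OF _ \<alpha> mom]) simp
  note [measurable] = pluriharmonic_borel_measurable[OF Q]
  have growth: "norm (Q z) \<le> (3 * B * ?M) * exp ((R / \<alpha>) * norm z)" for z
    unfolding Q_def kernel_integral_def
    by (rule norm_kernel_integral_truncated_le(2)[OF \<alpha> \<phi> B, where s = "\<lambda>w. w"]) (use supp in force)
  have L2: "integrable lborel (\<lambda>z. (norm (Q z))\<^sup>2 * gauss \<alpha> z)"
    by (rule integrable_square_exp_growth_gauss[OF \<alpha> _ growth]) simp
  show "Q \<in> PH_space 2 \<alpha>" using Q L2 by (simp add: PH_space_2_iff)
  have L2\<phi>: "integrable lborel (\<lambda>z. (norm (cnj (\<phi> z)))\<^sup>2 * gauss \<alpha> z)"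
    by (rule integrable_square_exp_growth_gauss[OF \<alpha>, where C = B and c = 0]) (use B in simp_all)
  have repr: "kernel_integral lborel \<alpha> (\<lambda>z. Q z * gauss \<alpha> z) z = ?M * Q z" for z
    using pluriharmonic_reproducing[OF \<alpha> Q L2, of z] by (simp add: kernel_integral_def mult_ac)
  have cnjQ: "(\<integral>z. K_ph \<alpha> z w * (cnj (\<phi> z) * gauss \<alpha> z) \<partial>lborel) = cnj (Q w)" for w
  proof -
    have "K_ph \<alpha> z w * (cnj (\<phi> z) * gauss \<alpha> z) = cnj (K_ph \<alpha> w z * (\<phi> z * gauss \<alpha> z))" for z
      by (simp add: cnj_K_ph K_ph_commute[of \<alpha> w])
    then show ?thesis
      unfolding Q_def kernel_integral_def by (simp only: Bochner_Integration.integral_cnj)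
  qed
  have "?M * (\<integral>z. Q z * cnj (\<phi> z) * gauss \<alpha> z \<partial>lborel)
      = (\<integral>z. kernel_integral lborel \<alpha> (\<lambda>z. Q z * gauss \<alpha> z) z * (cnj (\<phi> z) * gauss \<alpha> z) \<partial>lborel)"
    unfolding repr by (simp add: mult.assoc)
  also have "\<dots> = (\<integral>w. (Q w * gauss \<alpha> w) * (\<integral>z. K_ph \<alpha> z w * (cnj (\<phi> z) * gauss \<alpha> z) \<partial>lborel) \<partial>lborel)"
  proof (rule kernel_integral_fubini[OF _ \<alpha> _ exp_moments_gauss[OF \<alpha> _ growth]])
    show "norm (cnj (\<phi> z) * gauss \<alpha> z) \<le> B * 1" for z
      unfolding norm_mult using B[of z] order_trans[OF norm_ge_zero B] \<alpha>
      by (intro mult_mono) (auto simp: gauss_def)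
    show "norm z > R \<Longrightarrow> cnj (\<phi> z) * gauss \<alpha> z = 0" for z by (simp add: supp)
  qed (use lborel.sigma_finite_measure_axioms in auto)
  also have "\<dots> = of_real (sqnorm_gauss \<alpha> Q)"
    unfolding cnjQ by (subst integral_complex_of_real[symmetric])
      (auto intro!: Bochner_Integration.integral_cong simp: complex_norm_square mult_ac simp del: of_real_power)
  finally have "sqnorm_gauss \<alpha> Q = norm (?M * (\<integral>z. Q z * cnj (\<phi> z) * gauss \<alpha> z \<partial>lborel))"
    using sqnorm_gauss_nonneg[where f = Q and M = lborel and \<alpha> = \<alpha>] by simp
  also have "\<dots> \<le> ?M * (sqrt (sqnorm_gauss \<alpha> Q) * sqrt (\<integral>z. (norm (cnj (\<phi> z)))\<^sup>2 * gauss \<alpha> z \<partial>lborel))"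
    using M norm_integral_mult_weighted_le[OF _ _ _ _ L2 L2\<phi>]
    by (simp add: norm_mult del: complex_mod_cnj)
  finally have le: "sqnorm_gauss \<alpha> Q \<le> ?M * (sqrt (sqnorm_gauss \<alpha> Q) * sqrt (sqnorm_gauss \<alpha> \<phi>))" by simp
  show "sqrt (sqnorm_gauss \<alpha> Q) \<le> ?M * sqrt (sqnorm_gauss \<alpha> \<phi>)"
  proof (cases "sqnorm_gauss \<alpha> Q = 0")
    case True
    then show ?thesis using M by (simp add: sqnorm_gauss_nonneg)
  next
    case False
    have pos: "sqrt (sqnorm_gauss \<alpha> Q) > 0"
      using le_neq_trans[OF sqnorm_gauss_nonneg False[symmetric]] by simp
    have "sqrt (sqnorm_gauss \<alpha> Q) * sqrt (sqnorm_gauss \<alpha> Q) \<le> sqrt (sqnorm_gauss \<alpha> Q) * (?M * sqrt (sqnorm_gauss \<alpha> \<phi>))"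
      using le sqnorm_gauss_nonneg[where f = Q and M = lborel and \<alpha> = \<alpha>] by (simp add: mult_ac)
    then show ?thesis using pos by (simp only: mult_le_cancel_left_pos)
  qed
qed


section \<open>Test functions: exponentials and finite combinations of kernels\<close>

text \<open>Some coordinate has absolute value at least the norm divided by the dimension.
  Exponentials of real linear forms are wanted because they are squared moduli of holomorphic
  exponentials, to which the Carleson inequality applies.\<close>

lemma exp_norm_le_sum_exp_inner:
  obtains D where "D > 0"
    "\<And>w :: 'a::euclidean_space. exp (c * norm w) \<le> (\<Sum>b\<in>Basis. exp (D * (w \<bullet> b)) + exp (- D * (w \<bullet> b)))"
proof
  \<comment> \<open>The summand 1 keeps the constant positive when \<open>c = 0\<close>.\<close>
  let ?D = "(\<bar>c\<bar> + 1) * real DIM('a)"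
  show "?D > 0" by simp
  show "exp (c * norm w) \<le> (\<Sum>b\<in>Basis. exp (?D * (w \<bullet> b)) + exp (- ?D * (w \<bullet> b)))" for w :: 'a
  proof -
    have "\<exists>b\<in>Basis. norm w \<le> real DIM('a) * \<bar>w \<bullet> b\<bar>"
    proof (rule ccontr)
      assume "\<not> ?thesis"
      then have "(\<Sum>b\<in>(Basis::'a set). real DIM('a) * \<bar>w \<bullet> b\<bar>) < (\<Sum>b\<in>(Basis::'a set). norm w)"
        by (intro sum_strict_mono) auto
      then show False using norm_le_l1[of w] by (simp add: sum_distrib_left[symmetric])
    qed
    then obtain b where b: "b \<in> Basis" "norm w \<le> real DIM('a) * \<bar>w \<bullet> b\<bar>" by blast
    have "c * norm w \<le> (\<bar>c\<bar> + 1) * norm w" by (intro mult_right_mono) auto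
    also have "\<dots> \<le> (\<bar>c\<bar> + 1) * (real DIM('a) * \<bar>w \<bullet> b\<bar>)" using b(2) by (intro mult_left_mono) auto
    finally have "c * norm w \<le> ?D * \<bar>w \<bullet> b\<bar>" by (simp add: mult.assoc)
    then have "exp (c * norm w) \<le> exp (?D * \<bar>w \<bullet> b\<bar>)" by simp
    also have "\<dots> \<le> exp (?D * (w \<bullet> b)) + exp (- ?D * (w \<bullet> b))"
      by (cases "0 \<le> w \<bullet> b") simp_all
    also have "\<dots> \<le> (\<Sum>b\<in>Basis. exp (?D * (w \<bullet> b)) + exp (- ?D * (w \<bullet> b)))"
      using b(1) by (intro member_le_sum) (auto intro: add_nonneg_nonneg)
    finally show ?thesis .
  qed
qed

text \<open>The finite-sum counterpart of \<open>exp_transform\<close>: it differentiates by the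
  same rule, multiplying the coefficient at \<open>w\<close> by
  \<open>cnj (w $ j) / of_real \<alpha>\<close>.\<close>

definition exp_sum :: "real \<Rightarrow> (complex^'n) set \<Rightarrow> (complex^'n \<Rightarrow> complex) \<Rightarrow> complex^'n \<Rightarrow> complex" where
  "exp_sum \<alpha> W c z = (\<Sum>w\<in>W. c w * exp (herm z w / of_real \<alpha>))"

lemma has_derivative_exp_sum:
  "(exp_sum \<alpha> W c has_derivative (\<lambda>v. \<Sum>j\<in>UNIV. v $ j * exp_sum \<alpha> W (\<lambda>w. c w * (cnj (w $ j) / of_real \<alpha>)) z)) (at z)"
proof -
  have herm: "((\<lambda>z. herm z w / of_real \<alpha>) has_derivative (\<lambda>v. herm v w / of_real \<alpha>)) (at z)" for w
  proof -
    have "bounded_linear (\<lambda>z. herm z w / of_real \<alpha>)"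
      unfolding linear_conv_bounded_linear[symmetric] divide_inverse
      by (rule linearI) (simp_all add: herm_add_left distrib_right, simp add: herm_def flip: scaleR_sum_right)
    then show ?thesis by (rule bounded_linear_imp_has_derivative)
  qed
  have "((\<lambda>z. exp (herm z w / of_real \<alpha>)) has_derivative
      (\<lambda>v. exp (herm z w / of_real \<alpha>) * (herm v w / of_real \<alpha>))) (at z)" for w
    using has_derivative_compose[OF herm[of w] DERIV_exp[unfolded has_field_derivative_def]] .
  then have "((\<lambda>z. \<Sum>w\<in>W. c w * exp (herm z w / of_real \<alpha>)) has_derivative
      (\<lambda>v. \<Sum>w\<in>W. c w * (exp (herm z w / of_real \<alpha>) * (herm v w / of_real \<alpha>)))) (at z)"
    by (intro has_derivative_sum has_derivative_mult_right)
  moreover have "(\<Sum>w\<in>W. c w * (exp (herm z w / of_real \<alpha>) * (herm v w / of_real \<alpha>)))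
      = (\<Sum>j\<in>UNIV. v $ j * exp_sum \<alpha> W (\<lambda>w. c w * (cnj (w $ j) / of_real \<alpha>)) z)" for v
    unfolding exp_sum_def sum_distrib_left herm_def[of v] sum_divide_distrib
    by (subst sum.swap) (simp add: mult_ac)
  ultimately show ?thesis by (simp add: exp_sum_def[abs_def])
qed

lemma pluriharmonic_exp_sum:
  "pluriharmonic (\<lambda>z. (exp_sum \<alpha> W c z - e) + cnj (exp_sum \<alpha> W d z))"
proof (rule pluriharmonic_holomorphic_plus_cnj)
  have cont: "continuous_on UNIV (exp_sum \<alpha> W c)" for c
    using has_derivative_exp_sum[of \<alpha> W c]
    by (auto intro!: continuous_at_imp_continuous_on has_derivative_continuous)
  let ?c = "\<lambda>c j (w :: complex^'n). c w * (cnj (w $ j) / of_real \<alpha>)"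
  show "((\<lambda>z. exp_sum \<alpha> W c z - e) has_derivative (\<lambda>v. \<Sum>j\<in>UNIV. v $ j * exp_sum \<alpha> W (?c c j) z)) (at z)" for z
    using has_derivative_diff[OF has_derivative_exp_sum has_derivative_const] by simp
  show "(exp_sum \<alpha> W (?c c j) has_derivative (\<lambda>v. \<Sum>k\<in>UNIV. v $ k * exp_sum \<alpha> W (?c (?c c j) k) z)) (at z)" for j z
    by (rule has_derivative_exp_sum)
  show "continuous_on UNIV (exp_sum \<alpha> W (?c (?c c j) k))" for j k by (rule cont)
  show "(exp_sum \<alpha> W d has_derivative (\<lambda>v. \<Sum>j\<in>UNIV. v $ j * exp_sum \<alpha> W (?c d j) z)) (at z)" for z
    by (rule has_derivative_exp_sum)
  show "(exp_sum \<alpha> W (?c d j) has_derivative (\<lambda>v. \<Sum>k\<in>UNIV. v $ k * exp_sum \<alpha> W (?c (?c d j) k) z)) (at z)" for j z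
    by (rule has_derivative_exp_sum)
  show "continuous_on UNIV (exp_sum \<alpha> W (?c (?c d j) k))" for j k by (rule cont)
qed

text \<open>These are the functions on which a Carleson measure is tested to obtain its exponential
  moments.\<close>

lemma exp_herm_in_PH_space:
  assumes \<alpha>: "\<alpha> > 0"
  shows "(\<lambda>z. exp (herm z a / of_real \<alpha>)) \<in> PH_space 2 \<alpha>"
  unfolding PH_space_2_iff
proof
  show "pluriharmonic (\<lambda>z. exp (herm z a / of_real \<alpha>))"
    using pluriharmonic_exp_sum[of \<alpha> "{a}" "\<lambda>_. 1" 0 "\<lambda>_. 0"] by (simp add: exp_sum_def)
  then show "integrable lborel (\<lambda>z. (norm (exp (herm z a / of_real \<alpha>)))\<^sup>2 * gauss \<alpha> z)"
    using norm_exp_herm_le[OF \<alpha>, of _ a]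
    by (intro integrable_square_exp_growth_gauss[OF \<alpha>, where C = 1 and c = "norm a / \<alpha>"])
      (auto intro: pluriharmonic_borel_measurable simp: mult.commute)
qed

lemma kernel_span_subset_PH_space:
  fixes c :: "complex^'n \<Rightarrow> complex"
  assumes \<alpha>: "\<alpha> > 0" and W: "finite W"
  shows "(\<lambda>z. \<Sum>w\<in>W. c w * K_ph \<alpha> z w) \<in> PH_space 2 \<alpha>"
  unfolding PH_space_2_iff
proof
  have eq: "(\<lambda>z. \<Sum>w\<in>W. c w * K_ph \<alpha> z w)
      = (\<lambda>z. (exp_sum \<alpha> W c z - (\<Sum>w\<in>W. c w)) + cnj (exp_sum \<alpha> W (\<lambda>w. cnj (c w)) z))"
    by (auto simp: exp_sum_def K_ph_def exp_cnj cnj_herm algebra_simps sum.distrib sum_subtractf)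
  show ph: "pluriharmonic (\<lambda>z. \<Sum>w\<in>W. c w * K_ph \<alpha> z w)"
    unfolding eq by (rule pluriharmonic_exp_sum)
  show "integrable lborel (\<lambda>z. (norm (\<Sum>w\<in>W. c w * K_ph \<alpha> z w))\<^sup>2 * gauss \<alpha> z)"
  proof (rule integrable_square_exp_growth_gauss[OF \<alpha> pluriharmonic_borel_measurable[OF ph]])
    fix z :: "complex^'n"
    let ?R = "\<Sum>w\<in>W. norm w"
    have "norm (\<Sum>w\<in>W. c w * K_ph \<alpha> z w) \<le> (\<Sum>w\<in>W. norm (c w) * (3 * exp ((?R / \<alpha>) * norm z)))"
    proof (intro order_trans[OF norm_sum] sum_mono)
      fix w assume "w \<in> W"
      then have "norm w \<le> ?R" using W by (intro member_le_sum) auto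
      then have "norm z * norm w / \<alpha> \<le> (?R / \<alpha>) * norm z"
        using divide_right_mono[OF mult_left_mono, of "norm w" ?R "norm z" \<alpha>] \<alpha> by (simp add: mult.commute)
      then have "exp (norm z * norm w / \<alpha>) \<le> exp ((?R / \<alpha>) * norm z)" by simp
      then have "norm (K_ph \<alpha> z w) \<le> 3 * exp ((?R / \<alpha>) * norm z)"
        using norm_K_ph_le[OF \<alpha>, of z w] by linarith
      then show "norm (c w * K_ph \<alpha> z w) \<le> norm (c w) * (3 * exp ((?R / \<alpha>) * norm z))"
        unfolding norm_mult by (intro mult_left_mono) auto
    qed
    also have "\<dots> = (3 * (\<Sum>w\<in>W. norm (c w))) * exp ((?R / \<alpha>) * norm z)"
      by (simp add: sum_distrib_right[symmetric])
    finally show "norm (\<Sum>w\<in>W. c w * K_ph \<alpha> z w) \<le> (3 * (\<Sum>w\<in>W. norm (c w))) * exp ((?R / \<alpha>) * norm z)" .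
  qed
qed

text \<open>On the ball of radius k the Gaussian is at least exp (- k^2 / \<alpha>), so the ball has
  finite measure. Fubini's theorem for \<mu> rests on this.\<close>

lemma sigma_finite_measure_gauss:
  fixes \<mu> :: "(complex^'n) measure"
  assumes "sets \<mu> = sets borel" "integrable \<mu> (gauss \<alpha>)" "\<alpha> > 0"
  shows "sigma_finite_measure \<mu>"
proof
  have sp: "space \<mu> = UNIV" using sets_eq_imp_space_eq[OF assms(1)] by simp
  define A where "A = (\<lambda>k::nat. cball (0 :: complex^'n) (real k))"
  have "emeasure \<mu> (A k) \<noteq> \<infinity>" for k
  proof -
    have "integrable \<mu> (\<lambda>z. indicat_real (A k) z)"
    proof (rule Bochner_Integration.integrable_bound[OF integrable_mult_right[where c = "exp ((real k)\<^sup>2 / \<alpha>)", OF assms(2)]])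
      show "AE z in \<mu>. norm (indicat_real (A k) z) \<le> norm (exp ((real k)\<^sup>2 / \<alpha>) * gauss \<alpha> z)"
      proof (rule AE_I2)
        fix z :: "complex^'n"
        have "1 \<le> exp ((real k)\<^sup>2 / \<alpha>) * gauss \<alpha> z" if "norm z \<le> real k"
          using that assms(3) by (simp add: gauss_def exp_add[symmetric] divide_right_mono power_mono)
        then show "norm (indicat_real (A k) z) \<le> norm (exp ((real k)\<^sup>2 / \<alpha>) * gauss \<alpha> z)"
          by (auto simp: A_def split: split_indicator)
      qed
    qed (auto simp: A_def assms(1) intro!: borel_measurable_indicator)
    then show ?thesis by (simp add: integrable_indicator_iff sp less_top)
  qed
  moreover have "(\<Union>k. A k) = UNIV" by (auto simp: A_def real_arch_simple)
  ultimately show "\<exists>A. countable A \<and> A \<subseteq> sets \<mu> \<and> \<Union> A = space \<mu> \<and> (\<forall>a\<in>A. emeasure \<mu> a \<noteq> \<infinity>)"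
    by (intro exI[of _ "range A"]) (auto simp: A_def assms(1) sp)
qed


section \<open>From the Carleson inequality to the Toeplitz operator\<close>

lemma carleson_imp_toeplitz_bounded:
  fixes \<mu> :: "(complex^'n) measure"
  assumes \<alpha>: "\<alpha> > 0" and sets_mu: "sets \<mu> = sets borel" and carleson: "carleson 2 \<alpha> \<mu>"
  shows "toeplitz_bounded \<alpha> \<mu>"
proof -
  note [measurable_cong] = sets_mu
  let ?M = "gauss_mass \<alpha> TYPE('n)"
  have M: "?M > 0" by (rule gauss_mass_pos[OF \<alpha>])
  obtain C where C: "C > 0"
    and intC: "\<And>f. f \<in> PH_space 2 \<alpha> \<Longrightarrow> integrable \<mu> (\<lambda>z. (norm (f z))\<^sup>2 * gauss \<alpha> z)"
    and leC: "\<And>f. f \<in> PH_space 2 \<alpha> \<Longrightarrow>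
      sqrt (\<integral>z. (norm (f z))\<^sup>2 * gauss \<alpha> z \<partial>\<mu>) \<le> C * sqrt (sqnorm_gauss \<alpha> f)"
    using carleson unfolding carleson_2_iff[OF \<alpha>] by blast
  \<comment> \<open>The point \<alpha> r / 2 times \<open>b\<close> is chosen so that the squared
    modulus of the exponential is \<open>exp (r * (w \<bullet> b))\<close>: squaring doubles the
    real part.\<close>
  have int_inner: "integrable \<mu> (\<lambda>w. exp (r * (w \<bullet> b)) * gauss \<alpha> w)" for r :: real and b :: "complex^'n"
  proof -
    have "(norm (exp (herm w ((\<alpha> * (r / 2)) *\<^sub>R b) / of_real \<alpha>)))\<^sup>2 = exp (r * (w \<bullet> b))" for w
    proof -
      have "Re (herm w ((\<alpha> * (r / 2)) *\<^sub>R b) / of_real \<alpha>) = r / 2 * (w \<bullet> b)"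
        using \<alpha> by (simp add: Re_herm)
      then show ?thesis by (simp only: norm_exp_eq_Re exp_double[symmetric]) simp
    qed
    with intC[OF exp_herm_in_PH_space[OF \<alpha>, of "(\<alpha> * (r / 2)) *\<^sub>R b"]] show ?thesis by simp
  qed
  have moments: "integrable \<mu> (\<lambda>w. exp (c * norm w) * gauss \<alpha> w)" for c
  proof -
    obtain D where D: "\<And>w :: complex^'n. exp (c * norm w) \<le> (\<Sum>b\<in>Basis. exp (D * (w \<bullet> b)) + exp (- D * (w \<bullet> b)))"
      using exp_norm_le_sum_exp_inner[of c] by blast
    have "integrable \<mu> (\<lambda>w. \<Sum>b\<in>Basis. exp (D * (w \<bullet> b)) * gauss \<alpha> w + exp (- D * (w \<bullet> b)) * gauss \<alpha> w)"
      by (intro Bochner_Integration.integrable_sum Bochner_Integration.integrable_add int_inner)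
    then show ?thesis
    proof (rule Bochner_Integration.integrable_bound)
      show "AE w in \<mu>. norm (exp (c * norm w) * gauss \<alpha> w)
        \<le> norm (\<Sum>b\<in>Basis. exp (D * (w \<bullet> b)) * gauss \<alpha> w + exp (- D * (w \<bullet> b)) * gauss \<alpha> w)"
      proof (rule AE_I2)
        fix w :: "complex^'n"
        have "norm (exp (c * norm w) * gauss \<alpha> w)
          \<le> (\<Sum>b\<in>Basis. exp (D * (w \<bullet> b)) + exp (- D * (w \<bullet> b))) * gauss \<alpha> w"
          using mult_right_mono[OF D[of w], of "gauss \<alpha> w"] by simp
        also have "\<dots> = (\<Sum>b\<in>Basis. exp (D * (w \<bullet> b)) * gauss \<alpha> w + exp (- D * (w \<bullet> b)) * gauss \<alpha> w)"
          by (simp only: sum_distrib_right distrib_right)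
        also have "\<dots> \<le> norm \<dots>" by simp
        finally show "norm (exp (c * norm w) * gauss \<alpha> w)
          \<le> norm (\<Sum>b\<in>Basis. exp (D * (w \<bullet> b)) * gauss \<alpha> w + exp (- D * (w \<bullet> b)) * gauss \<alpha> w)" .
      qed
    qed simp
  qed
  have sf: "sigma_finite_measure \<mu>"
    using moments[of 0] by (intro sigma_finite_measure_gauss[OF sets_mu _ \<alpha>]) simp
  have mom: "exp_moments \<mu> (\<lambda>w. f w * gauss \<alpha> w)" if f: "f \<in> PH_space 2 \<alpha>" for f
  proof -
    have [measurable]: "f \<in> borel_measurable borel"
      using f by (simp add: PH_space_2_iff pluriharmonic_borel_measurable)
    \<comment> \<open>Both factors are square integrable for the weighted \<mu>: \<open>f\<close> by
      the Carleson inequality, the exponential by its moment at \<open>2 * c\<close>.\<close>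
    have "integrable \<mu> (\<lambda>w. norm (of_real (exp (c * norm w)) :: complex) * norm (f w) * gauss \<alpha> w)" for c
    proof (rule integrable_norm_mult_weighted)
      show "integrable \<mu> (\<lambda>w. (norm (of_real (exp (c * norm w)) :: complex))\<^sup>2 * gauss \<alpha> w)"
        using moments[of "2 * c"] by (simp add: exp_double[symmetric] mult.assoc)
    qed (use intC[OF f] in auto)
    then show ?thesis by (simp add: exp_moments_def norm_mult mult.assoc)
  qed
  define T where "T = toeplitz \<alpha> \<mu>"
  have T: "T f = kernel_integral \<mu> \<alpha> (\<lambda>w. f w * gauss \<alpha> w)" for f
    unfolding T_def by (rule toeplitz_eq_kernel_integral)
  have phT: "pluriharmonic (T f)" if "f \<in> PH_space 2 \<alpha>" for f
    unfolding T by (rule pluriharmonic_kernel_integral[OF sets_mu \<alpha> mom[OF that]])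
  have trunc: "(\<integral>z. (norm (T f z))\<^sup>2 * (indicator {..real k} (norm z) * gauss \<alpha> z) \<partial>lborel)
      \<le> (C\<^sup>2 * ?M)\<^sup>2 * sqnorm_gauss \<alpha> f"
    if f: "f \<in> PH_space 2 \<alpha>" for f k
  proof -
    \<comment> \<open>The conjugate of \<open>T f\<close> cut off at radius \<open>k\<close>: its
      pairing with \<open>T f\<close> is its own squared norm, and it is bounded with bounded
      support.\<close>
    define \<phi> where "\<phi> = (\<lambda>z. indicator {..real k} (norm z) * cnj (T f z))"
    have [measurable]: "T f \<in> borel_measurable borel" "f \<in> borel_measurable borel"
      using phT[OF f] f by (simp_all add: PH_space_2_iff pluriharmonic_borel_measurable)
    have \<phi>m [measurable]: "\<phi> \<in> borel_measurable borel" unfolding \<phi>_def by measurable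
    have "compact (T f ` cball 0 (real k))"
      by (intro compact_continuous_image pluriharmonic_continuous phT f compact_cball)
    then obtain B where B: "\<And>z. norm z \<le> real k \<Longrightarrow> norm (T f z) \<le> B" "B > 0"
      by (force dest!: compact_imp_bounded simp: bounded_pos)
    have \<phi>B: "norm (\<phi> z) \<le> B" for z using B by (auto simp: \<phi>_def split: split_indicator)
    have \<phi>0: "norm z > real k \<Longrightarrow> \<phi> z = 0" for z by (simp add: \<phi>_def)
    define Q where "Q = kernel_integral lborel \<alpha> (\<lambda>z. \<phi> z * gauss \<alpha> z)"
    have Q: "Q \<in> PH_space 2 \<alpha>"
      unfolding Q_def by (rule kernel_integral_in_PH_space[OF \<alpha> \<phi>m \<phi>B \<phi>0])
    have leQ: "sqrt (sqnorm_gauss \<alpha> Q) \<le> ?M * sqrt (sqnorm_gauss \<alpha> \<phi>)"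
      unfolding Q_def by (rule sqnorm_kernel_integral_le[OF \<alpha> \<phi>m \<phi>B \<phi>0])
    have [measurable]: "Q \<in> borel_measurable borel"
      using Q by (simp add: PH_space_2_iff pluriharmonic_borel_measurable)
    let ?N = "sqnorm_gauss \<alpha> \<phi>"
    have "of_real ?N = (\<integral>z. T f z * (\<phi> z * gauss \<alpha> z) \<partial>lborel)"
      by (subst integral_complex_of_real[symmetric])
        (auto intro!: Bochner_Integration.integral_cong simp: \<phi>_def complex_norm_square simp del: of_real_power
          split: split_indicator)
    also have "\<dots> = (\<integral>w. (f w * gauss \<alpha> w) * (\<integral>z. K_ph \<alpha> z w * (\<phi> z * gauss \<alpha> z) \<partial>lborel) \<partial>\<mu>)"
      unfolding T
    proof (rule kernel_integral_fubini[OF sets_mu \<alpha> sf mom[OF f]])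
      show "norm (\<phi> z * gauss \<alpha> z) \<le> B * 1" for z
        unfolding norm_mult using \<phi>B[of z] B(2) \<alpha> by (intro mult_mono) (auto simp: gauss_def)
      show "norm z > real k \<Longrightarrow> \<phi> z * gauss \<alpha> z = 0" for z by (simp add: \<phi>0)
    qed simp
    also have "\<dots> = (\<integral>w. f w * Q w * gauss \<alpha> w \<partial>\<mu>)"
      by (simp add: Q_def kernel_integral_def K_ph_commute[of \<alpha> _ "_ :: complex^'n"] mult_ac)
    finally have "of_real ?N = (\<integral>w. f w * Q w * gauss \<alpha> w \<partial>\<mu>)" .
    from arg_cong[OF this, of norm] have "?N = norm (\<integral>w. f w * Q w * gauss \<alpha> w \<partial>\<mu>)"
      unfolding norm_of_real abs_of_nonneg[OF sqnorm_gauss_nonneg] .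
    also have "\<dots> \<le> sqrt (\<integral>w. (norm (f w))\<^sup>2 * gauss \<alpha> w \<partial>\<mu>) * sqrt (\<integral>w. (norm (Q w))\<^sup>2 * gauss \<alpha> w \<partial>\<mu>)"
      by (rule norm_integral_mult_weighted_le) (use intC[OF f] intC[OF Q] in auto)
    \<comment> \<open>One factor \<open>C\<close> comes from \<open>f\<close>, the other from
      \<open>Q\<close>, and \<open>?M\<close> from the norm of the unnormalised projection. Dividing
      by \<open>sqrt ?N\<close> leaves a bound free of \<open>k\<close>.\<close>
    also have "\<dots> \<le> (C * sqrt (sqnorm_gauss \<alpha> f)) * (C * (?M * sqrt ?N))"
      using C by (intro mult_mono leC[OF f] order_trans[OF leC[OF Q]] mult_left_mono leQ)
        (auto simp: sqnorm_gauss_nonneg)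
    also have "\<dots> = ((C\<^sup>2 * ?M) * sqrt (sqnorm_gauss \<alpha> f)) * sqrt ?N" by (simp add: power2_eq_square mult_ac)
    finally have le: "?N \<le> ((C\<^sup>2 * ?M) * sqrt (sqnorm_gauss \<alpha> f)) * sqrt ?N" .
    have "?N \<le> ((C\<^sup>2 * ?M) * sqrt (sqnorm_gauss \<alpha> f))\<^sup>2"
    proof (cases "?N = 0")
      case False
      have N0: "0 < ?N" by (rule le_neq_trans[OF sqnorm_gauss_nonneg False[symmetric]])
      have "sqrt ?N * sqrt ?N \<le> ((C\<^sup>2 * ?M) * sqrt (sqnorm_gauss \<alpha> f)) * sqrt ?N"
        using le N0 by simp
      then have "sqrt ?N \<le> (C\<^sup>2 * ?M) * sqrt (sqnorm_gauss \<alpha> f)"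
        using N0 by (simp only: mult_le_cancel_right_pos real_sqrt_gt_0_iff)
      then have "(sqrt ?N)\<^sup>2 \<le> ((C\<^sup>2 * ?M) * sqrt (sqnorm_gauss \<alpha> f))\<^sup>2"
        using N0 by (intro power_mono) auto
      then show ?thesis using N0 by simp
    qed simp
    also have "\<dots> = (C\<^sup>2 * ?M)\<^sup>2 * sqnorm_gauss \<alpha> f"
      by (simp add: power_mult_distrib sqnorm_gauss_nonneg)
    also have "?N = (\<integral>z. (norm (T f z))\<^sup>2 * (indicator {..real k} (norm z) * gauss \<alpha> z) \<partial>lborel)"
      by (intro Bochner_Integration.integral_cong) (auto simp: \<phi>_def split: split_indicator)
    finally show ?thesis .
  qed
  have Tf: "integrable lborel (\<lambda>z. (norm (T f z))\<^sup>2 * gauss \<alpha> z)"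
    "sqnorm_gauss \<alpha> (T f) \<le> (C\<^sup>2 * ?M)\<^sup>2 * sqnorm_gauss \<alpha> f" if f: "f \<in> PH_space 2 \<alpha>" for f
  proof -
    have *: "integrable lborel (\<lambda>z. (norm (T f z))\<^sup>2 * (indicator {..real k} (norm z) * gauss \<alpha> z))" for k
      using integrable_continuous_truncated_gauss[OF continuous_on_power[OF continuous_on_norm[OF
        pluriharmonic_continuous[OF phT[OF f]]], where n = 2], of "real k" \<alpha>] by (simp add: mult.commute)
    have lim: "(\<lambda>k. (norm (T f z))\<^sup>2 * (indicator {..real k} (norm z) * gauss \<alpha> z)) \<longlonglongrightarrow> (norm (T f z))\<^sup>2 * gauss \<alpha> z" for z
    proof (rule tendsto_eventually)
      obtain n :: nat where "norm z \<le> real n" using real_arch_simple by blast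
      then show "\<forall>\<^sub>F k in sequentially. (norm (T f z))\<^sup>2 * (indicator {..real k} (norm z) * gauss \<alpha> z) = (norm (T f z))\<^sup>2 * gauss \<alpha> z"
        by (intro eventually_sequentiallyI[of n]) simp
    qed
    note limit = integrable_limit_of_bounded_integrals[OF * _ lim trunc[OF f] tendsto_const]
    show "integrable lborel (\<lambda>z. (norm (T f z))\<^sup>2 * gauss \<alpha> z)" by (rule limit(1)) simp
    show "sqnorm_gauss \<alpha> (T f) \<le> (C\<^sup>2 * ?M)\<^sup>2 * sqnorm_gauss \<alpha> f" by (rule limit(2)) simp
  qed
  have intK: "integrable \<mu> (\<lambda>w. K_ph \<alpha> z w * (f w * gauss \<alpha> w))" if f: "f \<in> PH_space 2 \<alpha>" for f z
    by (rule integrable_exp_moments[OF sets_mu mom[OF f], where C = 3 and c = "norm z / \<alpha>"])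
      (use norm_K_ph_le[OF \<alpha>, of z] in auto)
  have "bounded_operator_PH2 \<alpha> T"
    unfolding bounded_operator_PH2_def
  proof (intro conjI ballI allI)
    show "T f \<in> PH_space 2 \<alpha>" if "f \<in> PH_space 2 \<alpha>" for f
      using phT[OF that] Tf(1)[OF that] by (simp add: PH_space_2_iff)
    show "T (\<lambda>z. f z + g z) = (\<lambda>z. T f z + T g z)" if "f \<in> PH_space 2 \<alpha>" "g \<in> PH_space 2 \<alpha>" for f g
      unfolding T kernel_integral_def using intK[OF that(1)] intK[OF that(2)]
      by (simp add: distrib_left distrib_right)
    show "T (\<lambda>z. c * f z) = (\<lambda>z. c * T f z)" if "f \<in> PH_space 2 \<alpha>" for f c
      unfolding T kernel_integral_def by (simp add: mult.left_commute[of _ c] mult.assoc)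
    have "sqrt (sqnorm_gauss \<alpha> (T f)) \<le> (C\<^sup>2 * ?M) * sqrt (sqnorm_gauss \<alpha> f)" if "f \<in> PH_space 2 \<alpha>" for f
      using real_sqrt_le_mono[OF Tf(2)[OF that]] M by (simp add: real_sqrt_mult)
    then show "\<exists>C. \<forall>f\<in>PH_space 2 \<alpha>. Lp_norm 2 \<alpha> (T f) \<le> C * Lp_norm 2 \<alpha> f"
      unfolding Lp_norm_2_le_iff[OF \<alpha>] by blast
  qed
  then show ?thesis unfolding toeplitz_bounded_def T_def by blast
qed

section \<open>From the kernel span to the whole space\<close>

lemma tendsto_K_ph:
  assumes "s \<longlonglongrightarrow> w"
  shows "(\<lambda>i. K_ph \<alpha> z (s i)) \<longlonglongrightarrow> K_ph \<alpha> z w"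
  by (rule continuous_on_tendsto_compose[of UNIV "K_ph \<alpha> z"]) (auto intro!: continuous_intros assms)

text \<open>A Riemann sum: only the kernel's second argument is discretised, so the integral becomes
  a finite combination of kernels centred at the values of \<open>s\<close>, weighted by the
  integrals of \<phi> over its level sets.\<close>

lemma kernel_integral_simple_function:
  fixes \<phi> :: "complex^'n \<Rightarrow> complex"
  assumes s: "simple_function lborel s" and \<phi>: "integrable lborel \<phi>"
  shows "(\<integral>w. K_ph \<alpha> z (s w) * \<phi> w \<partial>lborel)
    = (\<Sum>a\<in>range s. (\<integral>w. indicator (s -` {a}) w *\<^sub>R \<phi> w \<partial>lborel) * K_ph \<alpha> z a)"
proof -
  have fin: "finite (range s)" using simple_functionD(1)[OF s] by simp
  have meas: "s -` {a} \<in> sets lborel" for a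
    using simple_functionD(2)[OF s, of "{a}"] by simp
  have int: "integrable lborel (\<lambda>w. indicator (s -` {a}) w *\<^sub>R \<phi> w)" for a
    by (rule integrable_mult_indicator[OF meas \<phi>])
  have "K_ph \<alpha> z (s w) * \<phi> w = (\<Sum>a\<in>range s. (indicator (s -` {a}) w *\<^sub>R \<phi> w) * K_ph \<alpha> z a)" for w
  proof -
    have "(\<Sum>a\<in>range s. (indicator (s -` {a}) w *\<^sub>R \<phi> w) * K_ph \<alpha> z a)
        = (\<Sum>a\<in>range s. if a = s w then \<phi> w * K_ph \<alpha> z a else 0)"
      by (intro sum.cong) (auto split: split_indicator)
    then show ?thesis using fin by (simp add: mult.commute)
  qed
  then have "(\<integral>w. K_ph \<alpha> z (s w) * \<phi> w \<partial>lborel)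
      = (\<integral>w. (\<Sum>a\<in>range s. (indicator (s -` {a}) w *\<^sub>R \<phi> w) * K_ph \<alpha> z a) \<partial>lborel)" by simp
  also have "\<dots> = (\<Sum>a\<in>range s. (\<integral>w. (indicator (s -` {a}) w *\<^sub>R \<phi> w) * K_ph \<alpha> z a \<partial>lborel))"
    by (rule Bochner_Integration.integral_sum) (intro integrable_mult_left int)
  finally show ?thesis by (simp only: integral_mult_left_zero)
qed

context
  fixes \<mu> :: "(complex^'n) measure" and \<alpha> C :: real
  assumes \<alpha>: "\<alpha> > 0" and sets_mu [measurable_cong]: "sets \<mu> = sets borel"
    and span: "\<And>W c. finite W \<Longrightarrow>
      integrable \<mu> (\<lambda>z. (norm (\<Sum>w\<in>W. c w * K_ph \<alpha> z w))\<^sup>2 * gauss \<alpha> z) \<and>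
      (\<integral>z. (norm (\<Sum>w\<in>W. c w * K_ph \<alpha> z w))\<^sup>2 * gauss \<alpha> z \<partial>\<mu>)
        \<le> C * sqnorm_gauss \<alpha> (\<lambda>z. \<Sum>w\<in>W. c w * K_ph \<alpha> z w)"
begin

text \<open>The Riemann sums \<open>q i\<close> lie in the span and converge pointwise to
  \<open>Q\<close>. For Lebesgue measure their norms converge too, by dominated convergence under a
  growth bound uniform in \<open>i\<close>; for \<mu> Fatou's lemma suffices.\<close>

lemma kernel_integral_embedding:
  fixes \<phi> :: "complex^'n \<Rightarrow> complex"
  assumes \<phi> [measurable]: "\<phi> \<in> borel_measurable borel" and B: "\<And>z. norm (\<phi> z) \<le> B"
    and supp: "\<And>z. norm z > R \<Longrightarrow> \<phi> z = 0"
  defines "Q \<equiv> kernel_integral lborel \<alpha> (\<lambda>z. \<phi> z * gauss \<alpha> z)"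
  shows "integrable \<mu> (\<lambda>z. (norm (Q z))\<^sup>2 * gauss \<alpha> z)"
    and "(\<integral>z. (norm (Q z))\<^sup>2 * gauss \<alpha> z \<partial>\<mu>) \<le> C * sqnorm_gauss \<alpha> Q"
proof -
  \<comment> \<open>Taking 0 as the reference point of the approximation gives the bound by
    \<open>2 * norm w\<close>, which keeps the relevant kernel centres within radius
    \<open>2 * R\<close>.\<close>
  obtain s where s: "\<And>i. simple_function lborel (s i)" "\<And>w. (\<lambda>i. s i w) \<longlonglongrightarrow> w"
    "\<And>i w. norm (s i w) \<le> 2 * norm (w :: complex^'n)"
    using borel_measurable_implies_sequence_metric[of "\<lambda>w::complex^'n. w" lborel 0] by (auto simp: dist_norm)
  have [measurable]: "s i \<in> borel_measurable borel" for i
    using borel_measurable_simple_function[OF s(1)] by simp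
  define q where "q = (\<lambda>i z. \<integral>w. K_ph \<alpha> z (s i w) * (\<phi> w * gauss \<alpha> w) \<partial>lborel)"
  have \<phi>R: "norm w \<le> R" if "\<phi> w \<noteq> 0" for w using supp[of w] that by force
  have sR: "norm (s i w) \<le> 2 * R" if "\<phi> w \<noteq> 0" for i w using s(3)[of i w] \<phi>R[OF that] by linarith
  note bd = norm_kernel_integral_truncated_le[OF \<alpha> \<phi> B]
  let ?b = "\<lambda>z::complex^'n. (3 * B * gauss_mass \<alpha> TYPE('n)) * exp ((2 * R / \<alpha>) * norm z)"
  have qb: "norm (q i z) \<le> ?b z" for i z
    unfolding q_def by (rule bd(2)) (use sR in blast)
  have int\<phi>: "integrable lborel (\<lambda>w. \<phi> w * gauss \<alpha> w)"
    using integrable_exp_growth_gauss[OF \<alpha> \<phi>, of B 0] B by (simp add: scaleR_conv_of_real mult.commute)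
  have q_span: "q i = (\<lambda>z. \<Sum>a\<in>range (s i). (\<integral>w. indicator (s i -` {a}) w *\<^sub>R (\<phi> w * gauss \<alpha> w) \<partial>lborel) * K_ph \<alpha> z a)" for i
    unfolding q_def by (rule ext) (rule kernel_integral_simple_function[OF s(1) int\<phi>])
  have fin: "finite (range (s i))" for i using simple_functionD(1)[OF s(1)[of i]] by simp
  have qPH: "q i \<in> PH_space 2 \<alpha>" for i
    unfolding q_span by (rule kernel_span_subset_PH_space[OF \<alpha> fin])
  have q_bound: "integrable \<mu> (\<lambda>z. (norm (q i z))\<^sup>2 * gauss \<alpha> z)"
    "(\<integral>z. (norm (q i z))\<^sup>2 * gauss \<alpha> z \<partial>\<mu>) \<le> C * sqnorm_gauss \<alpha> (q i)" for i
    unfolding q_span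
    using span[OF fin[of i], of "\<lambda>a. \<integral>w. indicator (s i -` {a}) w *\<^sub>R (\<phi> w * gauss \<alpha> w) \<partial>lborel"]
    by simp_all
  have q_lim: "(\<lambda>i. q i z) \<longlonglongrightarrow> Q z" for z
    unfolding q_def Q_def kernel_integral_def
  proof (rule integral_dominated_convergence)
    show "integrable lborel (\<lambda>w::complex^'n. (3 * B * exp ((2 * R / \<alpha>) * norm z)) * gauss \<alpha> w)"
      by (intro integrable_mult_right integrable_gauss \<alpha>)
    show "AE w in lborel. (\<lambda>i. K_ph \<alpha> z (s i w) * (\<phi> w * gauss \<alpha> w)) \<longlonglongrightarrow> K_ph \<alpha> z w * (\<phi> w * gauss \<alpha> w)"
      by (intro AE_I2 tendsto_mult_right tendsto_K_ph s(2))
    show "AE w in lborel. norm (K_ph \<alpha> z (s i w) * (\<phi> w * gauss \<alpha> w)) \<le> (3 * B * exp ((2 * R / \<alpha>) * norm z)) * gauss \<alpha> w" for i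
      by (intro AE_I2 bd(1)) (use sR in blast)
  qed measurable
  have "Q \<in> PH_space 2 \<alpha>" unfolding Q_def by (rule kernel_integral_in_PH_space[OF \<alpha> \<phi> B supp])
  then have [measurable]: "Q \<in> borel_measurable borel" "q i \<in> borel_measurable borel" for i
    using qPH[of i] by (simp_all add: PH_space_2_iff pluriharmonic_borel_measurable)
  have norm_lim: "(\<lambda>i. sqnorm_gauss \<alpha> (q i)) \<longlonglongrightarrow> sqnorm_gauss \<alpha> Q"
  proof (rule integral_dominated_convergence)
    show "integrable lborel (\<lambda>z. (norm (of_real (?b z) :: complex))\<^sup>2 * gauss \<alpha> z)"
      by (rule integrable_square_exp_growth_gauss[OF \<alpha>, where C = "\<bar>3 * B * gauss_mass \<alpha> TYPE('n)\<bar>" and c = "2 * R / \<alpha>"])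
        (simp_all add: norm_mult abs_mult)
    show "AE z in lborel. (\<lambda>i. (norm (q i z))\<^sup>2 * gauss \<alpha> z) \<longlonglongrightarrow> (norm (Q z))\<^sup>2 * gauss \<alpha> z"
      by (intro AE_I2 tendsto_intros q_lim)
    show "AE z in lborel. norm ((norm (q i z))\<^sup>2 * gauss \<alpha> z) \<le> (norm (of_real (?b z) :: complex))\<^sup>2 * gauss \<alpha> z" for i
    proof (rule AE_I2)
      fix z :: "complex^'n"
      have "(norm (q i z))\<^sup>2 \<le> (norm (of_real (?b z) :: complex))\<^sup>2"
        unfolding norm_of_real by (intro power_mono order_trans[OF qb abs_ge_self]) simp
      then show "norm ((norm (q i z))\<^sup>2 * gauss \<alpha> z) \<le> (norm (of_real (?b z) :: complex))\<^sup>2 * gauss \<alpha> z"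
        using mult_right_mono[of _ _ "gauss \<alpha> z"] by (simp only: real_norm_def abs_mult abs_of_nonneg gauss_pos(2) zero_le_power2)
    qed
  qed measurable
  have lim: "(\<lambda>i. (norm (q i z))\<^sup>2 * gauss \<alpha> z) \<longlonglongrightarrow> (norm (Q z))\<^sup>2 * gauss \<alpha> z" for z
    by (intro tendsto_intros q_lim)
  note limit = integrable_limit_of_bounded_integrals[OF q_bound(1) _ lim q_bound(2) tendsto_mult_left[OF norm_lim]]
  show "integrable \<mu> (\<lambda>z. (norm (Q z))\<^sup>2 * gauss \<alpha> z)" by (rule limit(1)) simp
  show "(\<integral>z. (norm (Q z))\<^sup>2 * gauss \<alpha> z \<partial>\<mu>) \<le> C * sqnorm_gauss \<alpha> Q" by (rule limit(2)) simp
qed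

text \<open>The projections \<open>Q k\<close> of truncations of \<open>f\<close> have norm at most
  that of \<open>f\<close> and converge pointwise to \<open>f\<close>, by the reproducing formula
  and dominated convergence.\<close>

lemma embedding_of_kernel_span:
  fixes f :: "complex^'n \<Rightarrow> complex"
  assumes C: "C \<ge> 0" and f: "f \<in> PH_space 2 \<alpha>"
  shows "integrable \<mu> (\<lambda>z. (norm (f z))\<^sup>2 * gauss \<alpha> z)"
    and "(\<integral>z. (norm (f z))\<^sup>2 * gauss \<alpha> z \<partial>\<mu>) \<le> C * sqnorm_gauss \<alpha> f"
proof -
  let ?M = "gauss_mass \<alpha> TYPE('n)"
  have M: "?M > 0" by (rule gauss_mass_pos[OF \<alpha>])
  have ph: "pluriharmonic f" and L2: "integrable lborel (\<lambda>z. (norm (f z))\<^sup>2 * gauss \<alpha> z)"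
    using f by (simp_all add: PH_space_2_iff)
  have [measurable]: "f \<in> borel_measurable borel" by (rule pluriharmonic_borel_measurable[OF ph])
  \<comment> \<open>Division by \<open>?M\<close> cancels the mass both in the reproducing formula
    and in the norm estimate of the projection.\<close>
  define \<phi> where "\<phi> = (\<lambda>(k::nat) z. indicator {..real k} (norm z) * f z / ?M)"
  have \<phi>m [measurable]: "\<phi> k \<in> borel_measurable borel" for k unfolding \<phi>_def by measurable
  define Q where "Q = (\<lambda>k. kernel_integral lborel \<alpha> (\<lambda>z. \<phi> k z * gauss \<alpha> z))"
  have bd: "\<exists>B. \<forall>z. norm (\<phi> k z) \<le> B" for k
  proof -
    have "compact (f ` cball 0 (real k))"
      by (intro compact_continuous_image pluriharmonic_continuous ph compact_cball)
    then obtain B where B: "\<And>z. norm z \<le> real k \<Longrightarrow> norm (f z) \<le> B" "B > 0"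
      by (force dest!: compact_imp_bounded simp: bounded_pos)
    have "norm (\<phi> k z) \<le> B / ?M" for z
      using B M by (auto simp: \<phi>_def norm_mult norm_divide divide_right_mono split: split_indicator)
    then show ?thesis by blast
  qed
  have supp: "norm z > real k \<Longrightarrow> \<phi> k z = 0" for z k by (simp add: \<phi>_def)
  have Q: "integrable \<mu> (\<lambda>z. (norm (Q k z))\<^sup>2 * gauss \<alpha> z)"
    "(\<integral>z. (norm (Q k z))\<^sup>2 * gauss \<alpha> z \<partial>\<mu>) \<le> C * sqnorm_gauss \<alpha> f" for k
  proof -
    obtain B where B: "\<And>z. norm (\<phi> k z) \<le> B" using bd by blast
    show "integrable \<mu> (\<lambda>z. (norm (Q k z))\<^sup>2 * gauss \<alpha> z)"
      unfolding Q_def by (rule kernel_integral_embedding(1)[OF \<phi>m B supp])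
    have "(\<integral>z. (norm (Q k z))\<^sup>2 * gauss \<alpha> z \<partial>\<mu>) \<le> C * sqnorm_gauss \<alpha> (Q k)"
      unfolding Q_def by (rule kernel_integral_embedding(2)[OF \<phi>m B supp])
    also have "sqnorm_gauss \<alpha> (Q k) \<le> sqnorm_gauss \<alpha> f"
    proof -
      have "sqrt (sqnorm_gauss \<alpha> (Q k)) \<le> ?M * sqrt (sqnorm_gauss \<alpha> (\<phi> k))"
        unfolding Q_def by (rule sqnorm_kernel_integral_le[OF \<alpha> \<phi>m B supp])
      also have "sqnorm_gauss \<alpha> (\<phi> k) \<le> (\<integral>z. (norm (f z))\<^sup>2 * gauss \<alpha> z / ?M\<^sup>2 \<partial>lborel)"
      proof (rule Bochner_Integration.integral_mono')
        show "integrable lborel (\<lambda>z. (norm (f z))\<^sup>2 * gauss \<alpha> z / ?M\<^sup>2)"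
          by (intro integrable_divide L2)
      qed (auto simp: \<phi>_def norm_divide power_divide split: split_indicator)
      also have "\<dots> = sqnorm_gauss \<alpha> f / ?M\<^sup>2" by simp
      finally have "sqrt (sqnorm_gauss \<alpha> (Q k)) \<le> ?M * sqrt (sqnorm_gauss \<alpha> f / ?M\<^sup>2)"
        using M by (simp add: mult_left_mono)
      then show ?thesis using M by (simp add: real_sqrt_divide)
    qed
    finally show "(\<integral>z. (norm (Q k z))\<^sup>2 * gauss \<alpha> z \<partial>\<mu>) \<le> C * sqnorm_gauss \<alpha> f"
      using C by (simp add: mult_left_mono)
  qed
  have "(\<lambda>k. Q k z) \<longlonglongrightarrow> f z" for z
  proof -
    have int: "integrable lborel (\<lambda>w. f w * K_ph \<alpha> z w * gauss \<alpha> w)"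
      by (intro integrable_mult_weighted L2 integrable_square_K_ph \<alpha>) auto
    have "(\<lambda>k. \<integral>w. K_ph \<alpha> z w * (\<phi> k w * gauss \<alpha> w) \<partial>lborel)
        \<longlonglongrightarrow> (\<integral>w. f w * K_ph \<alpha> z w * gauss \<alpha> w / ?M \<partial>lborel)"
    proof (rule integral_dominated_convergence)
      show "integrable lborel (\<lambda>w. norm (f w * K_ph \<alpha> z w * gauss \<alpha> w / ?M))"
        by (intro integrable_norm integrable_divide int)
      show "AE w in lborel. (\<lambda>k. K_ph \<alpha> z w * (\<phi> k w * gauss \<alpha> w)) \<longlonglongrightarrow> f w * K_ph \<alpha> z w * gauss \<alpha> w / ?M"
      proof (intro AE_I2 tendsto_eventually)
        fix w :: "complex^'n"
        obtain n :: nat where "norm w \<le> real n" using real_arch_simple by blast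
        then show "\<forall>\<^sub>F k in sequentially. K_ph \<alpha> z w * (\<phi> k w * gauss \<alpha> w) = f w * K_ph \<alpha> z w * gauss \<alpha> w / ?M"
          by (intro eventually_sequentiallyI[of n]) (simp add: \<phi>_def)
      qed
      show "AE w in lborel. norm (K_ph \<alpha> z w * (\<phi> k w * gauss \<alpha> w)) \<le> norm (f w * K_ph \<alpha> z w * gauss \<alpha> w / ?M)" for k
        using M by (intro AE_I2) (auto simp: \<phi>_def norm_mult norm_divide mult_ac split: split_indicator)
    qed measurable
    moreover have "(\<integral>w. f w * K_ph \<alpha> z w * gauss \<alpha> w / ?M \<partial>lborel) = f z"
      using pluriharmonic_reproducing[OF \<alpha> ph L2, of z] M by simp
    ultimately show ?thesis by (simp add: Q_def kernel_integral_def)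
  qed
  then have lim: "(\<lambda>k. (norm (Q k z))\<^sup>2 * gauss \<alpha> z) \<longlonglongrightarrow> (norm (f z))\<^sup>2 * gauss \<alpha> z" for z
    by (intro tendsto_intros)
  note limit = integrable_limit_of_bounded_integrals[OF Q(1) _ lim Q(2) tendsto_const]
  show "integrable \<mu> (\<lambda>z. (norm (f z))\<^sup>2 * gauss \<alpha> z)" by (rule limit(1)) simp
  show "(\<integral>z. (norm (f z))\<^sup>2 * gauss \<alpha> z \<partial>\<mu>) \<le> C * sqnorm_gauss \<alpha> f" by (rule limit(2)) simp
qed

end

text \<open>For \<open>f\<close> in the span of the kernels, the reproducing property identifies the squared norm of \<open>f\<close> in
  \<open>L\<^sup>2(\<mu>)\<close> with the inner product of \<open>T f\<close> and \<open>f\<close>.\<close>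

lemma toeplitz_quadratic_form:
  fixes \<mu> :: "(complex^'n) measure" and c :: "complex^'n \<Rightarrow> complex"
  assumes \<alpha>: "\<alpha> > 0" and sets_mu: "sets \<mu> = sets borel"
    and K: "\<And>z. integrable \<mu> (\<lambda>w. (norm (K_ph \<alpha> z w))\<^sup>2 * gauss \<alpha> w)"
    and W: "finite W"
  defines "f \<equiv> \<lambda>z. \<Sum>w\<in>W. c w * K_ph \<alpha> z w"
  assumes T: "toeplitz \<alpha> \<mu> f \<in> PH_space 2 \<alpha>"
  shows "integrable \<mu> (\<lambda>z. (norm (f z))\<^sup>2 * gauss \<alpha> z)"
    and "gauss_mass \<alpha> TYPE('n) * (\<integral>z. (norm (f z))\<^sup>2 * gauss \<alpha> z \<partial>\<mu>)
      \<le> sqrt (sqnorm_gauss \<alpha> (toeplitz \<alpha> \<mu> f)) * sqrt (sqnorm_gauss \<alpha> f)"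
proof -
  note [measurable_cong] = sets_mu
  let ?M = "gauss_mass \<alpha> TYPE('n)"
  let ?T = "toeplitz \<alpha> \<mu> f"
  have M: "?M > 0" by (rule gauss_mass_pos[OF \<alpha>])
  have f_PH: "f \<in> PH_space 2 \<alpha>" unfolding f_def by (rule kernel_span_subset_PH_space[OF \<alpha> W])
  have [measurable]: "f \<in> borel_measurable borel" "?T \<in> borel_measurable borel"
    using f_PH T by (simp_all add: PH_space_2_iff pluriharmonic_borel_measurable)
  have L2f: "integrable lborel (\<lambda>z. (norm (f z))\<^sup>2 * gauss \<alpha> z)"
    and phT: "pluriharmonic ?T" and L2T: "integrable lborel (\<lambda>z. (norm (?T z))\<^sup>2 * gauss \<alpha> z)"
    using f_PH T by (simp_all add: PH_space_2_iff)
  \<comment> \<open>The integrability hypothesis concerns the second argument of the kernel, whereas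
    \<open>f\<close> varies in the first.\<close>
  have Kflip: "K_ph \<alpha> z w = K_ph \<alpha> w z" for z w :: "complex^'n" by (rule K_ph_commute)
  have Km: "(\<lambda>z. K_ph \<alpha> z w) \<in> borel_measurable borel" for w :: "complex^'n"
    unfolding Kflip[of _ w] by measurable
  show L2mu: "integrable \<mu> (\<lambda>z. (norm (f z))\<^sup>2 * gauss \<alpha> z)"
    unfolding f_def using W
  proof (induction W)
    case (insert a W)
    have "integrable \<mu> (\<lambda>z. (norm (c a))\<^sup>2 * ((norm (K_ph \<alpha> a z))\<^sup>2 * gauss \<alpha> z))"
      by (intro integrable_mult_right K)
    then have "integrable \<mu> (\<lambda>z. (norm (c a * K_ph \<alpha> z a))\<^sup>2 * gauss \<alpha> z)"
      by (simp add: norm_mult power_mult_distrib mult.assoc Kflip[of _ a])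
    moreover have "(\<lambda>z. \<Sum>w\<in>W. c w * K_ph \<alpha> z w) \<in> borel_measurable \<mu>"
      using Km by (auto intro!: borel_measurable_sum borel_measurable_times)
    moreover have "(\<lambda>z. c a * K_ph \<alpha> z a) \<in> borel_measurable \<mu>"
      using Km by (auto intro!: borel_measurable_times)
    ultimately show ?case
      using insert integrable_add_square_weighted[of "\<lambda>z. c a * K_ph \<alpha> z a" \<mu> "\<lambda>z. \<Sum>w\<in>W. c w * K_ph \<alpha> z w" "gauss \<alpha>"]
      by simp
  qed simp
  have cnj_f: "cnj (f w) = (\<Sum>a\<in>W. cnj (c a) * K_ph \<alpha> a w)" for w
    by (simp add: f_def cnj_K_ph Kflip[of w])
  have intT: "integrable \<mu> (\<lambda>w. f w * K_ph \<alpha> a w * gauss \<alpha> w)" for a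
    by (intro integrable_mult_weighted L2mu K) auto
  have intr: "integrable lborel (\<lambda>w. ?T w * K_ph \<alpha> a w * gauss \<alpha> w)" for a
    by (intro integrable_mult_weighted L2T integrable_square_K_ph \<alpha>) auto
  \<comment> \<open>Stated for any measure, because it is used once for \<mu> and \<open>f\<close>
    and once for \<open>lborel\<close> and \<open>?T\<close>.\<close>
  have pair: "(\<integral>w. g w * cnj (f w) * gauss \<alpha> w \<partial>\<nu>) = (\<Sum>a\<in>W. cnj (c a) * (\<integral>w. g w * K_ph \<alpha> a w * gauss \<alpha> w \<partial>\<nu>))"
    if "\<And>a. integrable \<nu> (\<lambda>w. g w * K_ph \<alpha> a w * gauss \<alpha> w)" for g and \<nu> :: "(complex^'n) measure"
  proof -
    have "g w * cnj (f w) * gauss \<alpha> w = (\<Sum>a\<in>W. cnj (c a) * (g w * K_ph \<alpha> a w * gauss \<alpha> w))" for w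
      unfolding cnj_f sum_distrib_left sum_distrib_right by (simp add: mult_ac)
    then show ?thesis using that by simp
  qed
  have T_eq: "(\<integral>w. f w * K_ph \<alpha> a w * gauss \<alpha> w \<partial>\<mu>) = ?T a" for a
    by (simp add: toeplitz_eq_kernel_integral kernel_integral_def mult_ac)
  have "of_real (\<integral>z. (norm (f z))\<^sup>2 * gauss \<alpha> z \<partial>\<mu>) = (\<integral>w. f w * cnj (f w) * gauss \<alpha> w \<partial>\<mu>)"
    by (subst integral_complex_of_real[symmetric])
      (auto intro!: Bochner_Integration.integral_cong simp: complex_norm_square simp del: of_real_power)
  also have "\<dots> = (\<Sum>a\<in>W. cnj (c a) * ?T a)" unfolding pair[OF intT] T_eq ..
  \<comment> \<open>Both pairings reduce to values of \<open>?T\<close> at the centres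
    \<open>a\<close>: for \<mu> by the definition of the operator, for Lebesgue measure by the
    reproducing formula, which adds the factor \<open>?M\<close>.\<close>
  finally have "of_real (?M * (\<integral>z. (norm (f z))\<^sup>2 * gauss \<alpha> z \<partial>\<mu>)) = (\<Sum>a\<in>W. cnj (c a) * (?M * ?T a))"
    by (simp add: sum_distrib_left mult_ac)
  also have "\<dots> = (\<integral>w. ?T w * cnj (f w) * gauss \<alpha> w \<partial>lborel)"
    unfolding pair[OF intr] pluriharmonic_reproducing[OF \<alpha> phT L2T] ..
  finally have eq: "of_real (?M * (\<integral>z. (norm (f z))\<^sup>2 * gauss \<alpha> z \<partial>\<mu>)) = (\<integral>w. ?T w * cnj (f w) * gauss \<alpha> w \<partial>lborel)" .
  have "?M * (\<integral>z. (norm (f z))\<^sup>2 * gauss \<alpha> z \<partial>\<mu>) \<le> norm (\<integral>w. ?T w * cnj (f w) * gauss \<alpha> w \<partial>lborel)"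
    unfolding eq[symmetric] norm_of_real by (rule abs_ge_self)
  also have "\<dots> \<le> sqrt (sqnorm_gauss \<alpha> ?T) * sqrt (\<integral>w. (norm (cnj (f w)))\<^sup>2 * gauss \<alpha> w \<partial>lborel)"
    by (rule norm_integral_mult_weighted_le) (use L2T L2f in auto)
  finally show "?M * (\<integral>z. (norm (f z))\<^sup>2 * gauss \<alpha> z \<partial>\<mu>) \<le> sqrt (sqnorm_gauss \<alpha> ?T) * sqrt (sqnorm_gauss \<alpha> f)"
    by simp
qed

section \<open>The Carleson inequality from boundedness of the Toeplitz operator\<close>

lemma toeplitz_bounded_imp_carleson:
  fixes \<mu> :: "(complex^'n) measure"
  assumes \<alpha>: "\<alpha> > 0" and sets_mu: "sets \<mu> = sets borel"
    and K: "\<And>z. integrable \<mu> (\<lambda>w. (norm (K_ph \<alpha> z w))\<^sup>2 * gauss \<alpha> w)"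
    and bounded: "toeplitz_bounded \<alpha> \<mu>"
  shows "carleson 2 \<alpha> \<mu>"
proof -
  let ?M = "gauss_mass \<alpha> TYPE('n)"
  have M: "?M > 0" by (rule gauss_mass_pos[OF \<alpha>])
  obtain S where S: "bounded_operator_PH2 \<alpha> S" "\<And>f. f \<in> kernel_span \<alpha> \<Longrightarrow> S f = toeplitz \<alpha> \<mu> f"
    using bounded unfolding toeplitz_bounded_def by blast
  obtain C where C: "\<And>f. f \<in> PH_space 2 \<alpha> \<Longrightarrow> Lp_norm 2 \<alpha> (S f) \<le> C * Lp_norm 2 \<alpha> f"
    using S(1) unfolding bounded_operator_PH2_def by blast
  \<comment> \<open>The operator bound comes without a sign, hence the absolute value;
    \<open>?M\<close> is the factor in the quadratic form. \<open>D\<close> bounds squared norms, so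
    its square root appears at the end.\<close>
  define D where "D = \<bar>C\<bar> / ?M"
  have span: "integrable \<mu> (\<lambda>z. (norm (\<Sum>w\<in>W. c w * K_ph \<alpha> z w))\<^sup>2 * gauss \<alpha> z) \<and>
      (\<integral>z. (norm (\<Sum>w\<in>W. c w * K_ph \<alpha> z w))\<^sup>2 * gauss \<alpha> z \<partial>\<mu>)
        \<le> D * sqnorm_gauss \<alpha> (\<lambda>z. \<Sum>w\<in>W. c w * K_ph \<alpha> z w)" if W: "finite W" for W and c :: "complex^'n \<Rightarrow> complex"
  proof -
    let ?f = "\<lambda>z. \<Sum>w\<in>W. c w * K_ph \<alpha> z w"
    have f: "?f \<in> PH_space 2 \<alpha>" by (rule kernel_span_subset_PH_space[OF \<alpha> W])
    have Sf: "S ?f = toeplitz \<alpha> \<mu> ?f" using W by (intro S(2)) (auto simp: kernel_span_def)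
    then have T: "toeplitz \<alpha> \<mu> ?f \<in> PH_space 2 \<alpha>"
      using S(1) f unfolding bounded_operator_PH2_def by metis
    have "sqrt (sqnorm_gauss \<alpha> (toeplitz \<alpha> \<mu> ?f)) \<le> C * sqrt (sqnorm_gauss \<alpha> ?f)"
      using C[OF f] unfolding Sf Lp_norm_2_le_iff[OF \<alpha>] .
    also have "\<dots> \<le> \<bar>C\<bar> * sqrt (sqnorm_gauss \<alpha> ?f)"
      by (intro mult_right_mono) (auto simp: sqnorm_gauss_nonneg)
    finally have "sqrt (sqnorm_gauss \<alpha> (toeplitz \<alpha> \<mu> ?f)) * sqrt (sqnorm_gauss \<alpha> ?f)
        \<le> \<bar>C\<bar> * sqrt (sqnorm_gauss \<alpha> ?f) * sqrt (sqnorm_gauss \<alpha> ?f)"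
      by (intro mult_right_mono) (auto simp: sqnorm_gauss_nonneg)
    with toeplitz_quadratic_form(2)[OF \<alpha> sets_mu K W T]
    have "?M * (\<integral>z. (norm (?f z))\<^sup>2 * gauss \<alpha> z \<partial>\<mu>) \<le> \<bar>C\<bar> * sqnorm_gauss \<alpha> ?f"
      by (simp add: sqnorm_gauss_nonneg mult.assoc)
    then show ?thesis
      using toeplitz_quadratic_form(1)[OF \<alpha> sets_mu K W T] M
      by (simp add: D_def pos_le_divide_eq mult.commute)
  qed
  have D: "0 \<le> D" using M by (simp add: D_def)
  note emb = embedding_of_kernel_span[OF \<alpha> sets_mu span D]
  show ?thesis
    unfolding carleson_2_iff[OF \<alpha>]
  \<comment> \<open>The added 1 provides the strictly positive constant that \<open>carleson\<close>
    asks for, since \<open>D\<close> may be 0.\<close>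
  proof (intro exI[of _ "sqrt D + 1"] conjI ballI)
    show "sqrt D + 1 > 0" using D by (intro add_nonneg_pos) auto
    fix f :: "complex^'n \<Rightarrow> complex" assume f: "f \<in> PH_space 2 \<alpha>"
    show "integrable \<mu> (\<lambda>z. (norm (f z))\<^sup>2 * gauss \<alpha> z)" by (rule emb(1)[OF _ f])
    have "sqrt (\<integral>z. (norm (f z))\<^sup>2 * gauss \<alpha> z \<partial>\<mu>) \<le> sqrt D * sqrt (sqnorm_gauss \<alpha> f)"
      unfolding real_sqrt_mult[symmetric] by (intro real_sqrt_le_mono emb(2)[OF _ f])
    also have "\<dots> \<le> (sqrt D + 1) * sqrt (sqnorm_gauss \<alpha> f)"
      by (intro mult_right_mono) (auto simp: sqnorm_gauss_nonneg)
    finally show "sqrt (\<integral>z. (norm (f z))\<^sup>2 * gauss \<alpha> z \<partial>\<mu>) \<le> (sqrt D + 1) * sqrt (sqnorm_gauss \<alpha> f)" .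
  qed
qed

theorem proposition3p1:
  fixes \<alpha> :: real and \<mu> :: "(complex^'n) measure"
  assumes "\<alpha> > 0"
    and "sets \<mu> = sets borel"
    and "\<And>z. (\<integral>\<^sup>+w. ennreal ((norm (K_ph \<alpha> z w))\<^sup>2 * exp (- (norm w)\<^sup>2 / \<alpha>)) \<partial>\<mu>) < \<infinity>"
  shows "toeplitz_bounded \<alpha> \<mu> \<longleftrightarrow> carleson 2 \<alpha> \<mu>"
proof
  assume "carleson 2 \<alpha> \<mu>"
  then show "toeplitz_bounded \<alpha> \<mu>" by (rule carleson_imp_toeplitz_bounded[OF assms(1,2)])
next
  note [measurable_cong] = assms(2)
  have "integrable \<mu> (\<lambda>w. (norm (K_ph \<alpha> z w))\<^sup>2 * gauss \<alpha> w)" for z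
    by (rule integrableI_bounded) (use assms(3)[of z] in \<open>simp_all add: gauss_def\<close>)
  moreover assume "toeplitz_bounded \<alpha> \<mu>"
  ultimately show "carleson 2 \<alpha> \<mu>" by (rule toeplitz_bounded_imp_carleson[OF assms(1,2)])
qed

end
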